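(* Fix parameters $0<w\le 1$ and $0<\delta\le 1$. Let $v\colon \mathbb{R}^2\to[0,1]$ be a function depending only on the horizontal variable, i.e. $v(a,b)=v(a)$. Let $\mathcal{R}_\delta$ be the collection of all rectangles $R$ of width $w$ such that $|V_R|\ge \delta |R|$. Then for every $f\in L^2(\mathbb{R}^2)$, $$\|M_{\mathcal{R}_\delta} f\|_{2}\le C\left(\log \tfrac{1}{\delta}\right)^{3/2}\|f\|_{2},$$ where $C$ is a universal constant (independent of $w$, $\delta$, $v$ and $f$).
   Context: For a collection of rectangles $\mathcal{R}$ in $\mathbb{R}^2$, the maximal operator is $M_{\mathcal{R}} f(x)=\sup_{x\in R\in\mathcal{R}} \frac{1}{|R|}\int_R f$. For a rectangle $R$, $L(R)$ denotes its length (long side), $w(R)$ its width (short side), and $\theta(R)$ is the interval of width $w(R)/L(R)$ centered at the slope of the long side of $R$. Given the slope field $v$, $V_R=\{p\in R: v(p)\in\theta(R)\}$. $|\cdot|$ denotes Lebesgue measure.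
   Formalization: The factor log(1/δ) is replaced by 1+log(1/δ), since the bound as written fails at and near δ=1 (it would force the maximal function to vanish); v is assumed Lebesgue measurable so that |V_R| is defined. *)

theory Defs
  imports "HOL-Analysis.Analysis"
begin

text \<open>A rectangle is encoded as a tuple (c, phi, L, w): centre c, angle phi of the
  long side (unit direction (cos phi, sin phi)), length L (long side) and width w
  (short side), with w \<le> L. The point set is the open rectangle.\<close>

type_synonym rect_data = "(real \<times> real) \<times> real \<times> real \<times> real"

definition rect_set :: "rect_data \<Rightarrow> (real \<times> real) set" where
  "rect_set R = (case R of (c, phi, L, w) \<Rightarrow>
     {p. \<bar>(p - c) \<bullet> (cos phi, sin phi)\<bar> < L / 2 \<and>
         \<bar>(p - c) \<bullet> (- sin phi, cos phi)\<bar> < w / 2})"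

definition rect_length :: "rect_data \<Rightarrow> real" where
  "rect_length R = (case R of (c, phi, L, w) \<Rightarrow> L)"

definition rect_width :: "rect_data \<Rightarrow> real" where
  "rect_width R = (case R of (c, phi, L, w) \<Rightarrow> w)"

text \<open>theta(R): interval of width w(R)/L(R) centred at the slope tan phi of the long
  side; empty if the long side is vertical (infinite slope).\<close>
definition theta :: "rect_data \<Rightarrow> real set" where
  "theta R = (case R of (c, phi, L, w) \<Rightarrow>
     (if cos phi = 0 then {} else {tan phi - w / (2 * L) .. tan phi + w / (2 * L)}))"

text \<open>V_R for a slope field depending only on the horizontal variable: v(a,b) = v a.\<close>
definition V_set :: "(real \<Rightarrow> real) \<Rightarrow> rect_data \<Rightarrow> (real \<times> real) set" where
  "V_set v R = {p \<in> rect_set R. v (fst p) \<in> theta R}"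

definition R_delta :: "(real \<Rightarrow> real) \<Rightarrow> real \<Rightarrow> real \<Rightarrow> rect_data set" where
  "R_delta v w \<delta> = {R. rect_width R = w \<and> w \<le> rect_length R \<and>
      measure lebesgue (V_set v R) \<ge> \<delta> * measure lebesgue (rect_set R)}"

definition maxop :: "rect_data set \<Rightarrow> ((real \<times> real) \<Rightarrow> real) \<Rightarrow> (real \<times> real) \<Rightarrow> ereal" where
  "maxop \<R> f x = (if \<exists>R\<in>\<R>. x \<in> rect_set R then
     (SUP R\<in>{R\<in>\<R>. x \<in> rect_set R}.
        ereal ((1 / measure lebesgue (rect_set R)) * (\<integral>p\<in>rect_set R. f p \<partial>lebesgue)))
   else 0)"

end

theory Submission
  imports Defs
begin

text \<open>Rectangles are compared with tiles \<open>P\<close>: a base interval \<open>I\<close> of a dyadic grid (or of its translate by a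
  third of the coarsest cell) together with a slope interval \<open>\<omega>\<close> with \<open>|I| |\<omega>| = w\<close>. A tile is live if
  \<open>v \<in> \<omega>\<close> on a proportion \<open>\<eta> \<sim> \<delta>\<close> of \<open>I\<close>. Up to constants the operator is the supremum over live tiles of
  \<open>B P (U f)\<close>, where \<open>U\<close> averages over vertical windows of radius comparable to \<open>w\<close> and \<open>B P\<close> averages over \<open>I\<close>
  along lines of the slope of \<open>P\<close>.

  Linearise this supremum as \<open>g = \<Sum>\<^sub>P g\<^sub>P\<close> with disjointly supported \<open>g\<^sub>P\<close>, and put \<open>\<phi>\<^sub>P = U (B P g\<^sub>P)\<close> and \<open>h = \<Sum>\<^sub>P \<phi>\<^sub>P\<close>.
  Then \<open>\<integral>g\<^sup>2 = \<integral>f h\<close>, so it suffices to bound \<open>h\<close> by \<open>g\<close> in \<open>L\<^sup>2\<close>. In \<open>\<integral>h\<^sup>2\<close> a pair of tiles contributes the pairing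
  of \<open>g\<^sub>P\<^sub>'\<close>, for the shorter tile \<open>P'\<close>, with a vertical average of \<open>\<phi>\<^sub>P\<close> in the same column. Grouping the tiles into
  generations leaves, in every column and generation, at most \<open>D \<sim> \<delta>\<^sup>-\<^sup>2\<close> groups of comparable tiles; the sum
  of the vertical maximal functions of the groups costs a factor \<open>1 + ln D\<close>, and the interaction of two
  generations decays geometrically in their distance. This yields the power 1 of the logarithm.\<close>

section \<open>Sums of maximal functions\<close>

text \<open>A column may meet live tiles with unboundedly many slopes, and a sum of that many
  vertical maximal functions has no useful bound. But a slope matters only up to an error
  \<open>w\<close> in height across the base, so a tile may be labelled by any recorded slope cell
  inside its own, and one record serves tiles of many depths. A generation lasts as long as at most
  D records suffice. Each record uses up fresh measure \<open>\<eta> * |I|\<close>, so the columns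
  that see the next generation form a proportion at most \<open>1 / (\<eta> * D)\<close> of the base
  cell on which the current one started. This fixes the size of D. Comparing the columns of one base
  cell moves every group by its own shift and costs D by Cauchy-Schwarz, while surviving t
  generations gains \<open>(1 / (\<eta> * D)) ^ (t - 1)\<close>; two gained factors beat D once
  \<open>\<eta>\<^sup>2 * D\<close> is large. The estimate for \<open>h\<close> returns to
  \<open>h\<close> itself with a small coefficient. Absorbing that term needs finiteness a priori,
  so finite families of tiles and bounded integrable functions are treated before any limit is
  taken.\<close>

lemma powr_Suc_diff_le:
  fixes x y u :: real
  assumes "0 \<le> y" "y \<le> x" "0 < u"
  shows "x powr (1 + u) - y powr (1 + u) \<le> (1 + 1/u) * (x * (x powr u - y powr u))"
proof -
  have "x * y powr u \<le> x powr (1 + u) / (1 + u) + (y powr u) powr ((1 + u)/u) / ((1 + u)/u)"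
    by (rule Youngs_inequality) (use assms in \<open>auto simp: field_simps\<close>)
  also have "(y powr u) powr ((1 + u)/u) = y powr (1 + u)"
    using assms by (simp add: powr_powr)
  finally have *: "x * y powr u \<le> x powr (1 + u) / (1 + u) + y powr (1 + u) * (u / (1 + u))"
    by simp
  have "(1 + 1/u) * (x * y powr u) \<le> (1 + 1/u) * (x powr (1 + u) / (1 + u) + y powr (1 + u) * (u / (1 + u)))"
    by (rule mult_left_mono[OF *]) (use assms in auto)
  also have "\<dots> = x powr (1 + u) / u + y powr (1 + u)"
  proof -
    have e: "(1 + 1/u) = (1+u)/u" using assms by (simp add: field_simps)
    have "(1+u)/u * (A / (1+u)) = A/u" "(1+u)/u * (A * (u/(1+u))) = A" for A
      using assms by (auto simp: divide_simps)
    then show ?thesis unfolding e distrib_left by simp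
  qed
  finally have "(1 + 1/u) * (x * y powr u) \<le> x powr (1 + u) / u + y powr (1 + u)" .
  moreover have "x * x powr u = x powr (1 + u)"
    using assms by (cases "x = 0") (auto simp: powr_add)
  ultimately show ?thesis
    by (simp add: algebra_simps)
qed

lemma powr_diff_le:
  fixes x y p :: real
  assumes "0 \<le> y" "y \<le> x" "1 < p"
  shows "x powr p - y powr p \<le> p * x powr (p - 1) * (x - y)"
proof -
  have "y * x powr (p - 1) \<le> y powr p / p + (x powr (p - 1)) powr (p/(p-1)) / (p/(p-1))"
    by (rule Youngs_inequality) (use assms in \<open>auto simp: field_simps\<close>)
  also have "(x powr (p - 1)) powr (p/(p-1)) = x powr p"
    using assms by (simp add: powr_powr)
  finally have *: "y * x powr (p - 1) \<le> y powr p / p + x powr p * ((p - 1) / p)"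
    by simp
  have "p * (y * x powr (p - 1)) \<le> p * (y powr p / p + x powr p * ((p - 1) / p))"
    by (rule mult_left_mono[OF *]) (use assms in auto)
  also have "\<dots> = y powr p + x powr p * (p - 1)"
    using assms by (simp add: distrib_left)
  finally have "p * (y * x powr (p - 1)) \<le> y powr p + x powr p * (p - 1)" .
  moreover have "x * x powr (p - 1) = x powr p"
    using assms by (cases "x = 0") (auto simp: powr_diff)
  ultimately show ?thesis
    by (simp add: algebra_simps)
qed

text \<open>The start value 0 keeps the maximum nonnegative, so that its powers are monotone and the
  telescoping sums begin at 0.\<close>

primrec runmax :: "(nat \<Rightarrow> real) \<Rightarrow> nat \<Rightarrow> real" where
  "runmax x 0 = 0"
| "runmax x (Suc n) = max (runmax x n) (x n)"

lemma runmax_nonneg: "0 \<le> runmax x n"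
  by (induction n) auto

lemma runmax_le_sum: "(\<And>n. 0 \<le> x n) \<Longrightarrow> runmax x N \<le> (\<Sum>n<N. x n)"
  by (induction N) (auto intro: add_increasing add_increasing2 sum_nonneg)

lemma runmax_cong: "(\<And>n. n < N \<Longrightarrow> x n = y n) \<Longrightarrow> runmax x N = runmax y N"
  by (induction N) auto

lemma measurable_runmax[measurable]:
  assumes "\<And>n. (\<lambda>z. x n z) \<in> borel_measurable M"
  shows "(\<lambda>z. runmax (\<lambda>n. x n z) N) \<in> borel_measurable M"
  using assms by (induction N) auto

text \<open>Either the maximum does not move and both sides vanish, or its new value is
  \<open>x n\<close> itself. The increment of the power is thus charged to \<open>x n\<close> times
  an increment of the \<open>u\<close>-th power.\<close>

lemma runmax_power_step:
  assumes "0 < u"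
  shows "runmax x (Suc n) powr (1 + u) - runmax x n powr (1 + u)
      \<le> (1 + 1/u) * (x n * (runmax x (Suc n) powr u - runmax x n powr u))"
proof (cases "runmax x n < x n")
  case True
  then show ?thesis
    using powr_Suc_diff_le[of "runmax x n" "x n" u] runmax_nonneg[of x n] assms by auto
qed auto

text \<open>A Doob-type argument: \<open>x j n\<close> enters linearly, against a weight built only
  from values with index at most \<open>n\<close>. Such a weight is constant wherever averages of
  level \<open>n\<close> are, so the average can later be removed from \<open>x j n\<close>.\<close>

lemma runmax_telescope:
  fixes x :: "'j \<Rightarrow> nat \<Rightarrow> real" and J :: "'j set" and u p :: real
  assumes x: "\<And>j n. 0 \<le> x j n" and u: "0 < u" and p: "1 < p"
  defines "V \<equiv> \<lambda>n. \<Sum>j\<in>J. runmax (x j) n powr (1 + u)"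
  shows "V N powr p \<le> p * (1 + 1/u) * (\<Sum>j\<in>J. \<Sum>n<N. x j n *
            ((runmax (x j) (Suc n) powr u - runmax (x j) n powr u) * V (Suc n) powr (p - 1)))"
proof (induction N)
  case 0
  then show ?case by (simp add: V_def)
next
  case (Suc N)
  let ?d = "\<lambda>j. runmax (x j) (Suc N) powr u - runmax (x j) N powr u"
  have V0: "0 \<le> V N" and mono: "V N \<le> V (Suc N)"
    unfolding V_def using u runmax_nonneg
    by (auto intro!: sum_nonneg sum_mono powr_mono2 simp: runmax_nonneg)
  have "V (Suc N) - V N = (\<Sum>j\<in>J. runmax (x j) (Suc N) powr (1 + u) - runmax (x j) N powr (1 + u))"
    by (simp add: V_def sum_subtractf)
  also have "\<dots> \<le> (\<Sum>j\<in>J. (1 + 1/u) * (x j N * ?d j))"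
    by (intro sum_mono runmax_power_step u)
  finally have dV: "V (Suc N) - V N \<le> (1 + 1/u) * (\<Sum>j\<in>J. x j N * ?d j)"
    by (simp add: sum_distrib_left)
  have "V (Suc N) powr p - V N powr p \<le> p * V (Suc N) powr (p - 1) * (V (Suc N) - V N)"
    by (rule powr_diff_le[OF V0 mono p])
  also have "\<dots> \<le> p * V (Suc N) powr (p - 1) * ((1 + 1/u) * (\<Sum>j\<in>J. x j N * ?d j))"
    by (rule mult_left_mono[OF dV]) (use p in auto)
  also have "\<dots> = p * (1 + 1/u) * (\<Sum>j\<in>J. x j N * (?d j * V (Suc N) powr (p - 1)))"
    by (simp add: sum_distrib_left sum_distrib_right mult_ac)
  finally show ?case
    using Suc.IH by (simp add: sum.distrib distrib_left)
qed

text \<open>Freezing \<open>V\<close> at its final value leaves a telescoping sum of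
  \<open>u\<close>-th powers. It is applied once the averages have been replaced by the functions
  themselves, which no longer depend on \<open>n\<close>.\<close>

lemma runmax_weight_le:
  fixes V :: "nat \<Rightarrow> real"
  assumes V: "\<And>n. n < N \<Longrightarrow> V (Suc n) \<le> V N" "\<And>n. 0 \<le> V n" and u: "0 < u" and p: "1 < p"
  shows "(\<Sum>n<N. (runmax x (Suc n) powr u - runmax x n powr u) * V (Suc n) powr (p - 1))
    \<le> runmax x N powr u * V N powr (p - 1)"
proof -
  have "(\<Sum>n<N. (runmax x (Suc n) powr u - runmax x n powr u) * V (Suc n) powr (p - 1))
    \<le> (\<Sum>n<N. (runmax x (Suc n) powr u - runmax x n powr u) * V N powr (p - 1))"
    using V u p runmax_nonneg by (intro sum_mono mult_left_mono powr_mono2) (auto simp: powr_mono2)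
  also have "\<dots> = (\<Sum>n<N. (runmax x (Suc n) powr u - runmax x n powr u)) * V N powr (p - 1)"
    by (simp add: sum_distrib_right)
  also have "(\<Sum>n<N. (runmax x (Suc n) powr u - runmax x n powr u)) = runmax x N powr u"
    by (subst sum_lessThan_telescope) (use u in auto)
  finally show ?thesis .
qed

text \<open>With \<open>G\<close> the norm on the right, the terms below \<open>G / D\<close> add up
  to at most \<open>G\<close>; a larger one is \<open>m powr (1 + u)\<close> times
  \<open>m powr (- u)\<close>, and the last factor is at most
  \<open>(G / D) powr (- u)\<close>.\<close>

lemma sum_le_lr_norm:
  fixes m :: "'j \<Rightarrow> real"
  assumes "finite J" "card J \<le> D" "0 < D" and m: "\<And>j. j \<in> J \<Longrightarrow> 0 \<le> m j" and u: "0 < u"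
  shows "(\<Sum>j\<in>J. m j) \<le> (1 + D powr u) * (\<Sum>j\<in>J. m j powr (1 + u)) powr (1 / (1 + u))"
proof -
  define V where "V = (\<Sum>j\<in>J. m j powr (1 + u))"
  define G where "G = V powr (1 / (1 + u))"
  have V0: "0 \<le> V" unfolding V_def by (auto intro: sum_nonneg)
  show ?thesis
  proof (cases "V = 0")
    case True
    then have "\<And>j. j \<in> J \<Longrightarrow> m j powr (1 + u) = 0"
      using assms(1) by (auto simp: V_def sum_nonneg_eq_0_iff)
    then have "(\<Sum>j\<in>J. m j) = 0" by (intro sum.neutral) auto
    then show ?thesis by auto
  next
    case False
    then have Vp: "0 < V" and Gp: "0 < G" using V0 by (auto simp: G_def)
    have *: "m j \<le> G / D + D powr u * G powr (- u) * m j powr (1 + u)" if "j \<in> J" for j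
    proof (cases "m j \<le> G / D")
      case True
      then show ?thesis by (simp add: add_increasing2)
    next
      case False
      then have mp: "G / D < m j" by simp
      have "0 < G / D" using Gp \<open>0 < D\<close> by auto
      have "m j = m j powr (1 + u) * m j powr (- u)"
        using mp \<open>0 < G / D\<close> by (simp flip: powr_add)
      also have "\<dots> \<le> m j powr (1 + u) * (G / D) powr (- u)"
        using mp \<open>0 < G / D\<close> u by (intro mult_left_mono powr_mono2') auto
      also have "(G / D) powr (- u) = D powr u * G powr (- u)"
        using Gp \<open>0 < D\<close> by (simp add: powr_divide powr_minus divide_simps)
      finally show ?thesis using \<open>0 < G / D\<close> by (simp add: mult_ac)
    qed
    have "(\<Sum>j\<in>J. m j) \<le> (\<Sum>j\<in>J. G / D + D powr u * G powr (- u) * m j powr (1 + u))"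
      by (intro sum_mono *)
    also have "\<dots> = card J * (G / D) + D powr u * G powr (- u) * V"
      by (simp add: sum.distrib V_def sum_distrib_left)
    also have "\<dots> \<le> G + D powr u * G powr (- u) * V"
    proof -
      have "card J * (G / D) \<le> D * (G / D)"
        using assms(2) Gp by (intro mult_right_mono) auto
      then show ?thesis using \<open>0 < D\<close> by simp
    qed
    also have "V = G powr (1 + u)"
      using u V0 by (simp add: G_def powr_powr)
    also have "D powr u * G powr (- u) * G powr (1 + u) = D powr u * G"
      using Gp by (simp flip: powr_add)
    finally show ?thesis by (simp add: G_def V_def algebra_simps)
  qed
qed

text \<open>Provides the finiteness that the absorption argument below needs.\<close>

lemma lr_norm_le_sum:
  fixes m :: "'j \<Rightarrow> real"
  assumes m: "\<And>j. j \<in> J \<Longrightarrow> 0 \<le> m j" and u: "0 < u" and "finite J"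
  shows "(\<Sum>j\<in>J. m j powr (1 + u)) powr (1 / (1 + u)) \<le> (\<Sum>j\<in>J. m j)"
proof -
  define S where "S = (\<Sum>j\<in>J. m j)"
  have S: "0 \<le> S" "\<And>j. j \<in> J \<Longrightarrow> m j \<le> S"
    using assms by (auto simp: S_def intro: sum_nonneg member_le_sum)
  have "(\<Sum>j\<in>J. m j powr (1 + u)) \<le> (\<Sum>j\<in>J. m j * S powr u)"
  proof (intro sum_mono)
    fix j assume j: "j \<in> J"
    have "m j powr (1 + u) = m j * m j powr u"
      using m[OF j] by (cases "m j = 0") (auto simp: powr_add)
    also have "\<dots> \<le> m j * S powr u"
      using m[OF j] S(2)[OF j] u by (intro mult_left_mono powr_mono2) auto
    finally show "m j powr (1 + u) \<le> m j * S powr u" .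
  qed
  also have "\<dots> = S * S powr u"
    by (simp add: S_def sum_distrib_right)
  also have "\<dots> = S powr (1 + u)"
    using S(1) by (cases "S = 0") (auto simp: powr_add)
  finally have "(\<Sum>j\<in>J. m j powr (1 + u)) powr (1 / (1 + u)) \<le> (S powr (1 + u)) powr (1 / (1 + u))"
    using u by (intro powr_mono2) (auto intro: sum_nonneg)
  also have "\<dots> = S"
    using S(1) u by (simp add: powr_powr)
  finally show ?thesis by (simp add: S_def)
qed

text \<open>Over at most D indices the \<open>\<ell>\<^sup>r\<close> norm with \<open>r = 1 + u\<close>, \<open>u = 1 / (2 + ln D)\<close>, is comparable to the
  \<open>\<ell>\<^sup>1\<close> norm, while telescoping its square costs only a factor of order \<open>1 / u\<close>. This is why the
  loss is logarithmic in D.\<close>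
lemma vector_maximal_ineq:
  fixes M :: "'a measure" and \<phi> :: "'j \<Rightarrow> 'a \<Rightarrow> real" and x :: "'j \<Rightarrow> nat \<Rightarrow> 'a \<Rightarrow> real"
    and E :: "nat \<Rightarrow> 'a \<Rightarrow> 'a \<Rightarrow> bool" and D :: nat
  assumes J: "finite J"
    and \<phi>[measurable]: "\<And>j. \<phi> j \<in> borel_measurable M" and x[measurable]: "\<And>j n. x j n \<in> borel_measurable M"
    and pos: "\<And>j z. 0 \<le> \<phi> j z" "\<And>j n z. 0 \<le> x j n z"
    and E_mono: "\<And>m n z z'. m \<le> n \<Longrightarrow> E n z z' \<Longrightarrow> E m z z'"
    and x_E: "\<And>j n z z'. E n z z' \<Longrightarrow> x j n z = x j n z'"
    and avg: "\<And>j n W. W \<in> borel_measurable M \<Longrightarrow> (\<And>z. 0 \<le> W z) \<Longrightarrow>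
        (\<And>z z'. E n z z' \<Longrightarrow> W z = W z') \<Longrightarrow>
        (\<integral>\<^sup>+ z. ennreal (x j n z * W z) \<partial>M) \<le> (\<integral>\<^sup>+ z. ennreal (\<phi> j z * W z) \<partial>M)"
    and D: "0 < D" "\<And>z. \<exists>A. finite A \<and> card A \<le> D \<and> (\<forall>j\<in>J - A. \<forall>n. x j n z = 0)"
    and fin: "(\<integral>\<^sup>+ z. ennreal ((\<Sum>j\<in>J. \<Sum>n<N. x j n z)\<^sup>2) \<partial>M) < \<infinity>"
  shows "(\<integral>\<^sup>+ z. ennreal ((\<Sum>j\<in>J. runmax (\<lambda>n. x j n z) N)\<^sup>2) \<partial>M)
     \<le> ennreal ((8 * (3 + ln D))\<^sup>2) * (\<integral>\<^sup>+ z. ennreal ((\<Sum>j\<in>J. \<phi> j z)\<^sup>2) \<partial>M)"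
proof -
  define q where "q = 2 + ln D"
  \<comment> \<open>\<open>u\<close> is about \<open>1 / ln D\<close>: \<open>D powr u\<close> stays
    below 3 while \<open>1 + 1 / u\<close> is only logarithmic. The exponent \<open>p\<close> makes
    \<open>V powr p\<close> the square of the norm \<open>G\<close>.\<close>
  define u where "u = 1 / q"
  define p where "p = 2 / (1 + u)"
  define c where "c = 2 * (q + 1)"
  define k :: real where "k = 1/2"
  define m where "m = (\<lambda>j z n. runmax (\<lambda>n. x j n z) n)"
  define V where "V = (\<lambda>z n. \<Sum>j\<in>J. m j z n powr (1 + u))"
  define G where "G = (\<lambda>z. V z N powr (1 / (1 + u)))"
  define \<Phi> where "\<Phi> = (\<lambda>z. \<Sum>j\<in>J. \<phi> j z)"
  define W where "W = (\<lambda>j n z. (m j z (Suc n) powr u - m j z n powr u) * V z (Suc n) powr (p - 1))"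
  have "0 \<le> ln (real D)" using D(1) by simp
  then have q: "2 \<le> q" by (simp add: q_def)
  then have u: "0 < u" "u < 1" "1 / u = q" by (auto simp: u_def)
  have p: "1 < p" "p \<le> 2" using u by (auto simp: p_def divide_simps)
  have k0: "0 \<le> k" by (simp add: k_def)
  have c: "0 < c" using q by (simp add: c_def)
  have m0: "0 \<le> m j z n" for j z n by (simp add: m_def runmax_nonneg)
  have m_mono: "m j z n \<le> m j z n'" if "n \<le> n'" for j z n n'
    using that by (induction n' rule: dec_induct) (auto simp: m_def)
  have V0: "0 \<le> V z n" for z n by (auto simp: V_def intro: sum_nonneg)
  have V_mono: "V z n \<le> V z n'" if "n \<le> n'" for z n n'
    unfolding V_def using u m0 m_mono[OF that] by (intro sum_mono powr_mono2) auto
  have G0: "0 \<le> G z" for z by (simp add: G_def)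
  have \<Phi>0: "0 \<le> \<Phi> z" for z by (auto simp: \<Phi>_def pos intro: sum_nonneg)
  have W0: "0 \<le> W j n z" for j n z
    unfolding W_def using m0 m_mono u by (intro mult_nonneg_nonneg) (auto simp: powr_mono2)
  have m_meas[measurable]: "(\<lambda>z. m j z n) \<in> borel_measurable M" for j n
    unfolding m_def by measurable
  have V_meas[measurable]: "(\<lambda>z. V z n) \<in> borel_measurable M" for n
    unfolding V_def by measurable
  have [measurable]: "G \<in> borel_measurable M" "\<Phi> \<in> borel_measurable M" "\<And>j n. W j n \<in> borel_measurable M"
    unfolding G_def \<Phi>_def W_def by measurable
  have m_E: "m j z k = m j z' k" if "E n z z'" "k \<le> Suc n" for j z z' k n
    unfolding m_def using that by (intro runmax_cong x_E) (auto intro: E_mono[of _ n])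
  have W_E: "W j n z = W j n z'" if "E n z z'" for j n z z'
    unfolding W_def V_def using m_E[OF that] by simp
  have G2: "(G z)\<^sup>2 = V z N powr p" for z
  proof -
    have "(V z N powr (1 / (1 + u)))\<^sup>2 = (V z N powr (1 / (1 + u))) powr 2"
      using V0 by simp
    then show ?thesis by (simp add: G_def p_def powr_powr)
  qed
  have step1: "(G z)\<^sup>2 \<le> c * (\<Sum>j\<in>J. \<Sum>n<N. x j n z * W j n z)" for z
  proof -
    have "(G z)\<^sup>2 \<le> p * (1 + 1/u) * (\<Sum>j\<in>J. \<Sum>n<N. x j n z * W j n z)"
      unfolding G2 using runmax_telescope[where x = "\<lambda>j n. x j n z" and u = u and p = p and J = J and N = N] u p pos
      by (simp add: V_def W_def m_def)
    also have "\<dots> \<le> c * (\<Sum>j\<in>J. \<Sum>n<N. x j n z * W j n z)"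
    proof (rule mult_right_mono)
      show "p * (1 + 1/u) \<le> c"
        unfolding c_def u(3) using p q by (intro mult_mono) auto
    qed (use pos W0 in \<open>auto intro!: sum_nonneg\<close>)
    finally show ?thesis .
  qed
  have step2: "(\<Sum>j\<in>J. \<Sum>n<N. \<phi> j z * W j n z) \<le> \<Phi> z * G z" for z
  proof -
    have "(\<Sum>j\<in>J. \<Sum>n<N. \<phi> j z * W j n z) = (\<Sum>j\<in>J. \<phi> j z * (\<Sum>n<N. W j n z))"
      by (simp add: sum_distrib_left)
    also have "\<dots> \<le> (\<Sum>j\<in>J. \<phi> j z * G z)"
    proof (intro sum_mono mult_left_mono pos)
      fix j assume j: "j \<in> J"
      have "(\<Sum>n<N. W j n z) \<le> m j z N powr u * V z N powr (p - 1)"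
        unfolding W_def m_def
        by (rule runmax_weight_le[where V = "V z"]) (use V0 u p in \<open>auto intro: V_mono\<close>)
      also have "m j z N powr u \<le> G z powr u"
      proof (intro powr_mono2)
        have "m j z N powr (1 + u) \<le> V z N"
          unfolding V_def using j J by (intro member_le_sum) auto
        then have "(m j z N powr (1 + u)) powr (1/(1+u)) \<le> G z"
          unfolding G_def using u by (intro powr_mono2) auto
        then show "m j z N \<le> G z" using m0 u by (simp add: powr_powr)
      qed (use u m0 in auto)
      also have "G z powr u * V z N powr (p - 1) = G z"
      proof -
        have "u / (1 + u) + (p - 1) = 1 / (1 + u)" using u by (simp add: p_def field_simps)
        then show ?thesis by (simp add: G_def powr_powr flip: powr_add)
      qed
      finally show "(\<Sum>n<N. W j n z) \<le> G z" by (simp add: mult_right_mono)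
    qed
    also have "\<dots> = \<Phi> z * G z" by (simp add: \<Phi>_def sum_distrib_right)
    finally show ?thesis .
  qed
  have e2: "(\<Sum>j\<in>J. \<Sum>n<N. ennreal (y j n)) = ennreal (\<Sum>j\<in>J. \<Sum>n<N. y j n)"
    if "\<And>j n. 0 \<le> y j n" for y :: "'j \<Rightarrow> nat \<Rightarrow> real"
    by (simp add: sum_ennreal sum_nonneg that)
  have "(\<integral>\<^sup>+ z. ennreal ((G z)\<^sup>2) \<partial>M) \<le> (\<integral>\<^sup>+ z. ennreal c * (\<Sum>j\<in>J. \<Sum>n<N. ennreal (x j n z * W j n z)) \<partial>M)"
  proof (rule nn_integral_mono)
    fix z
    have "ennreal ((G z)\<^sup>2) \<le> ennreal (c * (\<Sum>j\<in>J. \<Sum>n<N. x j n z * W j n z))"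
      by (intro ennreal_leI step1)
    then show "ennreal ((G z)\<^sup>2) \<le> ennreal c * (\<Sum>j\<in>J. \<Sum>n<N. ennreal (x j n z * W j n z))"
      using c by (subst e2) (simp_all add: pos W0 ennreal_mult')
  qed
  also have "\<dots> = ennreal c * (\<Sum>j\<in>J. \<Sum>n<N. \<integral>\<^sup>+ z. ennreal (x j n z * W j n z) \<partial>M)"
    by (simp add: nn_integral_cmult nn_integral_sum)
  \<comment> \<open>The weight \<open>W j n\<close> is constant on the classes of
    \<open>E n\<close>, so \<open>avg\<close> replaces every average \<open>x j n\<close> by
    \<open>\<phi> j\<close>.\<close>
  also have "\<dots> \<le> ennreal c * (\<Sum>j\<in>J. \<Sum>n<N. \<integral>\<^sup>+ z. ennreal (\<phi> j z * W j n z) \<partial>M)"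
    by (intro mult_left_mono sum_mono avg) (auto simp: W0 intro: W_E)
  also have "\<dots> = (\<integral>\<^sup>+ z. ennreal c * (\<Sum>j\<in>J. \<Sum>n<N. ennreal (\<phi> j z * W j n z)) \<partial>M)"
    by (simp add: nn_integral_cmult nn_integral_sum)
  \<comment> \<open>AM-GM with coefficient 1/2 on the unknown integral, so that it can be absorbed;
    the other coefficient is quadratic in \<open>c\<close>, hence in \<open>ln D\<close>.\<close>
  also have "\<dots> \<le> (\<integral>\<^sup>+ z. ennreal k * ennreal ((G z)\<^sup>2) + ennreal (c\<^sup>2 / 2) * ennreal ((\<Phi> z)\<^sup>2) \<partial>M)"
  proof (rule nn_integral_mono)
    fix z
    have "0 \<le> (G z - c * \<Phi> z)\<^sup>2" by simp
    then have "c * (\<Phi> z * G z) \<le> 1/2 * (G z)\<^sup>2 + c\<^sup>2/2 * (\<Phi> z)\<^sup>2"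
      by (simp add: power2_eq_square algebra_simps)
    then have "c * (\<Sum>j\<in>J. \<Sum>n<N. \<phi> j z * W j n z) \<le> 1/2 * (G z)\<^sup>2 + c\<^sup>2/2 * (\<Phi> z)\<^sup>2"
      using step2[of z] c by (smt (verit) mult_left_mono)
    then have "ennreal (c * (\<Sum>j\<in>J. \<Sum>n<N. \<phi> j z * W j n z)) \<le> ennreal (k * (G z)\<^sup>2 + c\<^sup>2/2 * (\<Phi> z)\<^sup>2)"
      unfolding k_def by (rule ennreal_leI)
    then show "ennreal c * (\<Sum>j\<in>J. \<Sum>n<N. ennreal (\<phi> j z * W j n z))
        \<le> ennreal k * ennreal ((G z)\<^sup>2) + ennreal (c\<^sup>2 / 2) * ennreal ((\<Phi> z)\<^sup>2)"
      using c by (subst e2) (simp_all add: pos W0 k0 flip: ennreal_mult' ennreal_plus)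
  qed
  also have "\<dots> = ennreal k * (\<integral>\<^sup>+ z. ennreal ((G z)\<^sup>2) \<partial>M) + ennreal (c\<^sup>2 / 2) * (\<integral>\<^sup>+ z. ennreal ((\<Phi> z)\<^sup>2) \<partial>M)"
    by (simp add: nn_integral_cmult nn_integral_add)
  finally have main: "(\<integral>\<^sup>+ z. ennreal ((G z)\<^sup>2) \<partial>M)
      \<le> ennreal k * (\<integral>\<^sup>+ z. ennreal ((G z)\<^sup>2) \<partial>M) + ennreal (c\<^sup>2 / 2) * (\<integral>\<^sup>+ z. ennreal ((\<Phi> z)\<^sup>2) \<partial>M)" .
  \<comment> \<open>Half of this integral is about to be subtracted from both sides, which requires
    it to be finite.\<close>
  have Gfin: "(\<integral>\<^sup>+ z. ennreal ((G z)\<^sup>2) \<partial>M) < \<infinity>"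
  proof (rule le_less_trans[OF nn_integral_mono fin])
    fix z
    have "G z \<le> (\<Sum>j\<in>J. m j z N)"
      unfolding G_def V_def by (rule lr_norm_le_sum) (use m0 u J in auto)
    also have "\<dots> \<le> (\<Sum>j\<in>J. \<Sum>n<N. x j n z)"
      unfolding m_def by (intro sum_mono runmax_le_sum pos)
    finally show "ennreal ((G z)\<^sup>2) \<le> ennreal ((\<Sum>j\<in>J. \<Sum>n<N. x j n z)\<^sup>2)"
      using G0[of z] by (intro ennreal_leI power_mono) auto
  qed
  have main': "(\<integral>\<^sup>+ z. ennreal ((G z)\<^sup>2) \<partial>M) \<le> ennreal (c\<^sup>2) * (\<integral>\<^sup>+ z. ennreal ((\<Phi> z)\<^sup>2) \<partial>M)"
  proof (cases "(\<integral>\<^sup>+ z. ennreal ((\<Phi> z)\<^sup>2) \<partial>M)")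
    case (real b)
    obtain a where a: "0 \<le> a" "(\<integral>\<^sup>+ z. ennreal ((G z)\<^sup>2) \<partial>M) = ennreal a"
      using Gfin by (cases "(\<integral>\<^sup>+ z. ennreal ((G z)\<^sup>2) \<partial>M)") auto
    have "a \<le> k * a + c\<^sup>2/2 * b"
      using main real a k0 by (simp flip: ennreal_mult' ennreal_plus)
    then have "a \<le> c\<^sup>2 * b" by (simp add: k_def)
    then show ?thesis using a real by (simp flip: ennreal_mult')
  qed (use c in \<open>simp add: ennreal_mult_top\<close>)
  have S_le: "(\<Sum>j\<in>J. m j z N) \<le> 4 * G z" for z
  proof -
    obtain A where A: "finite A" "card A \<le> D" "\<forall>j\<in>J - A. \<forall>n. x j n z = 0" using D(2)[of z] by blast
    have z0: "m j z N = 0" if "j \<in> J - A" for j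
    proof -
      have "runmax (\<lambda>n. 0) n = 0" for n by (induction n) auto
      then show ?thesis using that A(3) by (auto simp: m_def)
    qed
    \<comment> \<open>Only the at most \<open>D\<close> indices active at \<open>z\<close> enter, so
      the sum costs \<open>1 + D powr u\<close> over the norm, however large \<open>J\<close>
      is.\<close>
    have "(\<Sum>j\<in>J. m j z N) = (\<Sum>j\<in>J \<inter> A. m j z N)"
      using J z0 by (intro sum.mono_neutral_right) auto
    also have "\<dots> \<le> (1 + D powr u) * (\<Sum>j\<in>J \<inter> A. m j z N powr (1 + u)) powr (1 / (1 + u))"
      using A D(1) m0 u J card_mono[of A "J \<inter> A"] by (intro sum_le_lr_norm) auto
    also have "\<dots> \<le> (1 + D powr u) * G z"
      unfolding G_def V_def using J u
      by (intro mult_left_mono powr_mono2 sum_mono2) (auto intro: sum_nonneg)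
    also have "\<dots> \<le> 4 * G z"
    proof (intro mult_right_mono G0)
      have "real D powr u = exp (u * ln D)" using D(1) by (simp add: powr_def)
      also have "\<dots> \<le> exp 1" using q \<open>0 \<le> ln (real D)\<close> by (simp add: u_def q_def)
      also have "\<dots> \<le> 3" by (rule exp_le)
      finally show "1 + real D powr u \<le> 4" by simp
    qed
    finally show ?thesis .
  qed
  have "(\<integral>\<^sup>+ z. ennreal ((\<Sum>j\<in>J. m j z N)\<^sup>2) \<partial>M) \<le> (\<integral>\<^sup>+ z. ennreal 16 * ennreal ((G z)\<^sup>2) \<partial>M)"
  proof (rule nn_integral_mono)
    fix z
    have "(\<Sum>j\<in>J. m j z N)\<^sup>2 \<le> (4 * G z)\<^sup>2"
      using S_le[of z] m0 by (intro power_mono) (auto intro: sum_nonneg)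
    then show "ennreal ((\<Sum>j\<in>J. m j z N)\<^sup>2) \<le> ennreal 16 * ennreal ((G z)\<^sup>2)"
      by (subst ennreal_mult'[symmetric]) (auto intro!: ennreal_leI simp: power_mult_distrib)
  qed
  also have "\<dots> = ennreal 16 * (\<integral>\<^sup>+ z. ennreal ((G z)\<^sup>2) \<partial>M)"
    by (simp add: nn_integral_cmult)
  also have "\<dots> \<le> ennreal 16 * (ennreal (c\<^sup>2) * (\<integral>\<^sup>+ z. ennreal ((\<Phi> z)\<^sup>2) \<partial>M))"
    by (intro mult_left_mono main') auto
  also have "\<dots> = ennreal ((8 * (3 + ln D))\<^sup>2) * (\<integral>\<^sup>+ z. ennreal ((\<Phi> z)\<^sup>2) \<partial>M)"
  proof -
    have "16 * c\<^sup>2 = (8 * (3 + ln D))\<^sup>2" by (simp add: c_def q_def power2_eq_square algebra_simps)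
    then show ?thesis by (simp only: mult.assoc[symmetric] flip: ennreal_mult')
  qed
  finally show ?thesis by (simp add: m_def \<Phi>_def)
qed

section \<open>Dyadic cells\<close>

abbreviation pl :: "(real \<times> real) measure" where "pl \<equiv> lborel \<Otimes>\<^sub>M lborel"

text \<open>Depth 0 has the coarsest length \<open>l\<close>. Cells of increasing depth are nested,
  and the ancestor is obtained by integer division by a power of two.\<close>

definition cell :: "real \<Rightarrow> nat \<Rightarrow> real \<Rightarrow> int" where
  "cell l n x = \<lfloor>x * 2 ^ n / l\<rfloor>"

lemma cell_iff: "0 < l \<Longrightarrow> cell l n x = m \<longleftrightarrow> of_int m * (l / 2 ^ n) \<le> x \<and> x < (of_int m + 1) * (l / 2 ^ n)"
  unfolding cell_def floor_eq_iff by (auto simp: field_simps)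

lemma measurable_cell[measurable]: "cell l n \<in> borel \<rightarrow>\<^sub>M count_space UNIV"
  unfolding cell_def by measurable

lemma floor_divide_power2: "\<lfloor>x / 2 ^ d\<rfloor> = \<lfloor>x :: real\<rfloor> div 2 ^ d"
  using floor_divide_real_eq_div[of "2 ^ d" x] by simp

lemma cell_div: "cell l n x = cell l (n + d) x div 2 ^ d"
  using floor_divide_power2[of "x * 2 ^ (n + d) / l" d] by (simp add: cell_def power_add field_simps)

lemma cell_Suc_div: "cell l (Suc n) x div 2 = cell l n x"
  using cell_div[of l n x 1] by simp

lemma cell_eq_mono: "k \<le> n \<Longrightarrow> cell l n x = cell l n y \<Longrightarrow> cell l k x = cell l k y"
  using cell_div[of l k _ "n - k"] by simp

lemma cell_le_dist: "0 < l \<Longrightarrow> cell l n x = cell l n y \<Longrightarrow> \<bar>x - y\<bar> < l / 2 ^ n"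
  using cell_iff[of l n x "cell l n y"] cell_iff[of l n y "cell l n y"] by (auto simp: distrib_right add_divide_distrib)

lemma cell_eq_Ico: "0 < l \<Longrightarrow> {x. cell l n x = m} = {of_int m * (l / 2 ^ n)..<(of_int m + 1) * (l / 2 ^ n)}"
  by (auto simp: cell_iff)

lemma emeasure_cell: "0 < l \<Longrightarrow> emeasure lborel {x. cell l n x = m} = ennreal (l / 2 ^ n)"
  by (subst cell_eq_Ico) (auto simp: distrib_right add_divide_distrib)

text \<open>Because \<^term>\<open>2 ^ n\<close> is not a multiple of 3, one translation by a third of the coarsest cell
  serves as the second dyadic grid at all scales simultaneously.\<close>
lemma one_third_trick:
  fixes l b r :: real
  assumes l: "0 < l" and r: "0 \<le> r" "6 * r \<le> l / 2 ^ n"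
  obtains s where "s = 0 \<or> s = l / 3"
    "\<And>x y. \<bar>x - b\<bar> < r \<Longrightarrow> \<bar>y - b\<bar> < r \<Longrightarrow> cell l n (x + s) = cell l n (y + s)"
proof -
  let ?k = "l / 2 ^ n"
  have k: "0 < ?k" using l by simp
  have jump: "\<exists>z::int. b - r < of_int z * ?k - s \<and> of_int z * ?k - s < b + r"
    if "\<bar>x - b\<bar> < r" "\<bar>y - b\<bar> < r" "cell l n (x + s) \<noteq> cell l n (y + s)" for x y s
  proof -
    have main: "\<exists>z::int. b - r < of_int z * ?k - s \<and> of_int z * ?k - s < b + r"
      if "\<bar>x - b\<bar> < r" "\<bar>y - b\<bar> < r" "cell l n (x + s) < cell l n (y + s)" for x y
    proof (intro exI conjI)
      let ?z = "cell l n (y + s)"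
      have "of_int ?z * ?k \<le> y + s" using cell_iff[OF l, of n "y+s" ?z] by auto
      then show "of_int ?z * ?k - s < b + r" using that by linarith
      have "x + s < (of_int (cell l n (x + s)) + 1) * ?k" using cell_iff[OF l, of n "x+s" "cell l n (x+s)"] by auto
      also have "\<dots> \<le> of_int ?z * ?k"
      proof (rule mult_right_mono)
        have "cell l n (x + s) + 1 \<le> ?z" using that(3) by simp
        then show "real_of_int (cell l n (x + s)) + 1 \<le> of_int ?z" by linarith
      qed (use k in simp)
      finally show "b - r < of_int ?z * ?k - s" using that by linarith
    qed
    show ?thesis
      using main[OF that(1,2)] main[OF that(2,1)] that(3) by (cases "cell l n (x + s) < cell l n (y + s)") auto
  qed
  define good where "good = (\<lambda>s. \<forall>x y. \<bar>x - b\<bar> < r \<longrightarrow> \<bar>y - b\<bar> < r \<longrightarrow> cell l n (x + s) = cell l n (y + s))"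
  have bad: "\<exists>z::int. b - r < of_int z * ?k - s \<and> of_int z * ?k - s < b + r" if "\<not> good s" for s
  proof -
    from that obtain x y where "\<bar>x - b\<bar> < r" "\<bar>y - b\<bar> < r" "cell l n (x + s) \<noteq> cell l n (y + s)"
      unfolding good_def by metis
    then show ?thesis by (rule jump)
  qed
  have "good 0 \<or> good (l/3)"
  proof (rule ccontr)
    assume "\<not> ?thesis"
    then obtain z z' :: int where z: "b - r < of_int z * ?k - 0" "of_int z * ?k - 0 < b + r"
      and z': "b - r < of_int z' * ?k - l/3" "of_int z' * ?k - l/3 < b + r"
      using bad[of 0] bad[of "l/3"] by blast
    have "\<bar>of_int (z' - z) * ?k - l/3\<bar> < 2 * r"
      using z z' unfolding of_int_diff left_diff_distrib by linarith
    moreover have "3 * e < ?k" if "e < 2 * r" for e using r that by linarith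
    ultimately have lt: "3 * \<bar>of_int (z' - z) * ?k - l/3\<bar> < ?k" by blast
    have "3 * (of_int (z' - z) * ?k - l/3) = ?k * of_int (3 * (z' - z) - 2 ^ n)"
      by (simp add: field_simps)
    then have "3 * \<bar>of_int (z' - z) * ?k - l/3\<bar> = ?k * \<bar>of_int (3 * (z' - z) - 2 ^ n)\<bar>"
      using k by (metis abs_mult abs_numeral abs_of_pos)
    then have "?k * \<bar>real_of_int (3 * (z' - z) - 2 ^ n)\<bar> < ?k * 1"
      using lt by linarith
    then have "\<bar>real_of_int (3 * (z' - z) - 2 ^ n)\<bar> < 1"
      using k by (simp only: mult_less_cancel_left_pos)
    then have "3 * (z' - z) = 2 ^ n" by linarith
    then have "(3::int) dvd 2 ^ n" by (metis dvd_triv_left)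
    moreover have "coprime (3::int) (2 ^ n)" by (simp add: coprime_power_right_iff)
    ultimately have "is_unit (3::int)" by (meson coprime_absorb_left)
    then show False by simp
  qed
  then show thesis
    using that[of 0] that[of "l/3"] unfolding good_def by blast
qed

lemma nn_integral_shift:
  fixes f :: "real \<Rightarrow> ennreal"
  assumes "f \<in> borel_measurable borel"
  shows "(\<integral>\<^sup>+x. f (x + t) \<partial>lborel) = (\<integral>\<^sup>+x. f x \<partial>lborel)"
  using nn_integral_real_affine[OF assms, of 1 t] by (simp add: add.commute)

lemma nn_integral_reflect:
  fixes f :: "real \<Rightarrow> ennreal"
  assumes "f \<in> borel_measurable borel"
  shows "(\<integral>\<^sup>+x. f (- x) \<partial>lborel) = (\<integral>\<^sup>+x. f x \<partial>lborel)"
  using nn_integral_real_affine[OF assms, of "-1" 0] by simp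

section \<open>Conditional expectations on shifted dyadic grids and vertical maximal
  functions\<close>

definition cavg :: "real \<Rightarrow> real \<Rightarrow> nat \<Rightarrow> (real \<Rightarrow> ennreal) \<Rightarrow> real \<Rightarrow> ennreal" where
  "cavg l s n f x = ennreal (2 ^ n / l) * (\<integral>\<^sup>+y. (if cell l n (y + s) = cell l n (x + s) then f y else 0) \<partial>lborel)"

lemma cavg_measurable[measurable]:
  assumes [measurable]: "(\<lambda>(a, b). F a b) \<in> borel_measurable (N \<Otimes>\<^sub>M borel)"
    and [measurable]: "g \<in> N' \<rightarrow>\<^sub>M N" "k \<in> N' \<rightarrow>\<^sub>M borel"
  shows "(\<lambda>z. cavg l s n (F (g z)) (k z)) \<in> borel_measurable N'"
  unfolding cavg_def by measurable

lemma cavg_cong_cell: "cell l n (x + s) = cell l n (y + s) \<Longrightarrow> cavg l s n f x = cavg l s n f y"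
  by (simp add: cavg_def)

lemma emeasure_shifted_cell: "0 < l \<Longrightarrow> emeasure lborel {x. cell l n (x + s) = m} = ennreal (l / 2 ^ n)"
proof -
  assume l: "0 < l"
  have "{x. cell l n (x + s) = m} = {of_int m * (l / 2 ^ n) - s..<(of_int m + 1) * (l / 2 ^ n) - s}"
    by (auto simp: cell_iff[OF l])
  then show ?thesis using l by (simp add: distrib_right add_divide_distrib)
qed

text \<open>The defining property of a conditional expectation. \<open>W\<close> is constant on
  cells and can be moved inside the average; after Fubini each \<open>y\<close> is counted with
  weight \<open>2 ^ n / l\<close> times the cell length, that is 1.\<close>

lemma nn_integral_cavg_mult:
  assumes l: "0 < l" and [measurable]: "f \<in> borel_measurable borel" "W \<in> borel_measurable borel"
    and W: "\<And>x y. cell l n (x + s) = cell l n (y + s) \<Longrightarrow> W x = W y"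
  shows "(\<integral>\<^sup>+x. cavg l s n f x * W x \<partial>lborel) = (\<integral>\<^sup>+x. f x * W x \<partial>lborel)"
proof -
  have "(\<integral>\<^sup>+x. cavg l s n f x * W x \<partial>lborel)
    = (\<integral>\<^sup>+x. \<integral>\<^sup>+y. ennreal (2 ^ n / l) * (if cell l n (y + s) = cell l n (x + s) then f y * W y else 0) \<partial>lborel \<partial>lborel)"
  proof (rule nn_integral_cong)
    fix x
    have "cavg l s n f x * W x = (\<integral>\<^sup>+y. W x * (ennreal (2 ^ n / l) * (if cell l n (y + s) = cell l n (x + s) then f y else 0)) \<partial>lborel)"
      unfolding cavg_def by (simp add: nn_integral_cmult mult_ac)
    also have "\<dots> = (\<integral>\<^sup>+y. ennreal (2 ^ n / l) * (if cell l n (y + s) = cell l n (x + s) then f y * W y else 0) \<partial>lborel)"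
      by (intro nn_integral_cong) (auto simp: mult_ac dest: W)
    finally show "cavg l s n f x * W x = \<dots>" .
  qed
  also have "\<dots> = (\<integral>\<^sup>+y. \<integral>\<^sup>+x. ennreal (2 ^ n / l) * (if cell l n (y + s) = cell l n (x + s) then f y * W y else 0) \<partial>lborel \<partial>lborel)"
    by (rule lborel_pair.Fubini') measurable
  also have "\<dots> = (\<integral>\<^sup>+y. f y * W y \<partial>lborel)"
  proof (rule nn_integral_cong)
    fix y
    have "(\<integral>\<^sup>+x. ennreal (2 ^ n / l) * (if cell l n (y + s) = cell l n (x + s) then f y * W y else 0) \<partial>lborel)
      = (\<integral>\<^sup>+x. ennreal (2 ^ n / l) * (f y * W y) * indicator {x. cell l n (x + s) = cell l n (y + s)} x \<partial>lborel)"
      by (intro nn_integral_cong) (auto simp: indicator_def)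
    also have "\<dots> = ennreal (2 ^ n / l) * (f y * W y) * ennreal (l / 2 ^ n)"
      by (subst nn_integral_cmult_indicator) (auto simp: emeasure_shifted_cell[OF l])
    also have "\<dots> = f y * W y * ennreal (2 ^ n / l * (l / 2 ^ n))"
      using l by (subst ennreal_mult') (auto simp: mult_ac)
    finally show "(\<integral>\<^sup>+x. ennreal (2 ^ n / l) * (if cell l n (y + s) = cell l n (x + s) then f y * W y else 0) \<partial>lborel) = f y * W y"
      using l by simp
  qed
  finally show ?thesis .
qed

lemma cavg_le_const:
  assumes l: "0 < l" and "\<And>y. f y \<le> c" shows "cavg l s n f x \<le> c"
proof -
  have "cavg l s n f x \<le> ennreal (2 ^ n / l) * (\<integral>\<^sup>+y. c * indicator {y. cell l n (y + s) = cell l n (x + s)} y \<partial>lborel)"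
    unfolding cavg_def using assms by (intro mult_left_mono nn_integral_mono) (auto simp: indicator_def)
  also have "\<dots> = c * ennreal (2 ^ n / l * (l / 2 ^ n))"
    using l by (subst nn_integral_cmult_indicator; (subst ennreal_mult')?) (auto simp: emeasure_shifted_cell[OF l] mult_ac)
  finally show ?thesis using l by simp
qed

lemma nn_integral_cavg:
  assumes "0 < l" "f \<in> borel_measurable borel"
  shows "(\<integral>\<^sup>+x. cavg l s n f x \<partial>lborel) = (\<integral>\<^sup>+x. f x \<partial>lborel)"
  using nn_integral_cavg_mult[OF assms, of "\<lambda>_. 1"] by simp

lemma nn_integral_plane:
  "F \<in> borel_measurable (borel \<Otimes>\<^sub>M borel) \<Longrightarrow>
    (\<integral>\<^sup>+z. F z \<partial>pl) = (\<integral>\<^sup>+a. \<integral>\<^sup>+b. F (a, b) \<partial>lborel \<partial>(lborel :: real measure))"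
  for F :: "real \<times> real \<Rightarrow> ennreal"
  by (rule lborel.nn_integral_fst[symmetric]) simp

text \<open>The dyadic maximal function within the column of \<open>z\<close>. Finitely many depths
  make it a running maximum and keep it below any constant bound of \<open>F\<close>.\<close>

definition vmax :: "real \<Rightarrow> real \<Rightarrow> nat \<Rightarrow> (real \<times> real \<Rightarrow> ennreal) \<Rightarrow> real \<times> real \<Rightarrow> ennreal" where
  "vmax l s N F z = (SUP n\<in>{..<N}. cavg l s n (\<lambda>y. F (fst z, y)) (snd z))"

lemma vmax_measurable[measurable]:
  assumes [measurable]: "F \<in> borel_measurable (borel \<Otimes>\<^sub>M borel)"
  shows "vmax l s N F \<in> borel_measurable (borel \<Otimes>\<^sub>M borel)"
  unfolding vmax_def by measurable

text \<open>Instance of \<open>vector_maximal_ineq\<close> in which two points are equivalent at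
  level \<open>n\<close> when they share a column and a vertical cell. Boundedness and integrability
  supply finiteness; the constant sees only \<open>D\<close>, the number of groups active in a
  single column.\<close>

lemma column_maximal_ineq:
  fixes \<phi> :: "'j \<Rightarrow> real \<times> real \<Rightarrow> ennreal" and D :: nat
  assumes l: "0 < l" and J: "finite J"
    and \<phi>[measurable]: "\<And>j. \<phi> j \<in> borel_measurable (borel \<Otimes>\<^sub>M borel)"
    and bd: "\<And>j z. \<phi> j z \<le> ennreal K"
    and int: "\<And>j. j \<in> J \<Longrightarrow> (\<integral>\<^sup>+z. \<phi> j z \<partial>pl) < \<infinity>"
    and D: "0 < D" "\<And>a. \<exists>A. finite A \<and> card A \<le> D \<and> (\<forall>j\<in>J - A. \<forall>b. \<phi> j (a, b) = 0)"
  shows "(\<integral>\<^sup>+z. (\<Sum>j\<in>J. vmax l s N (\<phi> j) z)\<^sup>2 \<partial>pl)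
     \<le> ennreal ((8 * (3 + ln D))\<^sup>2) * (\<integral>\<^sup>+z. (\<Sum>j\<in>J. \<phi> j z)\<^sup>2 \<partial>pl)"
proof -
  let ?M = "lborel \<Otimes>\<^sub>M lborel :: (real \<times> real) measure"
  define X where "X = (\<lambda>j n z. cavg l s n (\<lambda>y. \<phi> j (fst z, y)) (snd z))"
  define x where "x = (\<lambda>j n z. enn2real (X j n z))"
  have [measurable]: "X j n \<in> borel_measurable (borel \<Otimes>\<^sub>M borel)" for j n
    unfolding X_def by measurable
  have [measurable]: "x j n \<in> borel_measurable (borel \<Otimes>\<^sub>M borel)" for j n
    unfolding x_def by measurable
  have X_le: "X j n z \<le> ennreal K" for j n z
    unfolding X_def by (intro cavg_le_const l bd)
  have x_eq: "ennreal (x j n z) = X j n z" for j n z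
    unfolding x_def using le_less_trans[OF X_le[of j n z] ennreal_less_top] by (simp add: ennreal_enn2real_if)
  have \<phi>_eq: "ennreal (enn2real (\<phi> j z)) = \<phi> j z" for j z
    using le_less_trans[OF bd[of j z] ennreal_less_top] by (simp add: ennreal_enn2real_if)
  have x_bd: "x j n z \<le> max 0 K" for j n z
    unfolding x_def using X_le[of j n z] by (intro enn2real_leI) (auto simp: max_def ennreal_neg split: if_splits)
  have X_avg: "(\<integral>\<^sup>+z. X j n z * W z \<partial>?M) = (\<integral>\<^sup>+z. \<phi> j z * W z \<partial>?M)"
    if [measurable]: "W \<in> borel_measurable (borel \<Otimes>\<^sub>M borel)"
      and W: "\<And>a b b'. cell l n (b + s) = cell l n (b' + s) \<Longrightarrow> W (a, b) = W (a, b')" for W j n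
  proof -
    have "(\<integral>\<^sup>+z. X j n z * W z \<partial>?M) = (\<integral>\<^sup>+a. \<integral>\<^sup>+b. cavg l s n (\<lambda>y. \<phi> j (a, y)) b * W (a, b) \<partial>lborel \<partial>lborel)"
      by (subst nn_integral_plane) (auto simp: X_def)
    also have "\<dots> = (\<integral>\<^sup>+a. \<integral>\<^sup>+b. \<phi> j (a, b) * W (a, b) \<partial>lborel \<partial>lborel)"
      by (intro nn_integral_cong nn_integral_cavg_mult l) (auto intro: W)
    also have "\<dots> = (\<integral>\<^sup>+z. \<phi> j z * W z \<partial>?M)"
      by (subst nn_integral_plane) auto
    finally show ?thesis .
  qed
  have int_x: "(\<integral>\<^sup>+z. X j n z \<partial>?M) < \<infinity>" if "j \<in> J" for j n
    using X_avg[of "\<lambda>_. 1" n j] int[OF that] by simp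
  have "(\<integral>\<^sup>+ z. ennreal ((\<Sum>j\<in>J. runmax (\<lambda>n. x j n z) N)\<^sup>2) \<partial>?M)
     \<le> ennreal ((8 * (3 + ln D))\<^sup>2) * (\<integral>\<^sup>+ z. ennreal ((\<Sum>j\<in>J. enn2real (\<phi> j z))\<^sup>2) \<partial>?M)"
  proof (rule vector_maximal_ineq[where E = "\<lambda>n z z'. fst z = fst z' \<and> cell l n (snd z + s) = cell l n (snd z' + s)"])
    fix j n and W :: "real \<times> real \<Rightarrow> real"
    assume W[measurable]: "W \<in> borel_measurable ?M" "\<And>z. 0 \<le> W z"
      and WE: "\<And>z z'. fst z = fst z' \<and> cell l n (snd z + s) = cell l n (snd z' + s) \<Longrightarrow> W z = W z'"
    have "(\<integral>\<^sup>+ z. ennreal (x j n z * W z) \<partial>?M) = (\<integral>\<^sup>+ z. X j n z * ennreal (W z) \<partial>?M)"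
      using W(2) by (simp add: ennreal_mult'' x_eq)
    also have "\<dots> = (\<integral>\<^sup>+ z. \<phi> j z * ennreal (W z) \<partial>?M)"
      by (rule X_avg) (use W(1) in \<open>auto intro!: arg_cong[where f=ennreal] WE\<close>)
    also have "\<dots> = (\<integral>\<^sup>+ z. ennreal (enn2real (\<phi> j z) * W z) \<partial>?M)"
      using W(2) by (simp add: ennreal_mult'' \<phi>_eq)
    finally show "(\<integral>\<^sup>+ z. ennreal (x j n z * W z) \<partial>?M) \<le> \<dots>" by simp
  next
    fix z :: "real \<times> real"
    obtain A where A: "finite A" "card A \<le> D" "\<forall>j\<in>J - A. \<forall>b. \<phi> j (fst z, b) = 0" using D(2) by blast
    have "X j n z = 0" if "j \<in> J - A" for j n
    proof -
      have "(\<lambda>y. \<phi> j (fst z, y)) = (\<lambda>y. 0)" using A(3) that by auto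
      then show ?thesis unfolding X_def by (simp only:) (simp add: cavg_def)
    qed
    then show "\<exists>A. finite A \<and> card A \<le> D \<and> (\<forall>j\<in>J - A. \<forall>n. x j n z = 0)"
      using A(1,2) by (auto simp: x_def)
  next
    define K' where "K' = real (card J * N) * max 0 K"
    have "(\<integral>\<^sup>+ z. ennreal ((\<Sum>j\<in>J. \<Sum>n<N. x j n z)\<^sup>2) \<partial>?M)
        \<le> (\<integral>\<^sup>+ z. ennreal K' * (\<Sum>j\<in>J. \<Sum>n<N. X j n z) \<partial>?M)"
    proof (rule nn_integral_mono)
      fix z
      have x0: "0 \<le> x j n z" for j n by (simp add: x_def)
      have "(\<Sum>j\<in>J. \<Sum>n<N. x j n z) \<le> (\<Sum>j\<in>J. \<Sum>n<N. max 0 K)"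
        by (intro sum_mono x_bd)
      also have "\<dots> = K'" by (simp add: K'_def)
      finally have "(\<Sum>j\<in>J. \<Sum>n<N. x j n z)\<^sup>2 \<le> K' * (\<Sum>j\<in>J. \<Sum>n<N. x j n z)"
        unfolding power2_eq_square by (intro mult_right_mono sum_nonneg x0)
      then have "ennreal ((\<Sum>j\<in>J. \<Sum>n<N. x j n z)\<^sup>2) \<le> ennreal K' * ennreal (\<Sum>j\<in>J. \<Sum>n<N. x j n z)"
        by (subst ennreal_mult'[symmetric]) (auto simp: K'_def intro: ennreal_leI)
      also have "ennreal (\<Sum>j\<in>J. \<Sum>n<N. x j n z) = (\<Sum>j\<in>J. \<Sum>n<N. X j n z)"
        by (simp add: x_eq[symmetric] sum_ennreal sum_nonneg x0)
      finally show "ennreal ((\<Sum>j\<in>J. \<Sum>n<N. x j n z)\<^sup>2) \<le> ennreal K' * (\<Sum>j\<in>J. \<Sum>n<N. X j n z)" .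
    qed
    also have "\<dots> = ennreal K' * (\<Sum>j\<in>J. \<Sum>n<N. \<integral>\<^sup>+ z. X j n z \<partial>?M)"
      by (simp add: nn_integral_cmult nn_integral_sum)
    also have "\<dots> < \<infinity>"
      using int_x J by (simp add: ennreal_mult_less_top ennreal_sum_less_top)
    finally show "(\<integral>\<^sup>+ z. ennreal ((\<Sum>j\<in>J. \<Sum>n<N. x j n z)\<^sup>2) \<partial>?M) < \<infinity>" .
  next
    show "x j n z = x j n z'" if "fst z = fst z' \<and> cell l n (snd z + s) = cell l n (snd z' + s)" for j n z z'
      using that cavg_cong_cell[of l n "snd z" s "snd z'"] by (simp add: x_def X_def)
  qed (use J D in \<open>auto simp: x_def intro: cell_eq_mono\<close>)
  moreover have vm: "vmax l s N (\<phi> j) z = ennreal (runmax (\<lambda>n. x j n z) N)" for j z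
  proof -
    have "(SUP n\<in>{..<N}. ennreal (y n)) = ennreal (runmax y N)" for y :: "nat \<Rightarrow> real"
    proof (induction N)
      case (Suc N)
      have "sup (ennreal p) (ennreal q) = ennreal (max q p)" for p q
        by (cases "p \<le> q") (simp_all add: sup.absorb1 sup.absorb2 ennreal_leI max_def)
      then show ?case using Suc.IH by (simp add: lessThan_Suc)
    qed (simp add: bot_ennreal)
    from this[of "\<lambda>n. x j n z"] show ?thesis by (simp add: vmax_def x_eq X_def)
  qed
  moreover have "(\<Sum>j\<in>J. vmax l s N (\<phi> j) z)\<^sup>2 = ennreal ((\<Sum>j\<in>J. runmax (\<lambda>n. x j n z) N)\<^sup>2)" for z
    unfolding vm by (simp add: sum_ennreal runmax_nonneg sum_nonneg ennreal_power)
  moreover have "(\<Sum>j\<in>J. \<phi> j z)\<^sup>2 = ennreal ((\<Sum>j\<in>J. enn2real (\<phi> j z))\<^sup>2)" for z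
  proof -
    have "(\<Sum>j\<in>J. \<phi> j z) = (\<Sum>j\<in>J. ennreal (enn2real (\<phi> j z)))" by (simp only: \<phi>_eq)
    then show ?thesis by (simp only:) (simp add: sum_ennreal sum_nonneg ennreal_power)
  qed
  ultimately show ?thesis by (simp only:)
qed

section \<open>Vertical averages and averages along lines\<close>

definition vsm :: "real \<Rightarrow> (real \<times> real \<Rightarrow> ennreal) \<Rightarrow> real \<times> real \<Rightarrow> ennreal" where
  "vsm \<rho> F z = ennreal (1 / (2 * \<rho>)) * (\<integral>\<^sup>+t. (if \<bar>t\<bar> < \<rho> then F (fst z, snd z + t) else 0) \<partial>lborel)"

text \<open>Off the base cell the value is 0: with both endpoints of the segment restricted to the
  cell, the kernel is symmetric.\<close>

definition lavg :: "real \<Rightarrow> nat \<Rightarrow> int \<Rightarrow> real \<Rightarrow> (real \<times> real \<Rightarrow> ennreal) \<Rightarrow> real \<times> real \<Rightarrow> ennreal" where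
  "lavg l n m s F z = (if cell l n (fst z) = m then ennreal (2 ^ n / l) *
     (\<integral>\<^sup>+a. (if cell l n a = m then F (a, snd z + s * (a - fst z)) else 0) \<partial>lborel) else 0)"

lemma vsm_Pair: "vsm \<rho> F (a, b) = ennreal (1 / (2 * \<rho>)) * (\<integral>\<^sup>+t. (if \<bar>t\<bar> < \<rho> then F (a, b + t) else 0) \<partial>lborel)"
  by (simp add: vsm_def cong: if_cong)

lemma lavg_Pair: "lavg l n m s F (a, b) = (if cell l n a = m then ennreal (2 ^ n / l) *
     (\<integral>\<^sup>+a'. (if cell l n a' = m then F (a', b + s * (a' - a)) else 0) \<partial>lborel) else 0)"
  by (simp add: lavg_def cong: if_cong)

lemma vsm_measurable[measurable]:
  assumes [measurable]: "F \<in> borel_measurable (borel \<Otimes>\<^sub>M borel)"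
  shows "vsm \<rho> F \<in> borel_measurable (borel \<Otimes>\<^sub>M borel)"
  unfolding vsm_def by measurable

lemma lavg_measurable[measurable]:
  assumes [measurable]: "F \<in> borel_measurable (borel \<Otimes>\<^sub>M borel)"
  shows "lavg l n m s F \<in> borel_measurable (borel \<Otimes>\<^sub>M borel)"
  unfolding lavg_def by measurable

text \<open>The window is even: within a column, reflecting \<open>t\<close> and translating the
  height by \<open>t\<close> exchanges the two functions.\<close>

lemma vsm_sym:
  assumes [measurable]: "F \<in> borel_measurable (borel \<Otimes>\<^sub>M borel)" "G \<in> borel_measurable (borel \<Otimes>\<^sub>M borel)"
  shows "(\<integral>\<^sup>+z. G z * vsm \<rho> F z \<partial>pl) = (\<integral>\<^sup>+z. F z * vsm \<rho> G z \<partial>pl)"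
proof -
  have col: "(\<integral>\<^sup>+b. G (a, b) * vsm \<rho> F (a, b) \<partial>lborel) = (\<integral>\<^sup>+b. F (a, b) * vsm \<rho> G (a, b) \<partial>lborel)" for a
  proof -
    have eq: "(\<integral>\<^sup>+b. G (a, b) * vsm \<rho> F (a, b) \<partial>lborel)
      = (\<integral>\<^sup>+t. \<integral>\<^sup>+b. ennreal (1 / (2 * \<rho>)) * (if \<bar>t\<bar> < \<rho> then G (a, b) * F (a, b + t) else 0) \<partial>lborel \<partial>lborel)"
      if [measurable]: "F \<in> borel_measurable (borel \<Otimes>\<^sub>M borel)" "G \<in> borel_measurable (borel \<Otimes>\<^sub>M borel)" for F G
    proof -
      have "(\<integral>\<^sup>+b. G (a, b) * vsm \<rho> F (a, b) \<partial>lborel)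
        = (\<integral>\<^sup>+b. \<integral>\<^sup>+t. ennreal (1 / (2 * \<rho>)) * (if \<bar>t\<bar> < \<rho> then G (a, b) * F (a, b + t) else 0) \<partial>lborel \<partial>lborel)"
      proof (rule nn_integral_cong)
        fix b
        have "G (a, b) * vsm \<rho> F (a, b) = (\<integral>\<^sup>+t. G (a, b) * (ennreal (1 / (2 * \<rho>)) * (if \<bar>t\<bar> < \<rho> then F (a, b + t) else 0)) \<partial>lborel)"
          by (simp add: vsm_Pair nn_integral_cmult)
        also have "\<dots> = (\<integral>\<^sup>+t. ennreal (1 / (2 * \<rho>)) * (if \<bar>t\<bar> < \<rho> then G (a, b) * F (a, b + t) else 0) \<partial>lborel)"
          by (intro nn_integral_cong) (auto simp: mult_ac)
        finally show "G (a, b) * vsm \<rho> F (a, b) = \<dots>" .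
      qed
      also have "\<dots> = (\<integral>\<^sup>+t. \<integral>\<^sup>+b. ennreal (1 / (2 * \<rho>)) * (if \<bar>t\<bar> < \<rho> then G (a, b) * F (a, b + t) else 0) \<partial>lborel \<partial>lborel)"
        by (rule lborel_pair.Fubini') measurable
      finally show ?thesis .
    qed
    have "(\<integral>\<^sup>+b. G (a, b) * vsm \<rho> F (a, b) \<partial>lborel)
      = (\<integral>\<^sup>+t. \<integral>\<^sup>+b. ennreal (1 / (2 * \<rho>)) * (if \<bar>- t\<bar> < \<rho> then G (a, b) * F (a, b + - t) else 0) \<partial>lborel \<partial>lborel)"
      by (subst eq, measurable, rule nn_integral_reflect[symmetric]) measurable
    also have "\<dots> = (\<integral>\<^sup>+t. \<integral>\<^sup>+b. ennreal (1 / (2 * \<rho>)) * (if \<bar>t\<bar> < \<rho> then F (a, b) * G (a, b + t) else 0) \<partial>lborel \<partial>lborel)"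
    proof (rule nn_integral_cong)
      fix t
      show "(\<integral>\<^sup>+b. ennreal (1 / (2 * \<rho>)) * (if \<bar>- t\<bar> < \<rho> then G (a, b) * F (a, b + - t) else 0) \<partial>lborel)
        = (\<integral>\<^sup>+b. ennreal (1 / (2 * \<rho>)) * (if \<bar>t\<bar> < \<rho> then F (a, b) * G (a, b + t) else 0) \<partial>lborel)"
        by (subst nn_integral_shift[of _ t, symmetric]) (auto simp: mult_ac cong: if_cong)
    qed
    also have "\<dots> = (\<integral>\<^sup>+b. F (a, b) * vsm \<rho> G (a, b) \<partial>lborel)"
      by (rule eq[symmetric]) measurable
    finally show ?thesis .
  qed
  show ?thesis
    by (simp add: nn_integral_plane col)
qed

text \<open>For fixed abscissas \<open>a\<close> and \<open>a'\<close> in the cell, translating the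
  height by \<open>s * (a - a')\<close> exchanges the endpoints of the segment; swapping the two
  outer integrals completes the exchange.\<close>

lemma lavg_sym:
  assumes [measurable]: "F \<in> borel_measurable (borel \<Otimes>\<^sub>M borel)" "G \<in> borel_measurable (borel \<Otimes>\<^sub>M borel)"
  shows "(\<integral>\<^sup>+z. G z * lavg l n m s F z \<partial>pl) = (\<integral>\<^sup>+z. F z * lavg l n m s G z \<partial>pl)"
proof -
  define H where "H F G a a' b = (if cell l n a = m \<and> cell l n a' = m
      then ennreal (2 ^ n / l) * (G (a, b) * F (a', b + s * (a' - a))) else 0)"
    for F G :: "real \<times> real \<Rightarrow> ennreal" and a a' b
  have eq: "(\<integral>\<^sup>+z. G z * lavg l n m s F z \<partial>pl) = (\<integral>\<^sup>+a. \<integral>\<^sup>+a'. \<integral>\<^sup>+b. H F G a a' b \<partial>lborel \<partial>lborel \<partial>lborel)"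
    if [measurable]: "F \<in> borel_measurable (borel \<Otimes>\<^sub>M borel)" "G \<in> borel_measurable (borel \<Otimes>\<^sub>M borel)" for F G
  proof -
    have "(\<integral>\<^sup>+z. G z * lavg l n m s F z \<partial>pl) = (\<integral>\<^sup>+a. \<integral>\<^sup>+b. G (a, b) * lavg l n m s F (a, b) \<partial>lborel \<partial>lborel)"
      by (rule nn_integral_plane) measurable
    also have "\<dots> = (\<integral>\<^sup>+a. \<integral>\<^sup>+b. \<integral>\<^sup>+a'. H F G a a' b \<partial>lborel \<partial>lborel \<partial>lborel)"
    proof (intro nn_integral_cong)
      fix a b
      show "G (a, b) * lavg l n m s F (a, b) = (\<integral>\<^sup>+a'. H F G a a' b \<partial>lborel)"
      proof (cases "cell l n a = m")
        case True
        have "G (a, b) * lavg l n m s F (a, b) = (\<integral>\<^sup>+a'. G (a, b) * (ennreal (2 ^ n / l) * (if cell l n a' = m then F (a', b + s * (a' - a)) else 0)) \<partial>lborel)"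
          using True by (simp add: lavg_Pair nn_integral_cmult)
        also have "\<dots> = (\<integral>\<^sup>+a'. H F G a a' b \<partial>lborel)"
          using True by (intro nn_integral_cong) (auto simp: H_def mult_ac)
        finally show ?thesis .
      qed (simp add: lavg_def H_def)
    qed
    also have "\<dots> = (\<integral>\<^sup>+a. \<integral>\<^sup>+a'. \<integral>\<^sup>+b. H F G a a' b \<partial>lborel \<partial>lborel \<partial>lborel)"
    proof (rule nn_integral_cong)
      fix a
      show "(\<integral>\<^sup>+b. \<integral>\<^sup>+a'. H F G a a' b \<partial>lborel \<partial>lborel) = (\<integral>\<^sup>+a'. \<integral>\<^sup>+b. H F G a a' b \<partial>lborel \<partial>lborel)"
        unfolding H_def by (rule lborel_pair.Fubini') measurable
    qed
    finally show ?thesis .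
  qed
  have "(\<integral>\<^sup>+z. G z * lavg l n m s F z \<partial>pl) = (\<integral>\<^sup>+a. \<integral>\<^sup>+a'. \<integral>\<^sup>+b. H F G a a' b \<partial>lborel \<partial>lborel \<partial>lborel)"
    by (rule eq) measurable
  also have "\<dots> = (\<integral>\<^sup>+a. \<integral>\<^sup>+a'. \<integral>\<^sup>+b. H G F a' a b \<partial>lborel \<partial>lborel \<partial>lborel)"
  proof (rule nn_integral_cong, rule nn_integral_cong)
    fix a a' :: real
    show "(\<integral>\<^sup>+b. H F G a a' b \<partial>lborel) = (\<integral>\<^sup>+b. H G F a' a b \<partial>lborel)"
    proof -
      have [measurable]: "H F G a a' \<in> borel_measurable borel" unfolding H_def by measurable
      show ?thesis
        by (subst nn_integral_shift[of _ "s * (a - a')", symmetric])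
           (auto simp: H_def mult_ac algebra_simps intro!: nn_integral_cong)
    qed
  qed
  also have "\<dots> = (\<integral>\<^sup>+a'. \<integral>\<^sup>+a. \<integral>\<^sup>+b. H G F a' a b \<partial>lborel \<partial>lborel \<partial>lborel)"
    unfolding H_def by (rule lborel_pair.Fubini') measurable
  also have "\<dots> = (\<integral>\<^sup>+z. F z * lavg l n m s G z \<partial>pl)"
    by (rule eq[symmetric]) measurable
  finally show ?thesis .
qed

lemma emeasure_window: "0 < \<rho> \<Longrightarrow> emeasure lborel {t. \<bar>t\<bar> < \<rho>} = ennreal (2 * \<rho>)" for \<rho> :: real
proof -
  assume "0 < \<rho>"
  moreover have "{t. \<bar>t\<bar> < \<rho>} = {-\<rho><..<\<rho>}" by auto
  ultimately show ?thesis by simp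
qed

lemma vsm_const: "0 < \<rho> \<Longrightarrow> vsm \<rho> (\<lambda>_. c) z = c"
proof -
  assume \<rho>: "0 < \<rho>"
  have "(\<integral>\<^sup>+t. (if \<bar>t\<bar> < \<rho> then c else 0) \<partial>lborel) = (\<integral>\<^sup>+t. c * indicator {t. \<bar>t\<bar> < \<rho>} t \<partial>lborel)"
    by (intro nn_integral_cong) (auto simp: indicator_def)
  also have "\<dots> = c * ennreal (2 * \<rho>)"
    by (subst nn_integral_cmult_indicator) (auto simp: emeasure_window[OF \<rho>])
  finally have "vsm \<rho> (\<lambda>_. c) z = c * (ennreal (1 / (2 * \<rho>)) * ennreal (2 * \<rho>))"
    by (simp add: vsm_def mult_ac)
  also have "ennreal (1 / (2 * \<rho>)) * ennreal (2 * \<rho>) = 1"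
    using \<rho> by (subst ennreal_mult'[symmetric]) auto
  finally show ?thesis by simp
qed

lemma vsm_mono: "(\<And>y. F (fst z, y) \<le> G (fst z, y)) \<Longrightarrow> vsm \<rho> F z \<le> vsm \<rho> G z"
  unfolding vsm_def by (intro mult_left_mono nn_integral_mono) auto

lemma vsm_le: "0 < \<rho> \<Longrightarrow> (\<And>z. F z \<le> c) \<Longrightarrow> vsm \<rho> F z \<le> c"
  using vsm_mono[of F z "\<lambda>_. c" \<rho>] by (simp add: vsm_const)

lemma lavg_const: "0 < l \<Longrightarrow> lavg l n m s (\<lambda>_. c) z = (if cell l n (fst z) = m then c else 0)"
proof -
  assume l: "0 < l"
  have "(\<integral>\<^sup>+a. (if cell l n a = m then c else 0) \<partial>lborel) = (\<integral>\<^sup>+a. c * indicator {a. cell l n a = m} a \<partial>lborel)"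
    by (intro nn_integral_cong) (auto simp: indicator_def)
  also have "\<dots> = c * ennreal (l / 2 ^ n)"
    by (subst nn_integral_cmult_indicator) (auto simp: emeasure_cell[OF l])
  finally have *: "ennreal (2 ^ n / l) * (\<integral>\<^sup>+a. (if cell l n a = m then c else 0) \<partial>lborel) = c * (ennreal (2 ^ n / l) * ennreal (l / 2 ^ n))"
    by (simp add: mult_ac)
  also have "ennreal (2 ^ n / l) * ennreal (l / 2 ^ n) = 1"
    using l by (subst ennreal_mult'[symmetric]) auto
  finally show ?thesis by (simp add: lavg_def)
qed

lemma lavg_mono: "(\<And>z. F z \<le> G z) \<Longrightarrow> lavg l n m s F z \<le> lavg l n m s G z"
  unfolding lavg_def by (auto intro!: mult_left_mono nn_integral_mono)

lemma lavg_le: "0 < l \<Longrightarrow> (\<And>z. F z \<le> c) \<Longrightarrow> lavg l n m s F z \<le> c"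
  using lavg_mono[of F "\<lambda>_. c" l n m s z] by (auto simp: lavg_const split: if_splits intro: order_trans)

lemma nn_integral_vsm:
  assumes "0 < \<rho>" and [measurable]: "F \<in> borel_measurable (borel \<Otimes>\<^sub>M borel)"
  shows "(\<integral>\<^sup>+z. vsm \<rho> F z \<partial>pl) = (\<integral>\<^sup>+z. F z \<partial>pl)"
  using vsm_sym[of F "\<lambda>_. 1" \<rho>] assms(1) by (simp add: vsm_const)

lemma nn_integral_lavg_le:
  assumes "0 < l" and [measurable]: "F \<in> borel_measurable (borel \<Otimes>\<^sub>M borel)"
  shows "(\<integral>\<^sup>+z. lavg l n m s F z \<partial>pl) \<le> (\<integral>\<^sup>+z. F z \<partial>pl)"
proof -
  have "(\<integral>\<^sup>+z. 1 * lavg l n m s F z \<partial>pl) = (\<integral>\<^sup>+z. F z * lavg l n m s (\<lambda>_. 1) z \<partial>pl)"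
    by (rule lavg_sym) auto
  also have "\<dots> \<le> (\<integral>\<^sup>+z. F z \<partial>pl)"
    using assms(1) by (intro nn_integral_mono) (auto simp: lavg_const)
  finally show ?thesis by simp
qed

lemma lavg_zero_off: "cell l n (fst z) \<noteq> m \<Longrightarrow> lavg l n m s F z = 0"
  by (simp add: lavg_def)

lemma lavg_along_line:
  assumes "cell l n a = m" "cell l n a0 = m"
  shows "lavg l n m s F (a, b) = lavg l n m s F (a0, b - s * (a - a0))"
  using assms by (simp add: lavg_Pair algebra_simps cong: if_cong)

lemma vsm_lavg_zero_off: "cell l n (fst z) \<noteq> m \<Longrightarrow> vsm \<rho> (lavg l n m s F) z = 0"
  by (simp add: vsm_def lavg_def cong: if_cong)

lemma vsm_lavg_along_line:
  assumes "cell l n a = m" "cell l n a0 = m"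
  shows "vsm \<rho> (lavg l n m s F) (a, b) = vsm \<rho> (lavg l n m s F) (a0, b - s * (a - a0))"
proof -
  have "lavg l n m s F (a, b + t) = lavg l n m s F (a0, b - s * (a - a0) + t)" for t
    using lavg_along_line[OF assms, of s F "b + t"] by (simp add: algebra_simps)
  then show ?thesis by (simp add: vsm_Pair cong: if_cong)
qed

text \<open>A window displaced by at most \<open>w\<close> lies in the union of those displaced by
  exactly \<open>-w\<close> and \<open>w\<close>, which overlap because \<open>w < \<rho>\<close>.
  Two fixed displacements thus replace an unknown one that varies from tile to tile.\<close>

lemma vsm_regular:
  assumes F[measurable]: "F \<in> borel_measurable (borel \<Otimes>\<^sub>M borel)" and "\<bar>e\<bar> \<le> w" "w < \<rho>"
  shows "vsm \<rho> F (a, y + e) \<le> vsm \<rho> F (a, y - w) + vsm \<rho> F (a, y + w)"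
proof -
  have sh: "(\<integral>\<^sup>+t. (if \<bar>t\<bar> < \<rho> then F (a, y + c + t) else 0) \<partial>lborel)
      = (\<integral>\<^sup>+t. (if \<bar>t - c\<bar> < \<rho> then F (a, y + t) else 0) \<partial>lborel)" for c
    by (subst nn_integral_shift[of _ "- c", symmetric]) (auto intro!: nn_integral_cong)
  have "(\<integral>\<^sup>+t. (if \<bar>t - e\<bar> < \<rho> then F (a, y + t) else 0) \<partial>lborel)
    \<le> (\<integral>\<^sup>+t. (if \<bar>t - (- w)\<bar> < \<rho> then F (a, y + t) else 0) + (if \<bar>t - w\<bar> < \<rho> then F (a, y + t) else 0) \<partial>lborel)"
    using assms by (intro nn_integral_mono) (auto split: if_splits)
  also have "\<dots> = (\<integral>\<^sup>+t. (if \<bar>t - (- w)\<bar> < \<rho> then F (a, y + t) else 0) \<partial>lborel) + (\<integral>\<^sup>+t. (if \<bar>t - w\<bar> < \<rho> then F (a, y + t) else 0) \<partial>lborel)"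
    by (rule nn_integral_add) auto
  finally have "(\<integral>\<^sup>+t. (if \<bar>t\<bar> < \<rho> then F (a, y + e + t) else 0) \<partial>lborel)
    \<le> (\<integral>\<^sup>+t. (if \<bar>t\<bar> < \<rho> then F (a, y + (- w) + t) else 0) \<partial>lborel) + (\<integral>\<^sup>+t. (if \<bar>t\<bar> < \<rho> then F (a, y + w + t) else 0) \<partial>lborel)"
    by (simp only: sh)
  then show ?thesis
    unfolding vsm_Pair diff_conv_add_uminus distrib_left[symmetric] by (rule mult_left_mono) simp
qed

text \<open>The window fits into a cell of one of the two grids; 6 is the ratio of the longest
  admissible cell, \<open>12 * r\<close>, to the window, \<open>2 * r\<close>.\<close>

lemma vsm_window_to_cells:
  assumes l: "0 < l" and r: "0 < r" "6 * r \<le> l / 2 ^ n" "l / 2 ^ n \<le> 12 * r"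
    and [measurable]: "F \<in> borel_measurable (borel \<Otimes>\<^sub>M borel)"
  shows "vsm r F (a, b) \<le> 6 * (cavg l 0 n (\<lambda>y. F (a, y)) b + cavg l (l / 3) n (\<lambda>y. F (a, y)) b)"
proof -
  obtain s where s: "s = 0 \<or> s = l / 3"
    "\<And>x y. \<bar>x - b\<bar> < r \<Longrightarrow> \<bar>y - b\<bar> < r \<Longrightarrow> cell l n (x + s) = cell l n (y + s)"
    using one_third_trick[OF l less_imp_le[OF r(1)] r(2)] by blast
  have "vsm r F (a, b) = ennreal (1 / (2 * r)) * (\<integral>\<^sup>+y. (if \<bar>y - b\<bar> < r then F (a, y) else 0) \<partial>lborel)"
    unfolding vsm_Pair by (subst (2) nn_integral_shift[of _ b, symmetric]) (auto simp: add.commute cong: if_cong)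
  also have "\<dots> \<le> ennreal (1 / (2 * r)) * (\<integral>\<^sup>+y. (if cell l n (y + s) = cell l n (b + s) then F (a, y) else 0) \<partial>lborel)"
    using r(1) by (intro mult_left_mono nn_integral_mono) (auto dest: s(2)[of _ b])
  also have "ennreal (1 / (2 * r)) \<le> ennreal (6 * (2 ^ n / l))"
    using r l by (intro ennreal_leI) (simp add: field_simps)
  also have "ennreal (6 * (2 ^ n / l)) = 6 * ennreal (2 ^ n / l)"
    using l by (subst ennreal_mult') auto
  also have "6 * ennreal (2 ^ n / l) * (\<integral>\<^sup>+y. (if cell l n (y + s) = cell l n (b + s) then F (a, y) else 0) \<partial>lborel) = 6 * cavg l s n (\<lambda>y. F (a, y)) b"
    by (simp add: cavg_def mult.assoc)
  also have "\<dots> \<le> 6 * (cavg l 0 n (\<lambda>y. F (a, y)) b + cavg l (l / 3) n (\<lambda>y. F (a, y)) b)"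
    using s(1) by (intro mult_left_mono) auto
  finally show ?thesis by (simp add: mult_right_mono)
qed

text \<open>Along slope \<open>s'\<close>, a function constant along slope \<open>s\<close> is seen
  at heights sliding with speed \<open>s' - s\<close>. The line average therefore becomes an average
  in one column, over a window that covers both the slide and the inner window.\<close>

lemma lavg_vsm_le_window:
  fixes s s' :: real
  assumes l: "0 < l" and \<rho>: "0 < \<rho>" and F[measurable]: "F \<in> borel_measurable (borel \<Otimes>\<^sub>M borel)"
    and a: "cell l n a = m"
    and line: "\<And>a' y. cell l n a' = m \<Longrightarrow> F (a', y) = F (a, y - s * (a' - a))"
  defines "r \<equiv> \<bar>s' - s\<bar> * (l / 2 ^ n) + \<rho>"
  shows "lavg l n m s' (vsm \<rho> F) (a, b) \<le> 4 * vsm r F (a, b)"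
proof -
  define L where "L = l / 2 ^ n"
  define e where "e = s' - s"
  define Q where "Q = (\<integral>\<^sup>+y. (if \<bar>y\<bar> < r then F (a, b + y) else 0) \<partial>lborel)"
  define H where "H a' t = (if cell l n a' = m \<and> \<bar>t\<bar> < \<rho> then F (a, b + (e * (a' - a) + t)) else 0)" for a' t
  have L: "0 < L" and r: "0 < r" "r = \<bar>e\<bar> * L + \<rho>"
    using l \<rho> by (auto simp: L_def r_def e_def intro: add_nonneg_pos)
  have [measurable]: "(\<lambda>(a', t). H a' t) \<in> borel_measurable (borel \<Otimes>\<^sub>M borel)"
    unfolding H_def by measurable
  have lhs: "lavg l n m s' (vsm \<rho> F) (a, b) = ennreal (1 / L) * (ennreal (1 / (2 * \<rho>)) * (\<integral>\<^sup>+a'. \<integral>\<^sup>+t. H a' t \<partial>lborel \<partial>lborel))"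
  proof -
    have "lavg l n m s' (vsm \<rho> F) (a, b) = ennreal (1 / L) * (\<integral>\<^sup>+a'. (if cell l n a' = m then vsm \<rho> F (a', b + s' * (a' - a)) else 0) \<partial>lborel)"
      using a by (simp add: lavg_Pair L_def)
    also have "(\<integral>\<^sup>+a'. (if cell l n a' = m then vsm \<rho> F (a', b + s' * (a' - a)) else 0) \<partial>lborel)
      = (\<integral>\<^sup>+a'. ennreal (1 / (2 * \<rho>)) * (\<integral>\<^sup>+t. H a' t \<partial>lborel) \<partial>lborel)"
    proof (rule nn_integral_cong)
      fix a'
      show "(if cell l n a' = m then vsm \<rho> F (a', b + s' * (a' - a)) else 0) = ennreal (1 / (2 * \<rho>)) * (\<integral>\<^sup>+t. H a' t \<partial>lborel)"
      proof (cases "cell l n a' = m")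
        case True
        have "F (a', b + s' * (a' - a) + t) = F (a, b + (e * (a' - a) + t))" for t
          using line[OF True, of "b + s' * (a' - a) + t"] by (simp add: e_def algebra_simps)
        then show ?thesis using True by (simp add: vsm_Pair H_def cong: if_cong)
      qed (simp add: H_def)
    qed
    also have "\<dots> = ennreal (1 / (2 * \<rho>)) * (\<integral>\<^sup>+a'. \<integral>\<^sup>+t. H a' t \<partial>lborel \<partial>lborel)"
      by (rule nn_integral_cmult) measurable
    finally show ?thesis .
  qed
  have dist: "\<bar>e * (a' - a)\<bar> \<le> \<bar>e\<bar> * L" if "cell l n a' = m" for a'
    unfolding abs_mult using cell_le_dist[OF l, of n a' a] that a by (intro mult_left_mono) (auto simp: L_def)
  have rhs: "4 * vsm r F (a, b) = ennreal (4 * (1 / (2 * r))) * Q"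
    by (subst ennreal_mult') (simp_all add: vsm_Pair Q_def mult.assoc)
  show ?thesis
  proof (cases "\<bar>e\<bar> * L \<le> \<rho>")
    \<comment> \<open>Slow slide: each displaced inner window lies in the window of radius
      \<open>r\<close>, and \<open>r\<close> is at most \<open>2 * \<rho>\<close>.\<close>
    case True
    have "(\<integral>\<^sup>+a'. \<integral>\<^sup>+t. H a' t \<partial>lborel \<partial>lborel) \<le> (\<integral>\<^sup>+a'. Q * indicator {a'. cell l n a' = m} a' \<partial>lborel)"
    proof (rule nn_integral_mono)
      fix a'
      show "(\<integral>\<^sup>+t. H a' t \<partial>lborel) \<le> Q * indicator {a'. cell l n a' = m} a'"
      proof (cases "cell l n a' = m")
        case True
        have "(\<integral>\<^sup>+t. H a' t \<partial>lborel) = (\<integral>\<^sup>+y. (if \<bar>y - e * (a' - a)\<bar> < \<rho> then F (a, b + y) else 0) \<partial>lborel)"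
          using True by (subst (2) nn_integral_shift[of _ "e * (a' - a)", symmetric])
            (auto simp: H_def add_ac intro!: nn_integral_cong)
        also have "\<dots> \<le> Q"
          unfolding Q_def using dist[OF True] r(2) by (intro nn_integral_mono) (auto split: if_splits)
        finally show ?thesis using True by simp
      qed (simp add: H_def)
    qed
    also have "\<dots> = Q * ennreal L"
      by (subst nn_integral_cmult_indicator) (auto simp: emeasure_cell[OF l] L_def)
    finally have "lavg l n m s' (vsm \<rho> F) (a, b) \<le> ennreal (1 / L) * (ennreal (1 / (2 * \<rho>)) * (Q * ennreal L))"
      unfolding lhs by (intro mult_left_mono) auto
    also have "\<dots> = (ennreal (1 / L) * ennreal (1 / (2 * \<rho>)) * ennreal L) * Q"
      by (simp add: mult_ac)
    also have "\<dots> = ennreal (1 / L * (1 / (2 * \<rho>)) * L) * Q"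
      using L \<rho> by (subst ennreal_mult'[symmetric], simp)+ simp
    also have "\<dots> \<le> ennreal (4 * (1 / (2 * r))) * Q"
      using L \<rho> r True by (intro mult_right_mono ennreal_leI) (auto simp: field_simps)
    finally show ?thesis unfolding rhs .
  next
    \<comment> \<open>Fast slide: \<open>y = e * (a' - a) + t\<close> is a change of variables with
      Jacobian \<open>1 / \<bar>e\<bar>\<close>, and \<open>r\<close> is at most
      \<open>2 * \<bar>e\<bar> * L\<close>.\<close>
    case False
    then have e: "e \<noteq> 0" "\<rho> < \<bar>e\<bar> * L" using \<rho> by auto
    have "(\<integral>\<^sup>+a'. \<integral>\<^sup>+t. H a' t \<partial>lborel \<partial>lborel) = (\<integral>\<^sup>+t. \<integral>\<^sup>+a'. H a' t \<partial>lborel \<partial>lborel)"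
      by (rule lborel_pair.Fubini') measurable
    also have "\<dots> \<le> (\<integral>\<^sup>+t. (ennreal (1 / \<bar>e\<bar>) * Q) * indicator {t. \<bar>t\<bar> < \<rho>} t \<partial>lborel)"
    proof (rule nn_integral_mono)
      fix t
      show "(\<integral>\<^sup>+a'. H a' t \<partial>lborel) \<le> (ennreal (1 / \<bar>e\<bar>) * Q) * indicator {t. \<bar>t\<bar> < \<rho>} t"
      proof (cases "\<bar>t\<bar> < \<rho>")
        case True
        define f where "f y = (if \<bar>y\<bar> < r then F (a, b + y) else 0)" for y
        have [measurable]: "f \<in> borel_measurable borel" unfolding f_def by measurable
        have "(\<integral>\<^sup>+a'. H a' t \<partial>lborel) \<le> (\<integral>\<^sup>+a'. f (t - e * a + e * a') \<partial>lborel)"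
        proof (rule nn_integral_mono)
          fix a'
          have eq: "t - e * a + e * a' = e * (a' - a) + t" by (simp add: algebra_simps)
          show "H a' t \<le> f (t - e * a + e * a')"
            unfolding eq H_def f_def using dist[of a'] True r(2) by (auto simp: field_simps)
        qed
        also have "\<dots> = ennreal (1 / \<bar>e\<bar>) * (ennreal \<bar>e\<bar> * (\<integral>\<^sup>+a'. f (t - e * a + e * a') \<partial>lborel))"
          using e by (simp add: mult.assoc[symmetric] flip: ennreal_mult')
        also have "ennreal \<bar>e\<bar> * (\<integral>\<^sup>+a'. f (t - e * a + e * a') \<partial>lborel) = (\<integral>\<^sup>+y. f y \<partial>lborel)"
          by (rule nn_integral_real_affine[symmetric]) (use e in auto)
        finally show ?thesis using True by (simp add: Q_def f_def)
      qed (simp add: H_def)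
    qed
    also have "\<dots> = (ennreal (1 / \<bar>e\<bar>) * Q) * ennreal (2 * \<rho>)"
      by (subst nn_integral_cmult_indicator) (auto simp: emeasure_window[OF \<rho>])
    finally have "lavg l n m s' (vsm \<rho> F) (a, b) \<le> ennreal (1 / L) * (ennreal (1 / (2 * \<rho>)) * ((ennreal (1 / \<bar>e\<bar>) * Q) * ennreal (2 * \<rho>)))"
      unfolding lhs by (intro mult_left_mono) auto
    also have "\<dots> = (ennreal (1 / L) * ennreal (1 / (2 * \<rho>)) * ennreal (1 / \<bar>e\<bar>) * ennreal (2 * \<rho>)) * Q"
      by (simp add: mult_ac)
    also have "\<dots> = ennreal (1 / L * (1 / (2 * \<rho>)) * (1 / \<bar>e\<bar>) * (2 * \<rho>)) * Q"
      using L \<rho> by (subst ennreal_mult'[symmetric], simp)+ simp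
    also have "\<dots> \<le> ennreal (4 * (1 / (2 * r))) * Q"
      using L \<rho> r e by (intro mult_right_mono ennreal_leI) (auto simp: field_simps)
    finally show ?thesis unfolding rhs .
  qed
qed

section \<open>Generations of live tiles\<close>

text \<open>\<open>l\<close> is the coarsest base length and \<open>\<eta>\<close> the density that
  makes a tile live. The constant 256 makes \<open>4 * D * \<epsilon>\<^sup>2\<close> at most 1/64
  for \<open>\<epsilon> = 1 / (\<eta> * D)\<close>, as the decay between generations
  requires.\<close>

locale slope_field =
  fixes l w \<eta> :: real and v :: "real \<Rightarrow> real" and D :: nat
  assumes l: "0 < l" and w: "0 < w" and \<eta>: "0 < \<eta>" "\<eta> \<le> 1"
    and v[measurable]: "v \<in> borel_measurable borel" and D: "256 / \<eta>\<^sup>2 \<le> D"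
begin

text \<open>Slope cells of depth n have length \<open>w * 2 ^ n / l\<close>, reciprocal to the base cells: they become
  coarser as n grows.\<close>
definition slc :: "nat \<Rightarrow> real \<Rightarrow> int" where
  "slc n s = \<lfloor>s * l / w / 2 ^ n\<rfloor>"

lemma slc_measurable[measurable]: "slc n \<in> borel \<rightarrow>\<^sub>M count_space UNIV"
  unfolding slc_def by measurable

lemma slc_div: "n \<le> n' \<Longrightarrow> slc n' s = slc n s div 2 ^ (n' - n)"
proof -
  assume "n \<le> n'"
  then have "(2::real) ^ n' = 2 ^ n * 2 ^ (n' - n)" by (simp flip: power_add)
  then show ?thesis
    using floor_divide_power2[of "s * l / w / 2 ^ n" "n' - n"] by (simp add: slc_def mult.assoc)
qed

definition len :: "nat \<Rightarrow> real" where
  "len n = l / 2 ^ n"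

lemma len_pos: "0 < len n" and len_Suc: "len n = 2 * len (Suc n)"
  using l by (auto simp: len_def)

lemma emeasure_cell': "emeasure lborel {a. cell l n a = m} = ennreal (len n)"
  using emeasure_cell[OF l] by (simp add: len_def)

definition cmeas :: "nat \<Rightarrow> int \<Rightarrow> (real \<Rightarrow> bool) \<Rightarrow> real" where
  "cmeas n m P = measure lborel {a. cell l n a = m \<and> P a}"

lemma cmeas_emeasure:
  assumes "Measurable.pred borel P"
  shows "emeasure lborel {a. cell l n a = m \<and> P a} = ennreal (cmeas n m P)"
proof -
  have [measurable]: "Measurable.pred borel P" by fact
  have "emeasure lborel {a. cell l n a = m \<and> P a} \<le> emeasure lborel {a. cell l n a = m}"
    by (rule emeasure_mono) auto
  then have "emeasure lborel {a. cell l n a = m \<and> P a} < top"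
    by (metis emeasure_cell' ennreal_less_top le_less_trans)
  then show ?thesis unfolding cmeas_def by (intro emeasure_eq_ennreal_measure) auto
qed

lemma cmeas_True: "cmeas n m (\<lambda>_. True) = len n"
  using emeasure_cell'[of n m] len_pos[of n] by (simp add: cmeas_def measure_def)

lemma cmeas_nonneg: "0 \<le> cmeas n m P"
  by (simp add: cmeas_def)

lemma cmeas_mono:
  assumes "Measurable.pred borel P" "Measurable.pred borel Q" "\<And>a. cell l n a = m \<Longrightarrow> P a \<Longrightarrow> Q a"
  shows "cmeas n m P \<le> cmeas n m Q"
proof -
  have [measurable]: "Measurable.pred borel P" "Measurable.pred borel Q" by fact+
  have "emeasure lborel {a. cell l n a = m \<and> P a} \<le> emeasure lborel {a. cell l n a = m \<and> Q a}"
    using assms(3) by (intro emeasure_mono) auto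
  then show ?thesis by (simp add: cmeas_emeasure assms cmeas_nonneg)
qed

lemma cmeas_le: "Measurable.pred borel P \<Longrightarrow> cmeas n m P \<le> len n"
  using cmeas_mono[of P "\<lambda>_. True" n m] by (simp add: cmeas_True)

lemma cmeas_disj:
  assumes "Measurable.pred borel P" "Measurable.pred borel Q" "\<And>a. cell l n a = m \<Longrightarrow> \<not> (P a \<and> Q a)"
  shows "cmeas n m (\<lambda>a. P a \<or> Q a) = cmeas n m P + cmeas n m Q"
proof -
  have [measurable]: "Measurable.pred borel P" "Measurable.pred borel Q" by fact+
  have "emeasure lborel ({a. cell l n a = m \<and> P a} \<union> {a. cell l n a = m \<and> Q a})
    = emeasure lborel {a. cell l n a = m \<and> P a} + emeasure lborel {a. cell l n a = m \<and> Q a}"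
    using assms(3) by (intro plus_emeasure[symmetric]) auto
  also have "{a. cell l n a = m \<and> P a} \<union> {a. cell l n a = m \<and> Q a} = {a. cell l n a = m \<and> (P a \<or> Q a)}"
    by auto
  finally show ?thesis
    by (simp add: cmeas_emeasure cmeas_nonneg flip: ennreal_plus)
qed

lemma cmeas_children:
  assumes P: "Measurable.pred borel P"
  shows "cmeas n m P = cmeas (Suc n) (2 * m) P + cmeas (Suc n) (2 * m + 1) P"
proof -
  have [measurable]: "Measurable.pred borel P" by fact
  have "cell l n a = m \<longleftrightarrow> cell l (Suc n) a = 2 * m \<or> cell l (Suc n) a = 2 * m + 1" for a
    using cell_Suc_div[of l n a] by presburger
  then have eq: "{a. cell l n a = m \<and> P a}
      = {a. cell l (Suc n) a = 2 * m \<and> P a} \<union> {a. cell l (Suc n) a = 2 * m + 1 \<and> P a}"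
    by auto
  have "emeasure lborel {a. cell l n a = m \<and> P a}
    = emeasure lborel {a. cell l (Suc n) a = 2 * m \<and> P a} + emeasure lborel {a. cell l (Suc n) a = 2 * m + 1 \<and> P a}"
    unfolding eq by (intro plus_emeasure[symmetric]) auto
  then show ?thesis
    by (simp add: cmeas_emeasure[OF P] cmeas_nonneg flip: ennreal_plus)
qed

section \<open>Live slope cells and the recursion into generations\<close>

definition live :: "nat \<Rightarrow> int \<Rightarrow> int \<Rightarrow> bool" where
  "live n m j \<longleftrightarrow> \<eta> * len n \<le> cmeas n m (\<lambda>a. slc n (v a) = j)"

text \<open>Distinct slope cells of one depth select disjoint parts of the base cell, so their lower
  bounds add.\<close>

lemma live_sum_le:
  assumes "finite S" "\<And>j. j \<in> S \<Longrightarrow> live n m j"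
  shows "card S * (\<eta> * len n) \<le> cmeas n m (\<lambda>a. slc n (v a) \<in> S)"
  using assms
proof (induction S rule: finite_induct)
  case (insert j S)
  have "cmeas n m (\<lambda>a. slc n (v a) \<in> insert j S) = cmeas n m (\<lambda>a. slc n (v a) = j \<or> slc n (v a) \<in> S)"
    by (simp add: cmeas_def)
  also have "\<dots> = cmeas n m (\<lambda>a. slc n (v a) = j) + cmeas n m (\<lambda>a. slc n (v a) \<in> S)"
    using insert by (intro cmeas_disj) auto
  finally have "cmeas n m (\<lambda>a. slc n (v a) \<in> insert j S)
      = cmeas n m (\<lambda>a. slc n (v a) = j) + cmeas n m (\<lambda>a. slc n (v a) \<in> S)" .
  moreover have "\<eta> * len n \<le> cmeas n m (\<lambda>a. slc n (v a) = j)"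
    using insert.prems by (simp add: live_def)
  moreover have "card S * (\<eta> * len n) \<le> cmeas n m (\<lambda>a. slc n (v a) \<in> S)"
    using insert by simp
  moreover have "card (insert j S) * (\<eta> * len n) = \<eta> * len n + card S * (\<eta> * len n)"
    using insert.hyps by (simp add: distrib_right)
  ultimately show ?case by linarith
qed (simp add: cmeas_nonneg)

lemma live_card:
  assumes "finite S" "\<And>j. j \<in> S \<Longrightarrow> live n m j"
  shows "card S * \<eta> \<le> 1"
proof -
  have "card S * \<eta> * len n \<le> 1 * len n"
    using live_sum_le[OF assms] cmeas_le[of "\<lambda>a. slc n (v a) \<in> S" n m] by (simp add: mult_ac)
  then show ?thesis using len_pos[of n] by (simp only: mult_le_cancel_right_pos)
qed

lemma finite_live: "finite {j. live n m j}"
proof (rule finite_if_finite_subsets_card_bdd[of _ "nat \<lceil>1 / \<eta>\<rceil>", THEN conjunct1])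
  fix G assume "G \<subseteq> {j. live n m j}" "finite G"
  then have "card G * \<eta> \<le> 1" by (intro live_card) auto
  then have "card G \<le> 1 / \<eta>" using \<eta> by (simp add: field_simps)
  then show "card G \<le> nat \<lceil>1 / \<eta>\<rceil>" by linarith
qed

definition Lv :: "nat \<Rightarrow> int \<Rightarrow> (nat \<times> int) set" where
  "Lv n m = Pair n ` {j. live n m j}"

text \<open>Slope cells of depth \<open>n\<close> are coarser than those of depth
  \<open>n' \<le> n\<close>, and \<open>j' div 2 ^ (n - n')\<close> is the cell of depth
  \<open>n\<close> that contains the recorded one.\<close>

definition nw :: "nat \<Rightarrow> int \<Rightarrow> (nat \<times> int) set \<Rightarrow> (nat \<times> int) set" where
  "nw n m A = Pair n ` {j. live n m j \<and> (\<forall>(n', j')\<in>A. j' div 2 ^ (n - n') \<noteq> j)}"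

text \<open>Descending from the coarsest cell, a base cell inherits the slope cells recorded by its parent
  and adds its live slope cells that contain no recorded one. As soon as more than D are recorded, a
  new generation starts with the live cells only.\<close>
primrec st :: "nat \<Rightarrow> int \<Rightarrow> nat \<times> (nat \<times> int) set" where
  "st 0 m = (0, Lv 0 m)"
| "st (Suc n) m = (let g = fst (st n (m div 2)); A = snd (st n (m div 2)); A' = A \<union> nw (Suc n) m A in
     if card A' \<le> D then (g, A') else (Suc g, Lv (Suc n) m))"

abbreviation "gen n m \<equiv> fst (st n m)"
abbreviation "tops n m \<equiv> snd (st n m)"

lemma D_pos: "0 < D" and D_ge: "1 / \<eta> \<le> D"
proof -
  have "0 < 256 / \<eta>\<^sup>2" using \<eta> by simp
  then have "0 < real D" using D by linarith
  then show "0 < D" by simp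
  have "\<eta>\<^sup>2 \<le> \<eta>" using \<eta> by (simp add: power2_eq_square mult_left_le)
  then have "1 / \<eta> \<le> 1 / \<eta>\<^sup>2" using \<eta> by (simp add: frac_le)
  also have "\<dots> \<le> 256 / \<eta>\<^sup>2" by (simp add: divide_right_mono)
  finally show "1 / \<eta> \<le> D" using D by linarith
qed

lemma finite_Lv: "finite (Lv n m)" and card_Lv: "card (Lv n m) \<le> D"
proof -
  show "finite (Lv n m)" by (simp add: Lv_def finite_live)
  have "card (Lv n m) = card {j. live n m j}"
    unfolding Lv_def by (rule card_image) (simp add: inj_on_def)
  moreover have "card {j. live n m j} * \<eta> \<le> 1"
    by (rule live_card[OF finite_live]) simp
  ultimately have "card (Lv n m) * \<eta> \<le> 1" by (simp only:)
  then have "real (card (Lv n m)) \<le> 1 / \<eta>"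
    using \<eta>(1) by (simp only: le_divide_eq) simp
  then have "real (card (Lv n m)) \<le> real D" using D_ge by linarith
  then show "card (Lv n m) \<le> D" by (simp only: of_nat_le_iff)
qed

lemma finite_nw: "finite (nw n m A)"
  unfolding nw_def by (intro finite_imageI finite_subset[OF _ finite_live[of n m]]) auto

lemma gen_Suc: "gen (Suc n) m = gen n (m div 2) \<and> tops (Suc n) m = tops n (m div 2) \<union> nw (Suc n) m (tops n (m div 2))
     \<and> card (tops n (m div 2) \<union> nw (Suc n) m (tops n (m div 2))) \<le> D
   \<or> gen (Suc n) m = Suc (gen n (m div 2)) \<and> tops (Suc n) m = Lv (Suc n) m
     \<and> D < card (tops n (m div 2) \<union> nw (Suc n) m (tops n (m div 2)))"
  by (auto simp: Let_def)

declare st.simps(2)[simp del]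

lemma tops_inv: "finite (tops n m)" "card (tops n m) \<le> D" "(n', j') \<in> tops n m \<Longrightarrow> n' \<le> n"
proof -
  have "finite (tops n m) \<and> card (tops n m) \<le> D \<and> (\<forall>(n', j')\<in>tops n m. n' \<le> n)"
  proof (induction n arbitrary: m)
    case 0
    then show ?case by (auto simp: finite_Lv card_Lv) (auto simp: Lv_def)
  next
    case (Suc n)
    have IH: "finite (tops n (m div 2))" "\<forall>(n', j')\<in>tops n (m div 2). n' \<le> Suc n"
      using Suc[of "m div 2"] by (auto intro: le_SucI)
    have new: "\<forall>(n', j')\<in>nw (Suc n) m A. n' \<le> Suc n" "\<forall>(n', j')\<in>Lv (Suc n) m. n' \<le> Suc n" for A
      by (auto simp: nw_def Lv_def)
    from gen_Suc[of n m] show ?case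
    proof (elim disjE conjE)
      assume "tops (Suc n) m = tops n (m div 2) \<union> nw (Suc n) m (tops n (m div 2))"
        "card (tops n (m div 2) \<union> nw (Suc n) m (tops n (m div 2))) \<le> D"
      then show ?case using IH new(1) by (simp add: finite_nw ball_Un)
    next
      assume "tops (Suc n) m = Lv (Suc n) m"
      then show ?case using new(2) by (simp add: finite_Lv card_Lv)
    qed
  qed
  then show "finite (tops n m)" "card (tops n m) \<le> D" "(n', j') \<in> tops n m \<Longrightarrow> n' \<le> n" by auto
qed

text \<open>Either a record inherited from the parent already lies in \<open>j\<close>, or
  \<open>j\<close> itself enters through \<open>nw\<close>; after a reset \<open>j\<close> is
  recorded directly.\<close>

lemma live_covered: "live n m j \<Longrightarrow> \<exists>(n', j')\<in>tops n m. j' div 2 ^ (n - n') = j"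
proof (cases n)
  case 0
  assume "live n m j" then show ?thesis using 0 by (auto simp: Lv_def)
next
  case (Suc k)
  assume j: "live n m j"
  show ?thesis
  proof (cases "\<exists>(n', j')\<in>tops k (m div 2). j' div 2 ^ (n - n') = j")
    case True
    then obtain n' j' where p: "(n', j') \<in> tops k (m div 2)" "j' div 2 ^ (n - n') = j" by blast
    have "(n', j') \<in> tops n m \<or> (n, j) \<in> tops n m"
      using gen_Suc[of k m] p(1) j unfolding Suc by (auto simp: Lv_def)
    then show ?thesis
    proof
      assume "(n', j') \<in> tops n m"
      then show ?thesis by (rule bexI[rotated]) (simp add: p(2))
    next
      assume "(n, j) \<in> tops n m"
      then show ?thesis by (rule bexI[rotated]) simp
    qed
  next
    case False
    then have "(n, j) \<in> nw n m (tops k (m div 2))" "(n, j) \<in> Lv n m"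
      using j by (auto simp: nw_def Lv_def)
    then have "(n, j) \<in> tops n m" using gen_Suc[of k m] unfolding Suc by blast
    then show ?thesis by (rule bexI[rotated]) simp
  qed
qed

lemma gen_mono: "n \<le> n' \<Longrightarrow> gen n (cell l n a) \<le> gen n' (cell l n' a)"
proof (induction n' rule: dec_induct)
  case (step k)
  then show ?case using gen_Suc[of k "cell l (Suc k) a"] by (auto simp: cell_Suc_div)
qed simp

lemma tops_mono: "n \<le> n' \<Longrightarrow> gen n (cell l n a) = gen n' (cell l n' a) \<Longrightarrow> tops n (cell l n a) \<subseteq> tops n' (cell l n' a)"
proof (induction n' rule: dec_induct)
  case (step k)
  have "gen n (cell l n a) \<le> gen k (cell l k a)" using step by (intro gen_mono)
  then show ?case using step gen_Suc[of k "cell l (Suc k) a"] by (auto simp: cell_Suc_div)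
qed simp

text \<open>Within one generation the records of a column only grow with depth, so the record at the
  last depth of generation \<open>i\<close> contains all earlier ones and still obeys the bound
  \<open>D\<close>.\<close>

lemma column_tops:
  "\<exists>A. finite A \<and> card A \<le> D \<and> (\<forall>n\<le>N. gen n (cell l n a) = i \<longrightarrow> tops n (cell l n a) \<subseteq> A)"
proof (cases "\<exists>n\<le>N. gen n (cell l n a) = i")
  case True
  define S where "S = {n. n \<le> N \<and> gen n (cell l n a) = i}"
  have S: "finite S" "S \<noteq> {}" using True by (auto simp: S_def)
  then have mx: "Max S \<in> S" "\<And>n. n \<in> S \<Longrightarrow> n \<le> Max S" by (rule Max_in) (rule Max_ge[OF S(1)])
  have "tops n (cell l n a) \<subseteq> tops (Max S) (cell l (Max S) a)" if "n \<le> N" "gen n (cell l n a) = i" for n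
  proof (rule tops_mono)
    show "n \<le> Max S" using that by (intro mx(2)) (simp add: S_def)
    show "gen n (cell l n a) = gen (Max S) (cell l (Max S) a)" using mx(1) that by (simp add: S_def)
  qed
  then show ?thesis
    using tops_inv(1,2) by (intro exI[of _ "tops (Max S) (cell l (Max S) a)"]) simp
qed (auto intro!: exI[of _ "{}"])

section \<open>A potential that bounds the measure of late columns\<close>

definition used :: "nat \<Rightarrow> int \<Rightarrow> (nat \<times> int) set \<Rightarrow> real" where
  "used n m A = cmeas n m (\<lambda>a. \<exists>p\<in>A. slc (fst p) (v a) = snd p)"

text \<open>Recording a new live slope cell raises the cardinality term by \<open>len n\<close>, but uses up fresh measure
  \<open>\<eta> * len n\<close>, so the potential does not increase. Hence few points can see a new generation.\<close>
definition pot :: "nat \<Rightarrow> int \<Rightarrow> (nat \<times> int) set \<Rightarrow> real" where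
  "pot n m A = card A * len n + (len n - used n m A) / \<eta>"

lemma used_pred[measurable]: "finite A \<Longrightarrow> Measurable.pred borel (\<lambda>a. \<exists>p\<in>A. slc (fst p) (v a) = snd p)"
  by (intro pred_intros_finite) auto

lemma pot_ge: "finite A \<Longrightarrow> card A * len n \<le> pot n m A"
  unfolding pot_def used_def using cmeas_le[OF used_pred] \<eta> by simp

lemma pot_nonneg: "finite A \<Longrightarrow> 0 \<le> pot n m A"
  using pot_ge[of A n m] len_pos[of n] by (meson less_imp_le mult_nonneg_nonneg of_nat_0_le_iff order_trans)

lemma pot_children: "finite A \<Longrightarrow> pot n m A = pot (Suc n) (2 * m) A + pot (Suc n) (2 * m + 1) A"
  unfolding pot_def used_def by (subst cmeas_children[OF used_pred]) (auto simp: len_Suc[of n] add_divide_distrib diff_divide_distrib algebra_simps)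

lemma pot_nw:
  assumes A: "finite A" "\<And>n' j'. (n', j') \<in> A \<Longrightarrow> n' \<le> n"
  shows "pot n m (A \<union> nw n m A) \<le> pot n m A"
proof -
  define S where "S = {j. live n m j \<and> (\<forall>(n', j')\<in>A. j' div 2 ^ (n - n') \<noteq> j)}"
  have S: "finite S" "\<And>j. j \<in> S \<Longrightarrow> live n m j" and nw: "nw n m A = Pair n ` S"
    by (auto simp: S_def nw_def intro: finite_subset[OF _ finite_live[of n m]])
  have cnw: "card (nw n m A) = card S"
    unfolding nw by (rule card_image) (simp add: inj_on_def)
  have "used n m (A \<union> nw n m A) = cmeas n m (\<lambda>a. (\<exists>p\<in>A. slc (fst p) (v a) = snd p) \<or> slc n (v a) \<in> S)"
    unfolding used_def nw by (rule arg_cong[where f = "cmeas n m"]) (auto simp: fun_eq_iff bex_Un)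
  also have "\<dots> = used n m A + cmeas n m (\<lambda>a. slc n (v a) \<in> S)"
    unfolding used_def
  proof (rule cmeas_disj)
    fix a
    \<comment> \<open>If \<open>v a\<close> lies in a recorded cell, its slope cell of depth
      \<open>n\<close> is the one containing that record, and \<open>nw\<close> admits no such cell.
      The measure newly used is therefore fresh.\<close>
    show "\<not> ((\<exists>p\<in>A. slc (fst p) (v a) = snd p) \<and> slc n (v a) \<in> S)"
    proof
      assume *: "(\<exists>p\<in>A. slc (fst p) (v a) = snd p) \<and> slc n (v a) \<in> S"
      then obtain n' j' where p: "(n', j') \<in> A" "slc n' (v a) = j'" by auto
      then have "slc n (v a) = j' div 2 ^ (n - n')" using A(2) slc_div[of n' n "v a"] by auto
      then show False using * p by (auto simp: S_def)
    qed
  qed (use A(1) S(1) in \<open>auto simp: used_pred\<close>)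
  finally have "used n m A + card S * (\<eta> * len n) \<le> used n m (A \<union> nw n m A)"
    using live_sum_le[OF S] by simp
  then have "(len n - used n m (A \<union> nw n m A)) / \<eta> \<le> (len n - (used n m A + card S * (\<eta> * len n))) / \<eta>"
    using \<eta> by (intro divide_right_mono) auto
  also have "\<dots> = (len n - used n m A) / \<eta> - card S * len n"
    using \<eta> by (simp add: field_simps)
  finally have 1: "(len n - used n m (A \<union> nw n m A)) / \<eta> \<le> (len n - used n m A) / \<eta> - card S * len n" .
  have "card (A \<union> nw n m A) * len n \<le> (card A + card S) * len n"
    using card_Un_le[of A "nw n m A"] len_pos[of n] cnw by (intro mult_right_mono) (auto simp flip: of_nat_add)
  then show ?thesis using 1 by (simp add: pot_def algebra_simps)
qed

lemma pot_Lv: "pot n m (Lv n m) \<le> len n / \<eta>"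
proof -
  have cl: "card (Lv n m) = card {j. live n m j}"
    unfolding Lv_def by (rule card_image) (simp add: inj_on_def)
  have "used n m (Lv n m) = cmeas n m (\<lambda>a. slc n (v a) \<in> {j. live n m j})"
    unfolding used_def Lv_def by (rule arg_cong[where f = "cmeas n m"]) (auto simp: fun_eq_iff bex_Un)
  moreover have "card {j. live n m j} * (\<eta> * len n) \<le> cmeas n m (\<lambda>a. slc n (v a) \<in> {j. live n m j})"
    by (rule live_sum_le[OF finite_live]) simp
  ultimately have "card (Lv n m) * (\<eta> * len n) \<le> used n m (Lv n m)"
    by (simp only: cl)
  then have "card (Lv n m) * (\<eta> * len n) / \<eta> \<le> used n m (Lv n m) / \<eta>"
    using \<eta> by (intro divide_right_mono) auto
  then have "card (Lv n m) * len n \<le> used n m (Lv n m) / \<eta>"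
    using \<eta> by simp
  then show ?thesis unfolding pot_def diff_divide_distrib by linarith
qed

text \<open>A generation starts with potential at most \<open>len n / \<eta>\<close>, while a reset
  on a cell of length \<open>len n\<close> requires \<open>D * len n\<close>. The ratio
  \<open>\<epsilon>\<close> bounds the proportion of a starting cell that can see the next
  generation.\<close>

definition \<epsilon> :: real where "\<epsilon> = 1 / (\<eta> * D)"

lemma \<epsilon>_pos: "0 < \<epsilon>" using \<eta> D_pos by (simp add: \<epsilon>_def)

text \<open>\<open>N\<close> is a fixed final depth; as generations increase with depth, the column
  has entered generation \<open>j\<close> or passed it by then.\<close>

definition late :: "nat \<Rightarrow> nat \<Rightarrow> real \<Rightarrow> bool" where
  "late N j a \<longleftrightarrow> j \<le> gen N (cell l N a)"

lemma late_pred[measurable]: "Measurable.pred borel (late N j)"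
  unfolding late_def by measurable

text \<open>Backward induction on the depth. Without a reset the potential does not grow and is
  split between the children. A reset shows that \<open>D * len\<close> is at most the potential of
  the child, which pays for the first generation; each later one starts with potential at most
  \<open>\<epsilon> * (D * len)\<close>, a gain of \<open>\<epsilon>\<close>.\<close>

lemma late_density:
  assumes "n \<le> N" "1 \<le> t"
  shows "D * cmeas n m (late N (gen n m + t)) \<le> \<epsilon> ^ (t - 1) * pot n m (tops n m)"
  using assms
proof (induction n arbitrary: m t rule: inc_induct)
  case base
  have "{a. cell l N a = m \<and> late N (gen N m + t) a} = {}"
    using base by (auto simp: late_def)
  then have "cmeas N m (late N (gen N m + t)) = 0" by (simp only: cmeas_def measure_empty)
  then show ?case using \<epsilon>_pos pot_nonneg[OF tops_inv(1)] by simp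
next
  case (step n)
  define A where "A = tops n m"
  define g where "g = gen n m"
  have child: "D * cmeas (Suc n) c (late N (g + t)) \<le> \<epsilon> ^ (t - 1) * pot (Suc n) c A"
    if c: "c div 2 = m" for c
  proof -
    let ?A' = "A \<union> nw (Suc n) c A"
    have fA: "finite A" "finite ?A'" "\<And>n' j'. (n', j') \<in> A \<Longrightarrow> n' \<le> Suc n"
      using tops_inv(1)[of n m] tops_inv(3)[of _ _ n m] by (auto simp: A_def finite_nw intro: le_SucI)
    have nw: "pot (Suc n) c ?A' \<le> pot (Suc n) c A" by (rule pot_nw[OF fA(1,3)])
    from gen_Suc[of n c] consider
      (same) "gen (Suc n) c = g" "tops (Suc n) c = ?A'" |
      (reset) "gen (Suc n) c = Suc g" "tops (Suc n) c = Lv (Suc n) c" "D < card ?A'"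
      unfolding c g_def A_def by blast
    then show ?thesis
    proof cases
      case same
      have "D * cmeas (Suc n) c (late N (g + t)) \<le> \<epsilon> ^ (t - 1) * pot (Suc n) c ?A'"
        using step.IH[of t c] step.prems same by simp
      also have "\<dots> \<le> \<epsilon> ^ (t - 1) * pot (Suc n) c A"
        using nw \<epsilon>_pos by (intro mult_left_mono) auto
      finally show ?thesis .
    next
      case reset
      have "D * len (Suc n) \<le> card ?A' * len (Suc n)"
        using reset(3) len_pos[of "Suc n"] by (intro mult_right_mono) auto
      then have big: "D * len (Suc n) \<le> pot (Suc n) c A"
        using pot_ge[OF fA(2), of "Suc n" c] nw by linarith
      show ?thesis
      proof (cases "t = 1")
        case True
        have "D * cmeas (Suc n) c (late N (g + t)) \<le> D * len (Suc n)"
          by (intro mult_left_mono cmeas_le) auto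
        then show ?thesis using big True by simp
      next
        case False
        define k where "k = t - 2"
        have k: "t = Suc (Suc k)" using False step.prems by (simp add: k_def)
        have "D * cmeas (Suc n) c (late N (g + t)) \<le> \<epsilon> ^ k * pot (Suc n) c (Lv (Suc n) c)"
          using step.IH[of "Suc k" c] reset by (simp add: k)
        also have "\<dots> \<le> \<epsilon> ^ k * (len (Suc n) / \<eta>)"
          using \<epsilon>_pos by (intro mult_left_mono pot_Lv) auto
        also have "\<dots> = \<epsilon> ^ Suc k * (D * len (Suc n))"
          using D_pos \<eta> by (simp add: \<epsilon>_def)
        also have "\<dots> \<le> \<epsilon> ^ Suc k * pot (Suc n) c A"
          using big \<epsilon>_pos by (intro mult_left_mono) auto
        also have "\<epsilon> ^ Suc k = \<epsilon> ^ (t - 1)" by (simp add: k)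
        finally show ?thesis .
      qed
    qed
  qed
  have "D * cmeas n m (late N (g + t)) = D * cmeas (Suc n) (2 * m) (late N (g + t)) + D * cmeas (Suc n) (2 * m + 1) (late N (g + t))"
    by (subst cmeas_children) (auto simp: distrib_left)
  also have "\<dots> \<le> \<epsilon> ^ (t - 1) * pot (Suc n) (2 * m) A + \<epsilon> ^ (t - 1) * pot (Suc n) (2 * m + 1) A"
    by (intro add_mono child) auto
  also have "\<dots> = \<epsilon> ^ (t - 1) * pot n m A"
    using pot_children[of A n m] tops_inv(1)[of n m] by (simp add: A_def distrib_left)
  finally show ?case by (simp add: A_def g_def)
qed

text \<open>Where a generation starts, the potential is at most
  \<open>len n / \<eta> = \<epsilon> * D * len n\<close>, one factor \<open>\<epsilon>\<close>
  better than what a general cell offers.\<close>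

lemma late_density_start:
  assumes "n \<le> N" "tops n m = Lv n m"
  shows "cmeas n m (late N (gen n m + t)) \<le> \<epsilon> ^ t * len n"
proof (cases "t = 0")
  case True
  show ?thesis unfolding True using cmeas_le[OF late_pred, of n m N "gen n m"] by simp
next
  case False
  have "D * cmeas n m (late N (gen n m + t)) \<le> \<epsilon> ^ (t - 1) * pot n m (Lv n m)"
    unfolding assms(2)[symmetric] using False by (intro late_density[OF assms(1)]) simp
  also have "\<dots> \<le> \<epsilon> ^ (t - 1) * (len n / \<eta>)"
    using \<epsilon>_pos by (intro mult_left_mono pot_Lv) auto
  also have "\<dots> = D * (\<epsilon> ^ t * len n)"
  proof -
    obtain k where "t = Suc k" using False by (cases t) auto
    then show ?thesis using D_pos \<eta> by (simp add: \<epsilon>_def)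
  qed
  finally have "D * cmeas n m (late N (gen n m + t)) \<le> D * (\<epsilon> ^ t * len n)" .
  then show ?thesis using D_pos by (simp only: mult_le_cancel_left_pos of_nat_0_less_iff)
qed

text \<open>Generation \<open>i\<close> ends on base cells where \<open>H\<close> is constant up to
  the factor \<open>c\<close>, so late points carry at most \<open>c\<close> times their proportion
  of the integral. The exponent is \<open>t - 1\<close> because the count restarts at generation
  \<open>i + 1\<close>.\<close>

lemma late_integral_le:
  fixes H :: "real \<Rightarrow> ennreal"
  assumes [measurable]: "H \<in> borel_measurable borel" and t: "1 \<le> t" and c: "0 \<le> c"
    and H: "\<And>n m a a0. n < N \<Longrightarrow> gen (Suc n) m = Suc i \<Longrightarrow> gen n (m div 2) = i \<Longrightarrow>
       cell l (Suc n) a = m \<Longrightarrow> cell l (Suc n) a0 = m \<Longrightarrow> H a \<le> ennreal c * H a0"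
  shows "(\<integral>\<^sup>+a. (if late N (i + t) a then H a else 0) \<partial>lborel) \<le> ennreal (c * \<epsilon> ^ (t - 1)) * (\<integral>\<^sup>+a. H a \<partial>lborel)"
proof -
  let ?C = "ennreal (c * \<epsilon> ^ (t - 1))"
  define In where "In n m F = (\<integral>\<^sup>+a. (if cell l n a = m then F a else 0) \<partial>lborel)" for n m and F :: "real \<Rightarrow> ennreal"
  let ?F = "\<lambda>a. if late N (i + t) a then H a else 0"
  have In_children: "In n m F = In (Suc n) (2 * m) F + In (Suc n) (2 * m + 1) F"
    if [measurable]: "F \<in> borel_measurable borel" for n m F
  proof -
    have "(if cell l n a = m then F a else 0)
      = (if cell l (Suc n) a = 2 * m then F a else 0) + (if cell l (Suc n) a = 2 * m + 1 then F a else 0)" for a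
    proof -
      have "cell l n a = m \<longleftrightarrow> cell l (Suc n) a = 2 * m \<or> cell l (Suc n) a = 2 * m + 1"
        using cell_Suc_div[of l n a] by presburger
      then show ?thesis by (cases "cell l (Suc n) a = 2 * m"; cases "cell l (Suc n) a = 2 * m + 1") simp_all
    qed
    then have "In n m F = (\<integral>\<^sup>+a. (if cell l (Suc n) a = 2 * m then F a else 0) + (if cell l (Suc n) a = 2 * m + 1 then F a else 0) \<partial>lborel)"
      unfolding In_def by (simp only:)
    also have "\<dots> = In (Suc n) (2 * m) F + In (Suc n) (2 * m + 1) F"
      unfolding In_def by (rule nn_integral_add) measurable
    finally show ?thesis .
  qed
  have start: "In (Suc n) m ?F \<le> ?C * In (Suc n) m H"
    if n: "n < N" and g: "gen (Suc n) m = Suc i" "gen n (m div 2) = i" for n m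
  proof -
    let ?L = "len (Suc n)"
    have L: "0 < ?L" by (rule len_pos)
    have pt: "H a \<le> ennreal (c / ?L) * In (Suc n) m H" if a: "cell l (Suc n) a = m" for a
    proof -
      have "H a * ennreal ?L = (\<integral>\<^sup>+a0. H a * indicator {a0. cell l (Suc n) a0 = m} a0 \<partial>lborel)"
        by (subst nn_integral_cmult_indicator) (auto simp: emeasure_cell')
      also have "\<dots> \<le> (\<integral>\<^sup>+a0. ennreal c * (if cell l (Suc n) a0 = m then H a0 else 0) \<partial>lborel)"
        using H[OF n g a] by (intro nn_integral_mono) (auto simp: indicator_def)
      also have "\<dots> = ennreal c * In (Suc n) m H"
        unfolding In_def by (rule nn_integral_cmult) measurable
      finally have "ennreal (1 / ?L) * (H a * ennreal ?L) \<le> ennreal (1 / ?L) * (ennreal c * In (Suc n) m H)"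
        by (intro mult_left_mono) auto
      moreover have "ennreal (1 / ?L) * (H a * ennreal ?L) = H a * ennreal (1 / ?L * ?L)"
        using L by (subst ennreal_mult') (auto simp: mult_ac)
      moreover have "ennreal (1 / ?L) * (ennreal c * In (Suc n) m H) = ennreal (1 / ?L * c) * In (Suc n) m H"
        using L by (subst ennreal_mult') (auto simp: mult_ac)
      ultimately show ?thesis using L l by (simp add: mult_ac)
    qed
    have "In (Suc n) m ?F \<le> (\<integral>\<^sup>+a. (ennreal (c / ?L) * In (Suc n) m H) * indicator {a. cell l (Suc n) a = m \<and> late N (i + t) a} a \<partial>lborel)"
      unfolding In_def[of _ _ ?F] using pt by (intro nn_integral_mono) (auto simp: indicator_def)
    also have "\<dots> = (ennreal (c / ?L) * In (Suc n) m H) * ennreal (cmeas (Suc n) m (late N (i + t)))"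
      by (subst nn_integral_cmult_indicator) (auto simp: cmeas_emeasure)
    also have "\<dots> \<le> (ennreal (c / ?L) * In (Suc n) m H) * ennreal (\<epsilon> ^ (t - 1) * ?L)"
    proof (intro mult_left_mono ennreal_leI)
      have "tops (Suc n) m = Lv (Suc n) m" using gen_Suc[of n m] g by auto
      then show "cmeas (Suc n) m (late N (i + t)) \<le> \<epsilon> ^ (t - 1) * ?L"
        using late_density_start[of "Suc n" N m "t - 1"] n t g by simp
    qed auto
    also have "\<dots> = ennreal (c / ?L * (\<epsilon> ^ (t - 1) * ?L)) * In (Suc n) m H"
      using \<epsilon>_pos L c by (subst ennreal_mult'') (auto simp: mult_ac)
    also have "c / ?L * (\<epsilon> ^ (t - 1) * ?L) = c * \<epsilon> ^ (t - 1)"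
      using L l by simp
    finally show ?thesis .
  qed
  \<comment> \<open>Cells are followed downwards while their generation is at most \<open>i\<close>.
    The first child beyond that has generation exactly \<open>i + 1\<close> over a parent of
    generation \<open>i\<close>, and \<open>start\<close> applies to it.\<close>
  have claim: "In n m ?F \<le> ?C * In n m H" if "n \<le> N" "gen n m \<le> i" for n m
    using that
  proof (induction n arbitrary: m rule: inc_induct)
    case base
    have "In N m ?F = (\<integral>\<^sup>+a. 0 \<partial>(lborel :: real measure))"
      unfolding In_def by (rule nn_integral_cong) (use base t in \<open>auto simp: late_def\<close>)
    then show ?case by simp
  next
    case (step n)
    have child: "In (Suc n) c' ?F \<le> ?C * In (Suc n) c' H" if "c' div 2 = m" for c'
    proof (cases "gen (Suc n) c' \<le> i")
      case True
      then show ?thesis by (rule step.IH)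
    next
      case False
      then have "gen (Suc n) c' = Suc i" "gen n (c' div 2) = i"
        using gen_Suc[of n c'] step.prems that by auto
      then show ?thesis using step.hyps by (intro start) auto
    qed
    have "In n m ?F = In (Suc n) (2 * m) ?F + In (Suc n) (2 * m + 1) ?F"
      "In n m H = In (Suc n) (2 * m) H + In (Suc n) (2 * m + 1) H"
      by (rule In_children, measurable)+
    moreover have "In (Suc n) (2 * m) ?F + In (Suc n) (2 * m + 1) ?F
        \<le> ?C * In (Suc n) (2 * m) H + ?C * In (Suc n) (2 * m + 1) H"
      by (rule add_mono) (rule child, simp)+
    ultimately show ?case by (simp only: distrib_left)
  qed
  \<comment> \<open>Averaging over the cells of depth 0 turns the estimate on each coarsest cell
    into one on the whole line without a countable sum.\<close>
  have cav: "cavg l 0 0 F x = ennreal (1 / l) * In 0 (cell l 0 x) F" for F x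
    by (simp add: cavg_def In_def)
  have "(\<integral>\<^sup>+a. ?F a \<partial>lborel) = (\<integral>\<^sup>+x. cavg l 0 0 ?F x \<partial>lborel)"
    by (rule nn_integral_cavg[OF l, symmetric]) measurable
  also have "\<dots> \<le> (\<integral>\<^sup>+x. ?C * cavg l 0 0 H x \<partial>lborel)"
  proof (rule nn_integral_mono)
    fix x
    have "ennreal (1 / l) * In 0 (cell l 0 x) ?F \<le> ennreal (1 / l) * (?C * In 0 (cell l 0 x) H)"
      by (intro mult_left_mono claim) simp_all
    then show "cavg l 0 0 ?F x \<le> ?C * cavg l 0 0 H x"
      unfolding cav by (simp only: mult.left_commute)
  qed
  also have "\<dots> = ?C * (\<integral>\<^sup>+x. H x \<partial>lborel)"
  proof -
    have "(\<lambda>x. cavg l 0 0 H x) \<in> borel_measurable lborel"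
      unfolding cavg_def by measurable
    from nn_integral_cmult[OF this, of ?C] show ?thesis
      using nn_integral_cavg[OF l assms(1), of 0 0] by (simp only:)
  qed
  finally show ?thesis .
qed

end

section \<open>Auxiliary inequalities, dyadic radii, and the geometric decay constant\<close>

lemma ennreal_amgm:
  fixes a b :: ennreal
  assumes "0 < c"
  shows "a * b \<le> ennreal c * a\<^sup>2 + ennreal (1 / (4 * c)) * b\<^sup>2"
proof (cases "a = top \<or> b = top")
  case True
  have p: "ennreal c \<noteq> 0" "ennreal (1 / (4 * c)) \<noteq> 0" using assms by auto
  have "ennreal c * a\<^sup>2 + ennreal (1 / (4 * c)) * b\<^sup>2 = top"
    using True p by (auto simp: ennreal_mult_eq_top_iff power2_eq_square)
  then show ?thesis by (simp only: top_greatest)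
next
  case False
  then obtain x y where xy: "0 \<le> x" "0 \<le> y" "a = ennreal x" "b = ennreal y"
    by (metis enn2real_nonneg ennreal_enn2real_if)
  have "0 \<le> c * (x - y / (2 * c))\<^sup>2" using assms by simp
  also have "\<dots> = c * x\<^sup>2 + 1 / (4 * c) * y\<^sup>2 - x * y"
    using assms by (simp add: power2_diff field_simps power2_eq_square)
  finally have "x * y \<le> c * x\<^sup>2 + 1 / (4 * c) * y\<^sup>2" by simp
  then have "ennreal (x * y) \<le> ennreal (c * x\<^sup>2 + 1 / (4 * c) * y\<^sup>2)" by (rule ennreal_leI)
  also have "\<dots> = ennreal c * ennreal (x\<^sup>2) + ennreal (1 / (4 * c)) * ennreal (y\<^sup>2)"
    using assms by (subst ennreal_plus; (subst ennreal_mult')?; (subst ennreal_mult')?) auto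
  finally show ?thesis using xy by (simp add: ennreal_mult' ennreal_power)
qed

lemma ennreal_sum_power2_le:
  fixes f :: "'j \<Rightarrow> ennreal"
  assumes "finite A"
  shows "(\<Sum>j\<in>A. f j)\<^sup>2 \<le> of_nat (card A) * (\<Sum>j\<in>A. (f j)\<^sup>2)"
proof (cases "\<exists>j\<in>A. f j = top")
  case True
  then obtain j where j: "j \<in> A" "f j = top" by blast
  then have "card A \<noteq> 0" "(\<Sum>j\<in>A. (f j)\<^sup>2) = top"
    using assms by (auto simp: power2_eq_square ennreal_mult_eq_top_iff intro!: bexI[of _ j])
  then have "of_nat (card A) * (\<Sum>j\<in>A. (f j)\<^sup>2) = (top::ennreal)" by (simp add: ennreal_mult_eq_top_iff)
  then show ?thesis by simp
next
  case False
  define g where "g j = enn2real (f j)" for j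
  have fg: "f j = ennreal (g j)" if "j \<in> A" for j using False that by (auto simp: g_def ennreal_enn2real_if)
  have g0: "0 \<le> g j" for j by (simp add: g_def)
  have "(\<Sum>j\<in>A. g j)\<^sup>2 \<le> card A * (\<Sum>j\<in>A. (g j)\<^sup>2)"
    using sum_squared_le_sum_of_squares[of g A] by (simp add: mult.commute)
  then have "ennreal ((\<Sum>j\<in>A. g j)\<^sup>2) \<le> ennreal (card A * (\<Sum>j\<in>A. (g j)\<^sup>2))" by (rule ennreal_leI)
  moreover have "(\<Sum>j\<in>A. f j)\<^sup>2 = ennreal ((\<Sum>j\<in>A. g j)\<^sup>2)"
    using fg g0 by (simp add: sum_ennreal sum_nonneg ennreal_power)
  moreover have "of_nat (card A) * (\<Sum>j\<in>A. (f j)\<^sup>2) = ennreal (card A * (\<Sum>j\<in>A. (g j)\<^sup>2))"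
    using fg g0 by (simp add: sum_ennreal sum_nonneg ennreal_power ennreal_mult' ennreal_of_nat_eq_real_of_nat)
  ultimately show ?thesis by simp
qed

lemma ennreal_sum_of_squares_le:
  fixes f :: "'j \<Rightarrow> ennreal"
  assumes "finite A"
  shows "(\<Sum>j\<in>A. (f j)\<^sup>2) \<le> (\<Sum>j\<in>A. f j)\<^sup>2"
  using assms
proof (induction A rule: finite_induct)
  case (insert j A)
  have "(f j)\<^sup>2 + (\<Sum>j\<in>A. (f j)\<^sup>2) \<le> (f j)\<^sup>2 + (\<Sum>j\<in>A. f j)\<^sup>2" using insert by (intro add_left_mono)
  also have "\<dots> \<le> (f j + (\<Sum>j\<in>A. f j))\<^sup>2"
    unfolding power2_eq_square distrib_left distrib_right by (simp add: add_ac add_left_mono add_increasing)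
  finally show ?case using insert by simp
qed simp

text \<open>Finitely many radii can share one dyadic scale: start with \<open>\<kappa>\<close> above
  six times each of them and halve until the length lies between \<open>6 * R x\<close> and
  \<open>12 * R x\<close>.\<close>

lemma dyadic_scales:
  fixes R :: "'x \<Rightarrow> real"
  assumes "finite X" "\<And>x. x \<in> X \<Longrightarrow> 0 < R x"
  obtains \<kappa> :: real and N :: nat where "0 < \<kappa>"
    "\<And>x. x \<in> X \<Longrightarrow> \<exists>k<N. 6 * R x \<le> \<kappa> / 2 ^ k \<and> \<kappa> / 2 ^ k \<le> 12 * R x"
proof -
  define \<kappa> where "\<kappa> = 1 + 6 * (\<Sum>x\<in>X. R x)"
  have s0: "0 \<le> (\<Sum>x\<in>X. R x)" using assms(2) by (intro sum_nonneg less_imp_le)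
  then have \<kappa>: "0 < \<kappa>" by (simp add: \<kappa>_def)
  have "\<exists>k. 6 * R x \<le> \<kappa> / 2 ^ k \<and> \<kappa> / 2 ^ k \<le> 12 * R x" if x: "x \<in> X" for x
  proof -
    have Rx: "0 < R x" by (rule assms(2)[OF x])
    have "R x \<le> (\<Sum>x\<in>X. R x)" using assms x by (intro member_le_sum) (auto intro: less_imp_le)
    then have le: "1 \<le> \<kappa> / (6 * R x)" using Rx by (simp add: \<kappa>_def)
    define k where "k = (LEAST k. \<kappa> / (6 * R x) < 2 ^ Suc k)"
    obtain n where "\<kappa> / (6 * R x) < 2 ^ n" using real_arch_pow[of 2 "\<kappa> / (6 * R x)"] by auto
    then have "\<kappa> / (6 * R x) < 2 ^ Suc n" using le by simp
    then have k: "\<kappa> / (6 * R x) < 2 ^ Suc k" unfolding k_def by (rule LeastI)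
    have k': "2 ^ k \<le> \<kappa> / (6 * R x)"
    proof (cases k)
      case (Suc j)
      then have "\<not> \<kappa> / (6 * R x) < 2 ^ Suc j"
        by (intro not_less_Least[of j "\<lambda>k. \<kappa> / (6 * R x) < 2 ^ Suc k"]) (simp only: k_def[symmetric])
      then show ?thesis using Suc by (simp only: not_less)
    qed (use le in simp)
    show ?thesis
      using k k' Rx by (intro exI[of _ k]) (auto simp: field_simps)
  qed
  then obtain k where k: "\<And>x. x \<in> X \<Longrightarrow> 6 * R x \<le> \<kappa> / 2 ^ k x \<and> \<kappa> / 2 ^ k x \<le> 12 * R x" by metis
  have "k x < Suc (Max (k ` X))" if "x \<in> X" for x using assms(1) that by (simp add: less_Suc_eq_le)
  then show thesis using that[OF \<kappa>, of "Suc (Max (k ` X))"] k by blast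
qed

lemma vsm_radius:
  assumes "0 < r" "r \<le> R" "R \<le> 2 * r"
  shows "vsm r F z \<le> 2 * vsm R F z"
proof -
  have "vsm r F z \<le> ennreal (2 * (1 / (2 * R))) * (\<integral>\<^sup>+t. (if \<bar>t\<bar> < R then F (fst z, snd z + t) else 0) \<partial>lborel)"
    unfolding vsm_def using assms by (intro mult_mono ennreal_leI nn_integral_mono) (auto simp: field_simps)
  also have "ennreal (2 * (1 / (2 * R))) = 2 * ennreal (1 / (2 * R))"
    using assms by (subst ennreal_mult') auto
  finally show ?thesis by (simp add: vsm_def mult.assoc)
qed

lemma vsm_sum:
  assumes "finite S" and [measurable]: "\<And>P. f P \<in> borel_measurable (borel \<Otimes>\<^sub>M borel)"
  shows "vsm R (\<lambda>z. \<Sum>P\<in>S. f P z) z = (\<Sum>P\<in>S. vsm R (f P) z)"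
proof -
  have "(\<integral>\<^sup>+t. (if \<bar>t\<bar> < R then (\<Sum>P\<in>S. f P (fst z, snd z + t)) else 0) \<partial>lborel)
    = (\<integral>\<^sup>+t. (\<Sum>P\<in>S. (if \<bar>t\<bar> < R then f P (fst z, snd z + t) else 0)) \<partial>lborel)"
    by (intro nn_integral_cong) auto
  also have "\<dots> = (\<Sum>P\<in>S. \<integral>\<^sup>+t. (if \<bar>t\<bar> < R then f P (fst z, snd z + t) else 0) \<partial>lborel)"
    by (rule nn_integral_sum) measurable
  finally show ?thesis by (simp add: vsm_def sum_distrib_left)
qed

lemma sum_pow_half_le: "(\<Sum>j\<in>A. (1/2::real) ^ j) \<le> 2" if "finite A" for A :: "nat set"
proof -
  have "(\<Sum>j\<in>A. (1/2::real) ^ j) \<le> (\<Sum>j<Suc (Max (insert 0 A)). (1/2) ^ j)"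
    using that by (intro sum_mono2) (auto simp: less_Suc_eq_le)
  also have "\<dots> \<le> 2" by (subst geometric_sum) (auto simp: field_simps)
  finally show ?thesis .
qed

text \<open>Two factors \<open>\<epsilon>\<close> pay for \<open>4 * D\<close>, and each remaining
  one is at most 1/4. The generous constant 16 makes the right side at least 1 for
  \<open>t \<le> 2\<close>, where the trivial bound will be used.\<close>

lemma (in slope_field) four_D_eps_le: "3 \<le> t \<Longrightarrow> 4 * D * \<epsilon> ^ (t - 1) \<le> 16 * (1/4) ^ t"
proof -
  assume t: "3 \<le> t"
  define k where "k = t - 3"
  have t: "t = k + 3" using t by (simp add: k_def)
  have D0: "0 < real D" using D_pos by simp
  have "256 \<le> \<eta>\<^sup>2 * D" using D \<eta> by (simp add: field_simps)
  have "\<eta>\<^sup>2 * D \<le> \<eta> * D" using \<eta> D0 by (simp add: power2_eq_square mult_left_le)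
  then have "4 \<le> \<eta> * D" using \<open>256 \<le> \<eta>\<^sup>2 * D\<close> by linarith
  then have e: "\<epsilon> \<le> 1/4" unfolding \<epsilon>_def by (intro frac_le) auto
  have "4 * D * \<epsilon>\<^sup>2 = 4 / (\<eta>\<^sup>2 * D)" using \<eta> D0 by (simp add: \<epsilon>_def power2_eq_square)
  also have "\<dots> \<le> 4 / 256" using \<open>256 \<le> \<eta>\<^sup>2 * D\<close> by (intro divide_left_mono) auto
  finally have d: "4 * D * \<epsilon>\<^sup>2 \<le> 1/64" by simp
  have "4 * D * \<epsilon> ^ (t - 1) = (4 * D * \<epsilon>\<^sup>2) * \<epsilon> ^ k"
    by (simp add: t power_add power2_eq_square mult_ac numeral_2_eq_2)
  also have "\<dots> \<le> 1/64 * (1/4) ^ k"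
    using d e \<epsilon>_pos by (intro mult_mono power_mono) auto
  also have "\<dots> \<le> 16 * (1/4) ^ t" by (simp add: t power_add power3_eq_cube)
  finally show ?thesis .
qed

context slope_field
begin

text \<open>The left endpoint of the slope cell, taken as the slope of the tile.\<close>

definition sp :: "nat \<Rightarrow> int \<Rightarrow> real" where "sp n j = of_int j * w / len n"

definition depth :: "nat \<times> int \<times> int \<Rightarrow> nat" where "depth P = fst P"
definition pos :: "nat \<times> int \<times> int \<Rightarrow> int" where "pos P = fst (snd P)"
definition slope :: "nat \<times> int \<times> int \<Rightarrow> real" where "slope P = sp (fst P) (snd (snd P))"
definition pgen :: "nat \<times> int \<times> int \<Rightarrow> nat" where "pgen P = gen (depth P) (pos P)"

definition B :: "nat \<times> int \<times> int \<Rightarrow> (real \<times> real \<Rightarrow> ennreal) \<Rightarrow> real \<times> real \<Rightarrow> ennreal" where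
  "B P = lavg l (depth P) (pos P) (slope P)"

text \<open>The group label of a tile: a recorded slope cell inside its own. Any such record would
  do, but fixing one makes the groups disjoint; for live tiles one exists by
  \<open>live_covered\<close>.\<close>

definition tp :: "nat \<times> int \<times> int \<Rightarrow> nat \<times> int" where
  "tp P = (SOME p. p \<in> tops (depth P) (pos P) \<and> snd p div 2 ^ (depth P - fst p) = snd (snd P))"

lemma B_measurable[measurable]:
  "F \<in> borel_measurable (borel \<Otimes>\<^sub>M borel) \<Longrightarrow> B P F \<in> borel_measurable (borel \<Otimes>\<^sub>M borel)"
  unfolding B_def by measurable

end

section \<open>The TT* argument\<close>

text \<open>\<open>G P\<close> is the piece of the linearised maximal function assigned to
  \<open>P\<close>. Boundedness and integrability make \<open>h\<close> square integrable;
  \<open>2 * w \<le> \<rho>\<close> keeps window radii comparable when a slope is replaced by that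
  of its label.\<close>

locale tiles = slope_field +
  fixes \<rho> K :: real and Ps :: "(nat \<times> int \<times> int) set"
    and G :: "nat \<times> int \<times> int \<Rightarrow> real \<times> real \<Rightarrow> ennreal"
  assumes \<rho>: "2 * w \<le> \<rho>" and fin: "finite Ps"
    and live: "\<And>n m j. (n, m, j) \<in> Ps \<Longrightarrow> live n m j"
    and G[measurable]: "\<And>P. G P \<in> borel_measurable (borel \<Otimes>\<^sub>M borel)"
    and G_bd: "\<And>P z. G P z \<le> ennreal K"
    and G_int: "\<And>P. P \<in> Ps \<Longrightarrow> (\<integral>\<^sup>+z. G P z \<partial>pl) < \<infinity>"
begin

definition \<phi> :: "nat \<times> int \<times> int \<Rightarrow> real \<times> real \<Rightarrow> ennreal" where
  "\<phi> P = vsm \<rho> (B P (G P))"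

definition grp :: "nat \<Rightarrow> nat \<times> int \<Rightarrow> (nat \<times> int \<times> int) set" where
  "grp i T = {P \<in> Ps. pgen P = i \<and> tp P = T}"

definition \<phi>g :: "nat \<Rightarrow> nat \<times> int \<Rightarrow> real \<times> real \<Rightarrow> ennreal" where
  "\<phi>g i T z = (\<Sum>P\<in>grp i T. \<phi> P z)"

definition hg :: "nat \<Rightarrow> real \<times> real \<Rightarrow> ennreal" where
  "hg i z = (\<Sum>T\<in>tp ` Ps. \<phi>g i T z)"

definition h :: "real \<times> real \<Rightarrow> ennreal" where
  "h z = (\<Sum>P\<in>Ps. \<phi> P z)"

definition Nmax :: nat where "Nmax = Max (insert 0 (depth ` Ps))"

lemma \<rho>_pos: "0 < \<rho>" "w < \<rho>"
  using \<rho> w by auto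

lemma depth_le: "P \<in> Ps \<Longrightarrow> depth P \<le> Nmax"
  using fin by (simp add: Nmax_def)

text \<open>The cell of \<open>tp P\<close> lies in that of \<open>P\<close>, so the left endpoints
  differ by at most the length \<open>w / len (depth P)\<close> of the latter. Over the base of
  \<open>P\<close> this is an error of at most \<open>w\<close> in height.\<close>

lemma tp_props:
  assumes "P \<in> Ps"
  shows "tp P \<in> tops (depth P) (pos P)" "\<bar>slope P - sp (fst (tp P)) (snd (tp P))\<bar> \<le> w / len (depth P)"
proof -
  obtain n m j where P: "P = (n, m, j)" by (cases P) auto
  have "\<exists>(n', j')\<in>tops n m. j' div 2 ^ (n - n') = j"
    using live_covered[OF live, of n m j] assms P by auto
  then have "\<exists>p. p \<in> tops (depth P) (pos P) \<and> snd p div 2 ^ (depth P - fst p) = snd (snd P)"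
    unfolding P depth_def pos_def by auto
  from someI_ex[OF this] have *: "tp P \<in> tops (depth P) (pos P)" "snd (tp P) div 2 ^ (depth P - fst (tp P)) = snd (snd P)"
    unfolding tp_def by auto
  then show "tp P \<in> tops (depth P) (pos P)" by simp
  define n' j' where "n' = fst (tp P)" and "j' = snd (tp P)"
  have tp: "(n', j') \<in> tops n m" "j' div 2 ^ (n - n') = j"
    using * by (auto simp: n'_def j'_def P depth_def pos_def)
  have "n' \<le> n" by (rule tops_inv(3)[OF tp(1)])
  then have "len n' = len n * 2 ^ (n - n')"
    by (simp add: len_def field_simps flip: power_add)
  then have "sp n' j' = (of_int j' / 2 ^ (n - n')) * (w / len n)"
    by (simp add: sp_def field_simps)
  moreover have "slope P = of_int j * (w / len n)" by (simp add: slope_def P sp_def)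
  ultimately have eq: "slope P - sp n' j' = (of_int j - of_int j' / 2 ^ (n - n')) * (w / len n)"
    by (simp only: left_diff_distrib)
  have "\<lfloor>real_of_int j' / 2 ^ (n - n')\<rfloor> = j"
    using floor_divide_power2[of "real_of_int j'" "n - n'"] tp(2) by simp
  then have "\<bar>of_int j - real_of_int j' / 2 ^ (n - n')\<bar> \<le> 1" by linarith
  then have "\<bar>of_int j - real_of_int j' / 2 ^ (n - n')\<bar> * \<bar>w / len n\<bar> \<le> 1 * \<bar>w / len n\<bar>"
    by (intro mult_right_mono) auto
  then have "\<bar>slope P - sp n' j'\<bar> \<le> \<bar>w / len n\<bar>"
    unfolding eq abs_mult by (simp only: mult_1)
  then show "\<bar>slope P - sp (fst (tp P)) (snd (tp P))\<bar> \<le> w / len (depth P)"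
    using w len_pos[of n] by (simp add: n'_def j'_def P depth_def)
qed

lemma finite_grp: "finite (grp i T)"
  using fin by (simp add: grp_def)

lemma \<phi>_measurable[measurable]: "\<phi> P \<in> borel_measurable (borel \<Otimes>\<^sub>M borel)"
  unfolding \<phi>_def by measurable

lemma \<phi>g_measurable[measurable]: "\<phi>g i T \<in> borel_measurable (borel \<Otimes>\<^sub>M borel)"
  unfolding \<phi>g_def by measurable

lemma hg_measurable[measurable]: "hg i \<in> borel_measurable (borel \<Otimes>\<^sub>M borel)"
  unfolding hg_def by measurable

lemma h_measurable[measurable]: "h \<in> borel_measurable (borel \<Otimes>\<^sub>M borel)"
  unfolding h_def by measurable

lemma \<phi>_bd: "\<phi> P z \<le> ennreal K"
  unfolding \<phi>_def B_def by (intro vsm_le lavg_le \<rho>_pos l G_bd)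

lemma \<phi>_int: "P \<in> Ps \<Longrightarrow> (\<integral>\<^sup>+z. \<phi> P z \<partial>pl) < \<infinity>"
  unfolding \<phi>_def B_def
  by (subst nn_integral_vsm) (auto intro: le_less_trans[OF nn_integral_lavg_le[OF l]] G_int[unfolded infinity_ennreal_def] simp: \<rho>_pos)

lemma \<phi>_zero_off: "cell l (depth P) a \<noteq> pos P \<Longrightarrow> \<phi> P (a, b) = 0"
  unfolding \<phi>_def B_def by (rule vsm_lavg_zero_off) simp

lemma \<phi>_line: "cell l (depth P) a = cell l (depth P) a' \<Longrightarrow> \<phi> P (a', y) = \<phi> P (a, y - slope P * (a' - a))"
proof (cases "cell l (depth P) a = pos P")
  case True
  moreover assume "cell l (depth P) a = cell l (depth P) a'"
  ultimately show ?thesis unfolding \<phi>_def B_def by (intro vsm_lavg_along_line) simp_all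
next
  case False
  moreover assume "cell l (depth P) a = cell l (depth P) a'"
  ultimately show ?thesis by (simp add: \<phi>_zero_off)
qed

lemma \<phi>g_bd: "\<phi>g i T z \<le> ennreal (card Ps * max 0 K)"
proof -
  have "\<phi>g i T z \<le> (\<Sum>P\<in>grp i T. ennreal (max 0 K))"
    unfolding \<phi>g_def by (intro sum_mono order_trans[OF \<phi>_bd] ennreal_leI) simp
  also have "\<dots> \<le> (\<Sum>P\<in>Ps. ennreal (max 0 K))"
    by (rule sum_mono2[OF fin]) (auto simp: grp_def)
  also have "\<dots> = ennreal (card Ps * max 0 K)"
    by (simp add: ennreal_mult' ennreal_of_nat_eq_real_of_nat)
  finally show ?thesis .
qed

lemma \<phi>g_int: "(\<integral>\<^sup>+z. \<phi>g i T z \<partial>pl) < \<infinity>"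
  unfolding \<phi>g_def using \<phi>_int by (subst nn_integral_sum) (auto simp: grp_def fin)

lemma h_split: "h z = (\<Sum>i\<in>pgen ` Ps. hg i z)"
proof -
  have "h z = (\<Sum>i\<in>pgen ` Ps. \<Sum>P | P \<in> Ps \<and> pgen P = i. \<phi> P z)"
    unfolding h_def by (rule sum.group[symmetric]) (use fin in auto)
  also have "\<dots> = (\<Sum>i\<in>pgen ` Ps. hg i z)"
  proof (rule sum.cong[OF refl])
    fix i
    have "hg i z = (\<Sum>T\<in>tp ` Ps. \<Sum>P\<in>{P \<in> {P \<in> Ps. pgen P = i}. tp P = T}. \<phi> P z)"
      unfolding hg_def \<phi>g_def grp_def by (intro sum.cong refl) auto
    also have "\<dots> = (\<Sum>P | P \<in> Ps \<and> pgen P = i. \<phi> P z)"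
      by (rule sum.group) (use fin in auto)
    finally show "(\<Sum>P | P \<in> Ps \<and> pgen P = i. \<phi> P z) = hg i z" by simp
  qed
  finally show ?thesis .
qed

text \<open>Nonnegativity stands in for orthogonality. This is what allows the terms of the single
  generations to be absorbed into the integral for \<open>h\<close>.\<close>

lemma hg_squares: "(\<Sum>i\<in>pgen ` Ps. \<integral>\<^sup>+z. (hg i z)\<^sup>2 \<partial>pl) \<le> (\<integral>\<^sup>+z. (h z)\<^sup>2 \<partial>pl)"
proof -
  have "(\<Sum>i\<in>pgen ` Ps. \<integral>\<^sup>+z. (hg i z)\<^sup>2 \<partial>pl) = (\<integral>\<^sup>+z. (\<Sum>i\<in>pgen ` Ps. (hg i z)\<^sup>2) \<partial>pl)"
    by (rule nn_integral_sum[symmetric]) measurable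
  also have "\<dots> \<le> (\<integral>\<^sup>+z. (h z)\<^sup>2 \<partial>pl)"
    unfolding h_split using fin by (intro nn_integral_mono ennreal_sum_of_squares_le) auto
  finally show ?thesis .
qed

lemma h_int2: "(\<integral>\<^sup>+z. (h z)\<^sup>2 \<partial>pl) < \<infinity>"
proof -
  have "(\<integral>\<^sup>+z. (h z)\<^sup>2 \<partial>pl) \<le> (\<integral>\<^sup>+z. ennreal (card Ps * max 0 K) * (\<Sum>P\<in>Ps. \<phi> P z) \<partial>pl)"
  proof (rule nn_integral_mono)
    fix z
    have "h z \<le> (\<Sum>P\<in>Ps. ennreal (max 0 K))"
      unfolding h_def by (intro sum_mono order_trans[OF \<phi>_bd]) (auto intro: ennreal_leI)
    also have "\<dots> = ennreal (card Ps * max 0 K)"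
      by (simp add: ennreal_mult' ennreal_of_nat_eq_real_of_nat)
    finally show "(h z)\<^sup>2 \<le> ennreal (card Ps * max 0 K) * (\<Sum>P\<in>Ps. \<phi> P z)"
      unfolding power2_eq_square h_def by (rule mult_right_mono) simp
  qed
  also have "\<dots> = ennreal (card Ps * max 0 K) * (\<Sum>P\<in>Ps. \<integral>\<^sup>+z. \<phi> P z \<partial>pl)"
    by (simp add: nn_integral_cmult nn_integral_sum)
  also have "\<dots> < \<infinity>"
    using \<phi>_int fin by (simp add: ennreal_mult_less_top)
  finally show ?thesis .
qed

text \<open>A tile reaches column \<open>a\<close> only if its base contains \<open>a\<close>. Its
  label is then recorded there, so all labels of generation \<open>i\<close> lie in the set given by
  \<open>column_tops\<close>.\<close>

lemma column_groups: "\<exists>A. finite A \<and> card A \<le> D \<and> (\<forall>T\<in>tp ` Ps - A. \<forall>b. \<phi>g i T (a, b) = 0)"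
proof -
  obtain A where A: "finite A" "card A \<le> D"
    "\<And>n. n \<le> Nmax \<Longrightarrow> gen n (cell l n a) = i \<Longrightarrow> tops n (cell l n a) \<subseteq> A"
    using column_tops[of Nmax a i] by blast
  have "\<phi>g i T (a, b) = 0" if T: "T \<notin> A" for T b
    unfolding \<phi>g_def
  proof (rule sum.neutral, rule ballI)
    fix P assume P: "P \<in> grp i T"
    show "\<phi> P (a, b) = 0"
    proof (cases "cell l (depth P) a = pos P")
      case True
      have P': "P \<in> Ps" "pgen P = i" "tp P = T" using P by (auto simp: grp_def)
      have "tp P \<in> tops (depth P) (cell l (depth P) a)"
        using tp_props(1)[OF P'(1)] True by simp
      also have "\<dots> \<subseteq> A"
        using P' True depth_le[OF P'(1)] by (intro A(3)) (auto simp: pgen_def)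
      finally show ?thesis using T P' by simp
    qed (rule \<phi>_zero_off)
  qed
  then show ?thesis using A(1,2) by (intro exI[of _ A]) auto
qed

section \<open>Column norms of one generation and their share on late columns\<close>

definition Ht :: "nat \<Rightarrow> real \<Rightarrow> ennreal" where
  "Ht i a = (\<integral>\<^sup>+b. (hg i (a, b))\<^sup>2 \<partial>lborel)"

lemma Ht_measurable[measurable]: "Ht i \<in> borel_measurable borel"
  unfolding Ht_def by measurable

text \<open>Since the generation has passed \<open>i\<close>, all tiles of generation
  \<open>i\<close> over these columns are longer than the cell, and both columns lie over their
  bases. From one column to the other a whole group moves by a common vertical shift, up to an error
  \<open>w\<close> absorbed by \<open>vsm_regular\<close>; this costs 4 on the squares. Different
  groups shift differently, and recombining at most \<open>D\<close> of them by Cauchy-Schwarz costs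
  \<open>D\<close>.\<close>

lemma Ht_comparable:
  assumes g: "gen (Suc n) m = Suc i" and a: "cell l (Suc n) a = m" "cell l (Suc n) a0 = m"
  shows "Ht i a \<le> ennreal (4 * real D) * Ht i a0"
proof -
  define \<sigma> where "\<sigma> T = sp (fst T) (snd T)" for T
  have pt: "\<phi>g i T (a, b) \<le> \<phi>g i T (a0, b + (- \<sigma> T * (a - a0) - w)) + \<phi>g i T (a0, b + (- \<sigma> T * (a - a0) + w))" for T b
  proof -
    define z where "z = b - \<sigma> T * (a - a0)"
    have "\<phi> P (a, b) \<le> \<phi> P (a0, z - w) + \<phi> P (a0, z + w)" if "P \<in> grp i T" for P
    proof (cases "cell l (depth P) a = pos P")
      case True
      have P: "P \<in> Ps" "pgen P = i" "tp P = T" using that by (auto simp: grp_def)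
      have dn: "depth P \<le> n"
      proof (rule ccontr)
        assume "\<not> depth P \<le> n"
        then have "gen (Suc n) (cell l (Suc n) a) \<le> gen (depth P) (cell l (depth P) a)" by (intro gen_mono) auto
        then show False using g a P True by (simp add: pgen_def)
      qed
      have same: "cell l (depth P) a0 = cell l (depth P) a"
        using cell_eq_mono[of "depth P" "Suc n" l a0 a] dn a by simp
      define e where "e = (\<sigma> T - slope P) * (a - a0)"
      have "\<bar>a - a0\<bar> \<le> len (depth P)"
        using cell_le_dist[OF l, of "depth P" a a0] same by (simp add: len_def)
      then have "\<bar>e\<bar> \<le> (w / len (depth P)) * len (depth P)"
        unfolding e_def abs_mult using tp_props(2)[OF P(1)] P(3) w len_pos[of "depth P"]
        by (intro mult_mono) (auto simp: \<sigma>_def abs_minus_commute)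
      then have e: "\<bar>e\<bar> \<le> w" using len_pos[of "depth P"] by simp
      have "\<phi> P (a, b) = \<phi> P (a0, b - slope P * (a - a0))"
        by (rule \<phi>_line[OF same])
      also have "b - slope P * (a - a0) = z + e" by (simp add: z_def e_def algebra_simps)
      also have "\<phi> P (a0, z + e) \<le> \<phi> P (a0, z - w) + \<phi> P (a0, z + w)"
        unfolding \<phi>_def by (rule vsm_regular) (use e \<rho>_pos in auto)
      finally show ?thesis .
    qed (simp add: \<phi>_zero_off)
    then have "\<phi>g i T (a, b) \<le> (\<Sum>P\<in>grp i T. \<phi> P (a0, z - w) + \<phi> P (a0, z + w))"
      unfolding \<phi>g_def by (intro sum_mono)
    also have "\<dots> = \<phi>g i T (a0, z - w) + \<phi>g i T (a0, z + w)"
      by (simp add: \<phi>g_def sum.distrib)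
    finally show ?thesis by (simp add: z_def algebra_simps)
  qed
  have grp2: "(\<integral>\<^sup>+b. (\<phi>g i T (a, b))\<^sup>2 \<partial>lborel) \<le> 4 * (\<integral>\<^sup>+b. (\<phi>g i T (a0, b))\<^sup>2 \<partial>lborel)" for T
  proof -
    let ?c1 = "- \<sigma> T * (a - a0) - w" and ?c2 = "- \<sigma> T * (a - a0) + w"
    have "(\<integral>\<^sup>+b. (\<phi>g i T (a, b))\<^sup>2 \<partial>lborel)
      \<le> (\<integral>\<^sup>+b. 2 * (\<phi>g i T (a0, b + ?c1))\<^sup>2 + 2 * (\<phi>g i T (a0, b + ?c2))\<^sup>2 \<partial>lborel)"
    proof (rule nn_integral_mono)
      fix b
      have two: "(x + y)\<^sup>2 \<le> 2 * x\<^sup>2 + 2 * y\<^sup>2" for x y :: ennreal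
        using ennreal_sum_power2_le[of "UNIV :: bool set" "\<lambda>t. if t then x else y"]
        by (simp add: UNIV_bool distrib_left add.commute)
      show "(\<phi>g i T (a, b))\<^sup>2 \<le> 2 * (\<phi>g i T (a0, b + ?c1))\<^sup>2 + 2 * (\<phi>g i T (a0, b + ?c2))\<^sup>2"
        by (rule order_trans[OF power_mono[OF pt[of T b]] two]) simp
    qed
    also have "\<dots> = 2 * (\<integral>\<^sup>+b. (\<phi>g i T (a0, b + ?c1))\<^sup>2 \<partial>lborel) + 2 * (\<integral>\<^sup>+b. (\<phi>g i T (a0, b + ?c2))\<^sup>2 \<partial>lborel)"
      by (simp add: nn_integral_add nn_integral_cmult)
    also have "\<dots> = 2 * (\<integral>\<^sup>+b. (\<phi>g i T (a0, b))\<^sup>2 \<partial>lborel) + 2 * (\<integral>\<^sup>+b. (\<phi>g i T (a0, b))\<^sup>2 \<partial>lborel)"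
      using nn_integral_shift[of "\<lambda>b. (\<phi>g i T (a0, b))\<^sup>2"] by simp
    also have "\<dots> = (2 + 2) * (\<integral>\<^sup>+b. (\<phi>g i T (a0, b))\<^sup>2 \<partial>lborel)"
      by (simp only: distrib_right)
    finally show ?thesis by simp
  qed
  obtain A where A: "finite A" "card A \<le> D" "\<forall>T\<in>tp ` Ps - A. \<forall>b. \<phi>g i T (a, b) = 0"
    using column_groups by blast
  have "Ht i a \<le> (\<integral>\<^sup>+b. of_nat D * (\<Sum>T\<in>tp ` Ps. (\<phi>g i T (a, b))\<^sup>2) \<partial>lborel)"
    unfolding Ht_def
  proof (rule nn_integral_mono)
    fix b
    have "hg i (a, b) = (\<Sum>T\<in>tp ` Ps \<inter> A. \<phi>g i T (a, b))"
      unfolding hg_def using fin A(3) by (intro sum.mono_neutral_right) auto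
    then have "(hg i (a, b))\<^sup>2 \<le> of_nat (card (tp ` Ps \<inter> A)) * (\<Sum>T\<in>tp ` Ps \<inter> A. (\<phi>g i T (a, b))\<^sup>2)"
      using ennreal_sum_power2_le[of "tp ` Ps \<inter> A" "\<lambda>T. \<phi>g i T (a, b)"] A(1) by simp
    also have "\<dots> \<le> of_nat D * (\<Sum>T\<in>tp ` Ps. (\<phi>g i T (a, b))\<^sup>2)"
      using fin A card_mono[of A "tp ` Ps \<inter> A"]
      by (intro mult_mono sum_mono2) (auto simp: intro: order_trans)
    finally show "(hg i (a, b))\<^sup>2 \<le> of_nat D * (\<Sum>T\<in>tp ` Ps. (\<phi>g i T (a, b))\<^sup>2)" .
  qed
  also have "\<dots> = of_nat D * (\<Sum>T\<in>tp ` Ps. \<integral>\<^sup>+b. (\<phi>g i T (a, b))\<^sup>2 \<partial>lborel)"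
    by (simp add: nn_integral_cmult nn_integral_sum)
  also have "\<dots> \<le> of_nat D * (\<Sum>T\<in>tp ` Ps. 4 * (\<integral>\<^sup>+b. (\<phi>g i T (a0, b))\<^sup>2 \<partial>lborel))"
    by (intro mult_left_mono sum_mono grp2) auto
  also have "\<dots> = of_nat D * (4 * (\<integral>\<^sup>+b. (\<Sum>T\<in>tp ` Ps. (\<phi>g i T (a0, b))\<^sup>2) \<partial>lborel))"
    by (simp add: nn_integral_sum sum_distrib_left)
  also have "\<dots> \<le> of_nat D * (4 * Ht i a0)"
    unfolding Ht_def hg_def using fin
    by (intro mult_left_mono nn_integral_mono ennreal_sum_of_squares_le) auto
  also have "\<dots> = ennreal (4 * real D) * Ht i a0"
    by (simp add: ennreal_mult' ennreal_of_nat_eq_real_of_nat mult_ac)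
  finally show ?thesis .
qed

lemma hg_late: "(\<integral>\<^sup>+z. (if late Nmax (i + t) (fst z) then hg i z else 0)\<^sup>2 \<partial>pl)
    \<le> ennreal (16 * (1/4) ^ t) * (\<integral>\<^sup>+z. (hg i z)\<^sup>2 \<partial>pl)"
proof (cases "3 \<le> t")
  case True
  have "(\<integral>\<^sup>+z. (if late Nmax (i + t) (fst z) then hg i z else 0)\<^sup>2 \<partial>pl)
    = (\<integral>\<^sup>+a. (if late Nmax (i + t) a then Ht i a else 0) \<partial>lborel)"
    by (subst nn_integral_plane) (auto simp: Ht_def intro!: nn_integral_cong)
  also have "\<dots> \<le> ennreal (4 * D * \<epsilon> ^ (t - 1)) * (\<integral>\<^sup>+a. Ht i a \<partial>lborel)"
    by (rule late_integral_le) (use True in \<open>auto intro: Ht_comparable\<close>)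
  also have "\<dots> \<le> ennreal (16 * (1/4) ^ t) * (\<integral>\<^sup>+a. Ht i a \<partial>lborel)"
    by (intro mult_right_mono ennreal_leI four_D_eps_le True) simp
  also have "(\<integral>\<^sup>+a. Ht i a \<partial>lborel) = (\<integral>\<^sup>+z. (hg i z)\<^sup>2 \<partial>pl)"
    by (subst nn_integral_plane) (auto simp: Ht_def intro!: nn_integral_cong)
  finally show ?thesis .
next
  case False
  then have "t = 0 \<or> t = 1 \<or> t = 2" by auto
  then have c: "1 \<le> 16 * (1/4::real) ^ t" by (auto simp: power2_eq_square)
  have "(\<integral>\<^sup>+z. (if late Nmax (i + t) (fst z) then hg i z else 0)\<^sup>2 \<partial>pl) \<le> 1 * (\<integral>\<^sup>+z. (hg i z)\<^sup>2 \<partial>pl)"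
    by (simp, intro nn_integral_mono) auto
  also have "\<dots> \<le> ennreal (16 * (1/4) ^ t) * (\<integral>\<^sup>+z. (hg i z)\<^sup>2 \<partial>pl)"
    using c by (intro mult_right_mono) (auto simp flip: ennreal_1 intro!: ennreal_leI simp del: ennreal_1)
  finally show ?thesis .
qed

end

section \<open>Interaction of two generations and the bound for \<open>h\<close>\<close>

lemma vmax_mask:
  "vmax l s N (\<lambda>z. if Q (fst z) then F z else 0) z = (if Q (fst z) then vmax l s N F z else 0)"
proof (cases "Q (fst z)")
  case False
  have "cavg l s n (\<lambda>_. 0) b = 0" for n b by (simp add: cavg_def)
  then have "(SUP n\<in>{..<N}. cavg l s n (\<lambda>_. 0) (snd z)) = (0::ennreal)"
    by (intro antisym SUP_least) auto
  then show ?thesis using False by (simp add: vmax_def)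
qed (simp add: vmax_def)

lemma ennreal_power2_add_le: "(x + y)\<^sup>2 \<le> 2 * x\<^sup>2 + 2 * y\<^sup>2" for x y :: ennreal
  using ennreal_sum_power2_le[of "UNIV :: bool set" "\<lambda>t. if t then x else y"]
  by (simp add: UNIV_bool distrib_left add.commute)

lemma cavg_le_vmax: "k < N \<Longrightarrow> cavg l s k (\<lambda>y. F (a, y)) b \<le> vmax l s N F (a, b)"
  unfolding vmax_def by (auto intro!: SUP_upper2[of k])

context tiles
begin

text \<open>The longer tile enters only through its label, so all tiles of a group are averaged over
  one common window; the summand \<open>w\<close> covers the slope error of the label.\<close>

definition Rad :: "nat \<times> int \<times> int \<Rightarrow> nat \<times> int \<Rightarrow> real" where
  "Rad P' T = \<bar>slope P' - sp (fst T) (snd T)\<bar> * len (depth P') + \<rho> + w"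

definition S :: "real \<Rightarrow> nat \<Rightarrow> nat \<Rightarrow> real \<times> real \<Rightarrow> ennreal" where
  "S \<kappa> N i z = (\<Sum>T\<in>tp ` Ps. vmax \<kappa> 0 N (\<phi>g i T) z + vmax \<kappa> (\<kappa> / 3) N (\<phi>g i T) z)"

lemma S_measurable[measurable]: "S \<kappa> N i \<in> borel_measurable (borel \<Otimes>\<^sub>M borel)"
  unfolding S_def by measurable

lemma Rad_pos: "0 < Rad P' T"
  using \<rho>_pos w len_pos[of "depth P'"] by (auto simp: Rad_def intro!: add_nonneg_pos)

text \<open>On its base cell \<open>\<phi> P\<close> is constant along lines of slope \<open>slope P\<close>, so averaging it over a shorter
  tile amounts to a vertical average in a single column.\<close>
lemma tile_pair:
  assumes P: "P \<in> Ps" and d: "depth P \<le> depth P'" and a: "cell l (depth P') a = pos P'"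
  shows "B P' (vsm \<rho> (\<phi> P)) (a, b) \<le> 8 * vsm (Rad P' (tp P)) (\<phi> P) (a, b)"
proof -
  define r where "r = \<bar>slope P' - slope P\<bar> * (l / 2 ^ depth P') + \<rho>"
  let ?\<sigma> = "sp (fst (tp P)) (snd (tp P))" and ?L = "len (depth P')"
  have L: "0 < ?L" by (rule len_pos)
  have r0: "0 < r" unfolding r_def using \<rho>_pos l by (intro add_nonneg_pos) auto
  have "?L \<le> len (depth P)"
    using d l by (auto simp: len_def intro!: divide_left_mono power_increasing)
  then have "w / len (depth P) \<le> w / ?L"
    using w L by (intro divide_left_mono mult_pos_pos len_pos) auto
  then have "\<bar>slope P - ?\<sigma>\<bar> \<le> w / ?L" using tp_props(2)[OF P] by linarith
  then have "\<bar>slope P - ?\<sigma>\<bar> * ?L \<le> w / ?L * ?L" using L by (intro mult_right_mono) auto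
  then have sw: "\<bar>slope P - ?\<sigma>\<bar> * ?L \<le> w" using L by simp
  have t1: "\<bar>slope P' - slope P\<bar> * ?L \<le> (\<bar>slope P' - ?\<sigma>\<bar> + \<bar>slope P - ?\<sigma>\<bar>) * ?L"
    and t2: "\<bar>slope P' - ?\<sigma>\<bar> * ?L \<le> (\<bar>slope P' - slope P\<bar> + \<bar>slope P - ?\<sigma>\<bar>) * ?L"
    using L by (intro mult_right_mono; linarith)+
  have rL: "r = \<bar>slope P' - slope P\<bar> * ?L + \<rho>" by (simp add: r_def len_def)
  have "r \<le> Rad P' (tp P)" using t1 sw unfolding rL Rad_def distrib_right by linarith
  moreover have "0 \<le> \<bar>slope P' - slope P\<bar> * ?L" using L by simp
  \<comment> \<open>Passing to the label changes the slide by at most \<open>w\<close>, the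
    definition of \<open>Rad\<close> adds another \<open>w\<close>, and
    \<open>2 * w \<le> \<rho> \<le> r\<close>.\<close>
  then have "Rad P' (tp P) \<le> 2 * r"
    using t2 sw \<rho> unfolding rL Rad_def distrib_right distrib_left by linarith
  ultimately have two: "vsm r (\<phi> P) (a, b) \<le> 2 * vsm (Rad P' (tp P)) (\<phi> P) (a, b)"
    by (intro vsm_radius r0)
  have "B P' (vsm \<rho> (\<phi> P)) (a, b) \<le> 4 * vsm r (\<phi> P) (a, b)"
    unfolding B_def r_def
  proof (rule lavg_vsm_le_window[OF l \<rho>_pos(1) \<phi>_measurable a])
    fix a' y assume "cell l (depth P') a' = pos P'"
    then have "cell l (depth P') a = cell l (depth P') a'" using a by simp
    then have "cell l (depth P) a = cell l (depth P) a'" by (rule cell_eq_mono[OF d])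
    then show "\<phi> P (a', y) = \<phi> P (a, y - slope P * (a' - a))" by (rule \<phi>_line)
  qed
  also have "\<dots> \<le> 4 * (2 * vsm (Rad P' (tp P)) (\<phi> P) (a, b))"
    by (intro mult_left_mono two) simp
  finally show ?thesis by (simp add: mult.assoc[symmetric])
qed

text \<open>Only tiles whose base contains the column of \<open>z\<close> matter. The longer ones
  have generation at most that of \<open>P'\<close>, and by monotonicity the column is late for the
  generation of \<open>P'\<close>. As the window is common to a group, the group can be summed
  before the maximal function is taken. The constant is 8 from the pairing times 6 from the change
  to cells.\<close>

lemma cross_pointwise:
  assumes P': "P' \<in> Ps" and \<kappa>: "0 < \<kappa>"
    and sc: "\<And>T. T \<in> tp ` Ps \<Longrightarrow> \<exists>k<N. 6 * Rad P' T \<le> \<kappa> / 2 ^ k \<and> \<kappa> / 2 ^ k \<le> 12 * Rad P' T"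
  shows "(\<Sum>P\<in>{P \<in> Ps. depth P \<le> depth P'}. B P' (vsm \<rho> (\<phi> P)) z)
    \<le> 48 * (\<Sum>i\<in>{i \<in> pgen ` Ps. i \<le> pgen P'}. if late Nmax (pgen P') (fst z) then S \<kappa> N i z else 0)"
proof (cases "cell l (depth P') (fst z) = pos P'")
  case False
  then show ?thesis by (simp add: B_def lavg_zero_off)
next
  case True
  obtain a b where z: "z = (a, b)" by (cases z)
  have a: "cell l (depth P') a = pos P'" using True z by simp
  define I where "I = {i \<in> pgen ` Ps. i \<le> pgen P'}"
  have late: "late Nmax (pgen P') a"
    using gen_mono[OF depth_le[OF P'], of a] a by (simp add: late_def pgen_def)
  define Q where "Q = {P \<in> Ps. depth P \<le> depth P' \<and> cell l (depth P) a = pos P}"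
  have finQ: "finite Q" "finite I" using fin by (auto simp: Q_def I_def)
  have zero: "vsm r (\<phi> P) (a, b) = 0" if "cell l (depth P) a \<noteq> pos P" for P r
    using \<phi>_zero_off[OF that] by (simp add: vsm_Pair cong: if_cong)
  have "(\<Sum>P\<in>{P \<in> Ps. depth P \<le> depth P'}. B P' (vsm \<rho> (\<phi> P)) z) = (\<Sum>P\<in>Q. B P' (vsm \<rho> (\<phi> P)) (a, b))"
  proof (unfold z, rule sum.mono_neutral_right)
    show "\<forall>P\<in>{P \<in> Ps. depth P \<le> depth P'} - Q. B P' (vsm \<rho> (\<phi> P)) (a, b) = 0"
    proof
      fix P assume "P \<in> {P \<in> Ps. depth P \<le> depth P'} - Q"
      then have P: "P \<in> Ps" "depth P \<le> depth P'" and "cell l (depth P) a \<noteq> pos P"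
        by (simp_all add: Q_def)
      then show "B P' (vsm \<rho> (\<phi> P)) (a, b) = 0"
        using tile_pair[OF P a, of b] zero[of P "Rad P' (tp P)"] by simp
    qed
  qed (use fin in \<open>auto simp: Q_def\<close>)
  also have "\<dots> \<le> (\<Sum>P\<in>Q. 8 * vsm (Rad P' (tp P)) (\<phi> P) (a, b))"
    by (intro sum_mono tile_pair a) (auto simp: Q_def)
  also have "\<dots> = (\<Sum>p\<in>I \<times> tp ` Ps. \<Sum>P | P \<in> Q \<and> (pgen P, tp P) = p. 8 * vsm (Rad P' (tp P)) (\<phi> P) (a, b))"
  proof (rule sum.group[symmetric])
    have "pgen P \<le> pgen P'" if "P \<in> Q" for P
      using gen_mono[of "depth P" "depth P'" a] that a by (auto simp: Q_def pgen_def)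
    then show "(\<lambda>P. (pgen P, tp P)) ` Q \<subseteq> I \<times> tp ` Ps"
      by (auto simp: I_def Q_def)
  qed (use finQ fin in auto)
  also have "\<dots> \<le> (\<Sum>p\<in>I \<times> tp ` Ps. \<Sum>P\<in>grp (fst p) (snd p). 8 * vsm (Rad P' (snd p)) (\<phi> P) (a, b))"
  proof (rule sum_mono)
    fix p :: "nat \<times> nat \<times> int"
    have "(\<Sum>P | P \<in> Q \<and> (pgen P, tp P) = p. 8 * vsm (Rad P' (tp P)) (\<phi> P) (a, b))
      = (\<Sum>P | P \<in> Q \<and> (pgen P, tp P) = p. 8 * vsm (Rad P' (snd p)) (\<phi> P) (a, b))"
      by (intro sum.cong) auto
    also have "\<dots> \<le> (\<Sum>P\<in>grp (fst p) (snd p). 8 * vsm (Rad P' (snd p)) (\<phi> P) (a, b))"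
      by (intro sum_mono2 finite_grp) (auto simp: grp_def Q_def)
    finally show "(\<Sum>P | P \<in> Q \<and> (pgen P, tp P) = p. 8 * vsm (Rad P' (tp P)) (\<phi> P) (a, b))
      \<le> (\<Sum>P\<in>grp (fst p) (snd p). 8 * vsm (Rad P' (snd p)) (\<phi> P) (a, b))" .
  qed
  also have "\<dots> = (\<Sum>p\<in>I \<times> tp ` Ps. 8 * vsm (Rad P' (snd p)) (\<phi>g (fst p) (snd p)) (a, b))"
    unfolding \<phi>g_def by (simp add: vsm_sum[OF finite_grp] sum_distrib_left)
  also have "\<dots> \<le> (\<Sum>p\<in>I \<times> tp ` Ps. 48 * (vmax \<kappa> 0 N (\<phi>g (fst p) (snd p)) (a, b) + vmax \<kappa> (\<kappa> / 3) N (\<phi>g (fst p) (snd p)) (a, b)))"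
  proof (rule sum_mono)
    fix p assume "p \<in> I \<times> tp ` Ps"
    then obtain k where k: "k < N" "6 * Rad P' (snd p) \<le> \<kappa> / 2 ^ k" "\<kappa> / 2 ^ k \<le> 12 * Rad P' (snd p)"
      using sc[of "snd p"] by auto
    let ?F = "\<phi>g (fst p) (snd p)"
    have "8 * vsm (Rad P' (snd p)) ?F (a, b) \<le> 8 * (6 * (cavg \<kappa> 0 k (\<lambda>y. ?F (a, y)) b + cavg \<kappa> (\<kappa> / 3) k (\<lambda>y. ?F (a, y)) b))"
      by (intro mult_left_mono vsm_window_to_cells \<kappa> Rad_pos k) auto
    also have "\<dots> \<le> 8 * (6 * (vmax \<kappa> 0 N ?F (a, b) + vmax \<kappa> (\<kappa> / 3) N ?F (a, b)))"
      by (intro mult_left_mono add_mono cavg_le_vmax k) auto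
    finally show "8 * vsm (Rad P' (snd p)) ?F (a, b) \<le> 48 * (vmax \<kappa> 0 N ?F (a, b) + vmax \<kappa> (\<kappa> / 3) N ?F (a, b))"
      by (simp add: mult.assoc[symmetric])
  qed
  also have "\<dots> = 48 * (\<Sum>i\<in>I. S \<kappa> N i (a, b))"
    by (simp add: S_def sum.cartesian_product sum_distrib_left case_prod_beta)
  finally show ?thesis using late by (simp add: I_def z)
qed

text \<open>Both averages are self-adjoint, so those belonging to \<open>P'\<close> can be moved
  onto \<open>\<phi> P\<close>.\<close>

lemma pair_integral:
  "(\<integral>\<^sup>+z. \<phi> P' z * \<phi> P z \<partial>pl) = (\<integral>\<^sup>+z. G P' z * B P' (vsm \<rho> (\<phi> P)) z \<partial>pl)"
proof -
  have "(\<integral>\<^sup>+z. \<phi> P' z * \<phi> P z \<partial>pl) = (\<integral>\<^sup>+z. \<phi> P z * vsm \<rho> (B P' (G P')) z \<partial>pl)"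
    by (simp add: \<phi>_def[of P'] mult.commute)
  also have "\<dots> = (\<integral>\<^sup>+z. B P' (G P') z * vsm \<rho> (\<phi> P) z \<partial>pl)"
    by (rule vsm_sym) measurable
  also have "\<dots> = (\<integral>\<^sup>+z. vsm \<rho> (\<phi> P) z * lavg l (depth P') (pos P') (slope P') (G P') z \<partial>pl)"
    by (simp add: B_def mult.commute)
  also have "\<dots> = (\<integral>\<^sup>+z. G P' z * B P' (vsm \<rho> (\<phi> P)) z \<partial>pl)"
    unfolding B_def by (rule lavg_sym) measurable
  finally show ?thesis .
qed

text \<open>By symmetry each pair may be listed with the deeper, hence shorter, tile in the role of
  \<open>P'\<close>.\<close>

lemma h2_le_ordered_pairs:
  "(h z)\<^sup>2 \<le> 2 * (\<Sum>P'\<in>Ps. \<Sum>P\<in>{P \<in> Ps. depth P \<le> depth P'}. \<phi> P' z * \<phi> P z)"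
proof -
  let ?A = "\<Sum>P'\<in>Ps. \<Sum>P\<in>{P \<in> Ps. depth P \<le> depth P'}. \<phi> P' z * \<phi> P z"
  have split: "(\<Sum>P\<in>Ps. \<phi> P' z * \<phi> P z) = (\<Sum>P\<in>{P \<in> Ps. depth P \<le> depth P'}. \<phi> P' z * \<phi> P z)
      + (\<Sum>P\<in>{P \<in> Ps. depth P' < depth P}. \<phi> P' z * \<phi> P z)" for P'
    using fin by (subst sum.union_disjoint[symmetric]) (auto intro!: sum.cong)
  have "(h z)\<^sup>2 = (\<Sum>P'\<in>Ps. \<Sum>P\<in>Ps. \<phi> P' z * \<phi> P z)"
    by (simp add: h_def power2_eq_square sum_product)
  also have "\<dots> = ?A + (\<Sum>P'\<in>Ps. \<Sum>P\<in>{P \<in> Ps. depth P' < depth P}. \<phi> P' z * \<phi> P z)"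
    by (simp add: split sum.distrib)
  also have "(\<Sum>P'\<in>Ps. \<Sum>P\<in>{P \<in> Ps. depth P' < depth P}. \<phi> P' z * \<phi> P z)
      = (\<Sum>P\<in>Ps. \<Sum>P'\<in>{P' \<in> Ps. depth P' < depth P}. \<phi> P' z * \<phi> P z)"
    by (rule sum.swap_restrict) (use fin in auto)
  also have "\<dots> \<le> ?A"
  proof (rule sum_mono)
    fix P
    have "(\<Sum>P'\<in>{P' \<in> Ps. depth P' < depth P}. \<phi> P' z * \<phi> P z)
      = (\<Sum>P'\<in>{P' \<in> Ps. depth P' < depth P}. \<phi> P z * \<phi> P' z)"
      by (intro sum.cong refl mult.commute)
    also have "\<dots> \<le> (\<Sum>P'\<in>{P' \<in> Ps. depth P' \<le> depth P}. \<phi> P z * \<phi> P' z)"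
      by (rule sum_mono2) (use fin in auto)
    finally show "(\<Sum>P'\<in>{P' \<in> Ps. depth P' < depth P}. \<phi> P' z * \<phi> P z)
      \<le> (\<Sum>P'\<in>{P' \<in> Ps. depth P' \<le> depth P}. \<phi> P z * \<phi> P' z)" .
  qed
  finally show ?thesis by (simp add: mult_2 add_left_mono)
qed

definition gg :: "nat \<Rightarrow> real \<times> real \<Rightarrow> ennreal" where
  "gg j z = (\<Sum>P\<in>{P \<in> Ps. pgen P = j}. G P z)"

lemma gg_measurable[measurable]: "gg j \<in> borel_measurable (borel \<Otimes>\<^sub>M borel)"
  unfolding gg_def by measurable

definition SL :: "real \<Rightarrow> nat \<Rightarrow> nat \<Rightarrow> nat \<Rightarrow> real \<times> real \<Rightarrow> ennreal" where
  "SL \<kappa> N j i z = (if late Nmax j (fst z) then S \<kappa> N i z else 0)"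

lemma SL_measurable[measurable]: "SL \<kappa> N j i \<in> borel_measurable (borel \<Otimes>\<^sub>M borel)"
  unfolding SL_def by measurable

text \<open>The cut to late columns depends on the abscissa alone, so it commutes with vertical
  maximal functions and can be made before the maximal inequality; what remains is small by
  \<open>hg_late\<close>. The constant is 4 for the two grids, times 64, times 16.\<close>

lemma SL_bound:
  assumes \<kappa>: "0 < \<kappa>" and ij: "i \<le> j"
  shows "(\<integral>\<^sup>+z. (SL \<kappa> N j i z)\<^sup>2 \<partial>pl)
    \<le> ennreal (4096 * (3 + ln D)\<^sup>2 * (1/4) ^ (j - i)) * (\<integral>\<^sup>+z. (hg i z)\<^sup>2 \<partial>pl)"
proof -
  define F where "F T z = (if late Nmax j (fst z) then \<phi>g i T z else 0)" for T z
  define V where "V s z = (\<Sum>T\<in>tp ` Ps. vmax \<kappa> s N (F T) z)" for s z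
  have [measurable]: "F T \<in> borel_measurable (borel \<Otimes>\<^sub>M borel)" for T
    unfolding F_def by measurable
  have [measurable]: "V s \<in> borel_measurable (borel \<Otimes>\<^sub>M borel)" for s
    unfolding V_def by measurable
  have F_le: "F T z \<le> \<phi>g i T z" for T z by (simp add: F_def)
  have V: "(\<integral>\<^sup>+z. (V s z)\<^sup>2 \<partial>pl) \<le> ennreal ((8 * (3 + ln D))\<^sup>2) * (\<integral>\<^sup>+z. (\<Sum>T\<in>tp ` Ps. F T z)\<^sup>2 \<partial>pl)" for s
    unfolding V_def
  proof (rule column_maximal_ineq[OF \<kappa>])
    show "F T z \<le> ennreal (card Ps * max 0 K)" for T z
      by (rule order_trans[OF F_le \<phi>g_bd])
    show "(\<integral>\<^sup>+z. F T z \<partial>pl) < \<infinity>" for T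
      by (rule le_less_trans[OF nn_integral_mono[OF F_le] \<phi>g_int])
    show "\<exists>A. finite A \<and> card A \<le> D \<and> (\<forall>T\<in>tp ` Ps - A. \<forall>b. F T (a, b) = 0)" for a
      using column_groups[of i a] by (auto simp: F_def)
  qed (use fin D_pos in auto)
  have FH: "(\<Sum>T\<in>tp ` Ps. F T z) = (if late Nmax j (fst z) then hg i z else 0)" for z
    by (simp add: F_def hg_def)
  have SV: "SL \<kappa> N j i z = V 0 z + V (\<kappa> / 3) z" for z
    unfolding V_def F_def vmax_mask by (simp add: SL_def S_def sum.distrib)
  have "(\<integral>\<^sup>+z. (SL \<kappa> N j i z)\<^sup>2 \<partial>pl) \<le> (\<integral>\<^sup>+z. 2 * (V 0 z)\<^sup>2 + 2 * (V (\<kappa> / 3) z)\<^sup>2 \<partial>pl)"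
    unfolding SV by (intro nn_integral_mono ennreal_power2_add_le)
  also have "\<dots> = 2 * (\<integral>\<^sup>+z. (V 0 z)\<^sup>2 \<partial>pl) + 2 * (\<integral>\<^sup>+z. (V (\<kappa> / 3) z)\<^sup>2 \<partial>pl)"
    by (simp add: nn_integral_add nn_integral_cmult)
  also have "\<dots> \<le> 2 * (ennreal ((8 * (3 + ln D))\<^sup>2) * (\<integral>\<^sup>+z. (\<Sum>T\<in>tp ` Ps. F T z)\<^sup>2 \<partial>pl))
      + 2 * (ennreal ((8 * (3 + ln D))\<^sup>2) * (\<integral>\<^sup>+z. (\<Sum>T\<in>tp ` Ps. F T z)\<^sup>2 \<partial>pl))"
    by (intro add_mono mult_left_mono V) auto
  also have "\<dots> = ennreal 4 * ennreal ((8 * (3 + ln D))\<^sup>2) * (\<integral>\<^sup>+z. (\<Sum>T\<in>tp ` Ps. F T z)\<^sup>2 \<partial>pl)"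
  proof -
    have "2 * (x * y) + 2 * (x * y) = (2 + 2) * x * y" for x y :: ennreal
      by (simp only: distrib_right mult.assoc)
    then show ?thesis by simp
  qed
  also have "\<dots> \<le> ennreal 4 * ennreal ((8 * (3 + ln D))\<^sup>2) * (ennreal (16 * (1/4) ^ (j - i)) * (\<integral>\<^sup>+z. (hg i z)\<^sup>2 \<partial>pl))"
    unfolding FH using hg_late[of i "j - i"] ij by (intro mult_left_mono) auto
  also have "\<dots> = ennreal (4 * (8 * (3 + ln D))\<^sup>2 * (16 * (1/4) ^ (j - i))) * (\<integral>\<^sup>+z. (hg i z)\<^sup>2 \<partial>pl)"
    by (subst ennreal_mult', simp, subst ennreal_mult', simp, simp only: mult.assoc)
  also have "4 * (8 * (3 + ln D))\<^sup>2 * (16 * (1/4) ^ (j - i)) = 4096 * (3 + ln D)\<^sup>2 * (1/4::real) ^ (j - i)"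
    by (simp only: power_mult_distrib) simp
  finally show ?thesis .
qed

theorem h_bound:
  "(\<integral>\<^sup>+z. (h z)\<^sup>2 \<partial>pl) \<le> ennreal ((12288 * (3 + ln D))\<^sup>2) * (\<integral>\<^sup>+z. (\<Sum>P\<in>Ps. G P z)\<^sup>2 \<partial>pl)"
proof -
  define q where "q = (3 + ln (real D))\<^sup>2"
  \<comment> \<open>Chosen so that \<open>96 * (2048 * q / \<Lambda>)\<close>, the coefficient with
    which the integral for \<open>h\<close> returns, equals 1/2.\<close>
  define \<Lambda> where "\<Lambda> = 393216 * q"
  define I where "I = pgen ` Ps"
  have "0 \<le> ln (real D)" using D_pos by simp
  then have q: "0 < q" and \<Lambda>: "0 < \<Lambda>" by (auto simp: q_def \<Lambda>_def)
  have finI: "finite I" using fin by (simp add: I_def)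
  obtain \<kappa> N where \<kappa>: "0 < \<kappa>"
    and sc: "\<And>x. x \<in> Ps \<times> tp ` Ps \<Longrightarrow> \<exists>k<N. 6 * Rad (fst x) (snd x) \<le> \<kappa> / 2 ^ k \<and> \<kappa> / 2 ^ k \<le> 12 * Rad (fst x) (snd x)"
    using dyadic_scales[of "Ps \<times> tp ` Ps" "\<lambda>x. Rad (fst x) (snd x)"] fin Rad_pos by auto
  have sc': "\<exists>k<N. 6 * Rad P' T \<le> \<kappa> / 2 ^ k \<and> \<kappa> / 2 ^ k \<le> 12 * Rad P' T"
    if "P' \<in> Ps" "T \<in> tp ` Ps" for P' T
    using sc[of "(P', T)"] that by simp
  define y where "y j = (\<integral>\<^sup>+z. (gg j z)\<^sup>2 \<partial>pl)" for j
  define x where "x i = (\<integral>\<^sup>+z. (hg i z)\<^sup>2 \<partial>pl)" for i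
  have "(\<integral>\<^sup>+z. (h z)\<^sup>2 \<partial>pl) \<le> (\<integral>\<^sup>+z. 2 * (\<Sum>P'\<in>Ps. \<Sum>P\<in>{P \<in> Ps. depth P \<le> depth P'}. \<phi> P' z * \<phi> P z) \<partial>pl)"
    by (intro nn_integral_mono h2_le_ordered_pairs)
  also have "\<dots> = 2 * (\<Sum>P'\<in>Ps. \<Sum>P\<in>{P \<in> Ps. depth P \<le> depth P'}. \<integral>\<^sup>+z. \<phi> P' z * \<phi> P z \<partial>pl)"
    by (simp add: nn_integral_cmult nn_integral_sum)
  also have "\<dots> = 2 * (\<Sum>P'\<in>Ps. \<integral>\<^sup>+z. G P' z * (\<Sum>P\<in>{P \<in> Ps. depth P \<le> depth P'}. B P' (vsm \<rho> (\<phi> P)) z) \<partial>pl)"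
    by (simp add: pair_integral nn_integral_sum sum_distrib_left)
  also have "\<dots> \<le> 2 * (\<Sum>P'\<in>Ps. \<integral>\<^sup>+z. G P' z * (48 * (\<Sum>i\<in>{i \<in> I. i \<le> pgen P'}. SL \<kappa> N (pgen P') i z)) \<partial>pl)"
    unfolding SL_def I_def
    by (intro mult_left_mono sum_mono nn_integral_mono cross_pointwise \<kappa> sc') (assumption | simp)+
  also have "\<dots> = 96 * (\<Sum>P'\<in>Ps. \<Sum>i\<in>{i \<in> I. i \<le> pgen P'}. \<integral>\<^sup>+z. G P' z * SL \<kappa> N (pgen P') i z \<partial>pl)"
  proof -
    have "(\<integral>\<^sup>+z. G P' z * (48 * (\<Sum>i\<in>{i \<in> I. i \<le> pgen P'}. SL \<kappa> N (pgen P') i z)) \<partial>pl)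
      = 48 * (\<Sum>i\<in>{i \<in> I. i \<le> pgen P'}. \<integral>\<^sup>+z. G P' z * SL \<kappa> N (pgen P') i z \<partial>pl)" for P'
    proof -
      have "G P' z * (48 * (\<Sum>i\<in>{i \<in> I. i \<le> pgen P'}. SL \<kappa> N (pgen P') i z))
        = 48 * (\<Sum>i\<in>{i \<in> I. i \<le> pgen P'}. G P' z * SL \<kappa> N (pgen P') i z)" for z
        by (simp add: sum_distrib_left mult_ac)
      then show ?thesis by (simp add: nn_integral_cmult nn_integral_sum)
    qed
    then show ?thesis by (simp add: mult.assoc[symmetric] flip: sum_distrib_left)
  qed
  also have "(\<Sum>P'\<in>Ps. \<Sum>i\<in>{i \<in> I. i \<le> pgen P'}. \<integral>\<^sup>+z. G P' z * SL \<kappa> N (pgen P') i z \<partial>pl)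
      = (\<Sum>j\<in>I. \<Sum>P'\<in>{P' \<in> Ps. pgen P' = j}. \<Sum>i\<in>{i \<in> I. i \<le> pgen P'}. \<integral>\<^sup>+z. G P' z * SL \<kappa> N (pgen P') i z \<partial>pl)"
    unfolding I_def by (rule sum.group[symmetric]) (use fin in auto)
  also have "\<dots> = (\<Sum>j\<in>I. \<Sum>i\<in>{i \<in> I. i \<le> j}. \<integral>\<^sup>+z. gg j z * SL \<kappa> N j i z \<partial>pl)"
  proof (rule sum.cong[OF refl])
    fix j
    have "(\<Sum>P'\<in>{P' \<in> Ps. pgen P' = j}. \<Sum>i\<in>{i \<in> I. i \<le> pgen P'}. \<integral>\<^sup>+z. G P' z * SL \<kappa> N (pgen P') i z \<partial>pl)
      = (\<Sum>P'\<in>{P' \<in> Ps. pgen P' = j}. \<Sum>i\<in>{i \<in> I. i \<le> j}. \<integral>\<^sup>+z. G P' z * SL \<kappa> N j i z \<partial>pl)"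
      by (rule sum.cong) auto
    also have "\<dots> = (\<Sum>i\<in>{i \<in> I. i \<le> j}. \<Sum>P'\<in>{P' \<in> Ps. pgen P' = j}. \<integral>\<^sup>+z. G P' z * SL \<kappa> N j i z \<partial>pl)"
      by (rule sum.swap)
    also have "\<dots> = (\<Sum>i\<in>{i \<in> I. i \<le> j}. \<integral>\<^sup>+z. gg j z * SL \<kappa> N j i z \<partial>pl)"
      by (simp add: gg_def sum_distrib_right nn_integral_sum)
    finally show "(\<Sum>P'\<in>{P' \<in> Ps. pgen P' = j}. \<Sum>i\<in>{i \<in> I. i \<le> pgen P'}. \<integral>\<^sup>+z. G P' z * SL \<kappa> N (pgen P') i z \<partial>pl)
      = (\<Sum>i\<in>{i \<in> I. i \<le> j}. \<integral>\<^sup>+z. gg j z * SL \<kappa> N j i z \<partial>pl)" .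
  qed
  also have "\<dots> \<le> (\<Sum>j\<in>I. \<Sum>i\<in>{i \<in> I. i \<le> j}. ennreal (\<Lambda> * (1/2) ^ (j - i)) * y j + ennreal (1024 * q / \<Lambda> * (1/2) ^ (j - i)) * x i)"
  proof (intro sum_mono)
    fix i j assume "i \<in> {i \<in> I. i \<le> j}"
    then have ij: "i \<le> j" by simp
    \<comment> \<open>The squares decay like \<open>(1/4) ^ (j - i)\<close>; the weight
      \<open>(1/2) ^ (j - i)\<close> in AM-GM leaves the same geometric factor on both terms, so
      each double sum reduces to a geometric series.\<close>
    let ?c = "\<Lambda> * (1/2) ^ (j - i)"
    have c: "0 < ?c" using \<Lambda> by simp
    have "(\<integral>\<^sup>+z. gg j z * SL \<kappa> N j i z \<partial>pl)
      \<le> (\<integral>\<^sup>+z. ennreal ?c * (gg j z)\<^sup>2 + ennreal (1 / (4 * ?c)) * (SL \<kappa> N j i z)\<^sup>2 \<partial>pl)"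
      by (intro nn_integral_mono ennreal_amgm c)
    also have "\<dots> = ennreal ?c * y j + ennreal (1 / (4 * ?c)) * (\<integral>\<^sup>+z. (SL \<kappa> N j i z)\<^sup>2 \<partial>pl)"
      unfolding y_def by (simp add: nn_integral_add nn_integral_cmult)
    also have "\<dots> \<le> ennreal ?c * y j + ennreal (1 / (4 * ?c)) * (ennreal (4096 * q * (1/4) ^ (j - i)) * x i)"
      unfolding x_def q_def by (intro add_left_mono mult_left_mono SL_bound \<kappa> ij) auto
    also have "ennreal (1 / (4 * ?c)) * (ennreal (4096 * q * (1/4) ^ (j - i)) * x i)
        = ennreal (1 / (4 * ?c) * (4096 * q * (1/4) ^ (j - i))) * x i"
      using q by (subst ennreal_mult'') (auto simp: mult.assoc)
    also have "1 / (4 * ?c) * (4096 * q * (1/4) ^ (j - i)) = 1024 * q / \<Lambda> * (1/2) ^ (j - i)"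
    proof -
      have "(1/4::real) ^ (j - i) = (1/2) ^ (j - i) * (1/2) ^ (j - i)"
        by (simp flip: power_mult_distrib)
      then show ?thesis using \<Lambda> by (simp add: field_simps)
    qed
    finally show "(\<integral>\<^sup>+z. gg j z * SL \<kappa> N j i z \<partial>pl)
      \<le> ennreal ?c * y j + ennreal (1024 * q / \<Lambda> * (1/2) ^ (j - i)) * x i" .
  qed
  also have "\<dots> = (\<Sum>j\<in>I. \<Sum>i\<in>{i \<in> I. i \<le> j}. ennreal (\<Lambda> * (1/2) ^ (j - i)) * y j)
      + (\<Sum>j\<in>I. \<Sum>i\<in>{i \<in> I. i \<le> j}. ennreal (1024 * q / \<Lambda> * (1/2) ^ (j - i)) * x i)"
    by (simp add: sum.distrib)
  also have "\<dots> \<le> ennreal (2 * \<Lambda>) * (\<Sum>j\<in>I. y j) + ennreal (2048 * q / \<Lambda>) * (\<Sum>i\<in>I. x i)"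
  proof (rule add_mono)
    have geo1: "(\<Sum>i\<in>{i \<in> I. i \<le> j}. ennreal (c * (1/2) ^ (j - i))) \<le> ennreal (2 * c)" if "0 \<le> c" for c j
    proof -
      have "(\<Sum>i\<in>{i \<in> I. i \<le> j}. (1/2::real) ^ (j - i)) = (\<Sum>k\<in>(\<lambda>i. j - i) ` {i \<in> I. i \<le> j}. (1/2) ^ k)"
        by (subst sum.reindex) (auto simp: inj_on_def)
      also have "\<dots> \<le> 2" using finI by (intro sum_pow_half_le) auto
      finally have "c * (\<Sum>i\<in>{i \<in> I. i \<le> j}. (1/2::real) ^ (j - i)) \<le> c * 2" using that by (intro mult_left_mono)
      then show ?thesis using that by (simp add: sum_ennreal sum_distrib_left[symmetric] ennreal_leI mult.commute)
    qed
    have geo2: "(\<Sum>j\<in>{j \<in> I. i \<le> j}. ennreal (c * (1/2) ^ (j - i))) \<le> ennreal (2 * c)" if "0 \<le> c" for c i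
    proof -
      have "(\<Sum>j\<in>{j \<in> I. i \<le> j}. (1/2::real) ^ (j - i)) = (\<Sum>k\<in>(\<lambda>j. j - i) ` {j \<in> I. i \<le> j}. (1/2) ^ k)"
        by (subst sum.reindex) (auto simp: inj_on_def)
      also have "\<dots> \<le> 2" using finI by (intro sum_pow_half_le) auto
      finally have "c * (\<Sum>j\<in>{j \<in> I. i \<le> j}. (1/2::real) ^ (j - i)) \<le> c * 2" using that by (intro mult_left_mono)
      then show ?thesis using that by (simp add: sum_ennreal sum_distrib_left[symmetric] ennreal_leI mult.commute)
    qed
    show "(\<Sum>j\<in>I. \<Sum>i\<in>{i \<in> I. i \<le> j}. ennreal (\<Lambda> * (1/2) ^ (j - i)) * y j) \<le> ennreal (2 * \<Lambda>) * (\<Sum>j\<in>I. y j)"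
      unfolding sum_distrib_left sum_distrib_right[symmetric]
      using \<Lambda> by (intro sum_mono mult_right_mono geo1) auto
    have "(\<Sum>j\<in>I. \<Sum>i\<in>{i \<in> I. i \<le> j}. ennreal (1024 * q / \<Lambda> * (1/2) ^ (j - i)) * x i)
      = (\<Sum>i\<in>I. \<Sum>j\<in>{j \<in> I. i \<le> j}. ennreal (1024 * q / \<Lambda> * (1/2) ^ (j - i)) * x i)"
      by (rule sum.swap_restrict) (use finI in auto)
    also have "\<dots> = (\<Sum>i\<in>I. (\<Sum>j\<in>{j \<in> I. i \<le> j}. ennreal (1024 * q / \<Lambda> * (1/2) ^ (j - i))) * x i)"
      by (simp add: sum_distrib_right)
    also have "\<dots> \<le> (\<Sum>i\<in>I. ennreal (2 * (1024 * q / \<Lambda>)) * x i)"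
      using q \<Lambda> by (intro sum_mono mult_right_mono geo2) auto
    finally show "(\<Sum>j\<in>I. \<Sum>i\<in>{i \<in> I. i \<le> j}. ennreal (1024 * q / \<Lambda> * (1/2) ^ (j - i)) * x i)
      \<le> ennreal (2048 * q / \<Lambda>) * (\<Sum>i\<in>I. x i)"
      by (simp add: sum_distrib_left)
  qed
  also have "\<dots> \<le> ennreal (2 * \<Lambda>) * (\<integral>\<^sup>+z. (\<Sum>P\<in>Ps. G P z)\<^sup>2 \<partial>pl) + ennreal (2048 * q / \<Lambda>) * (\<integral>\<^sup>+z. (h z)\<^sup>2 \<partial>pl)"
  proof (intro add_mono mult_left_mono)
    have gs: "(\<Sum>j\<in>I. gg j z) = (\<Sum>P\<in>Ps. G P z)" for z
      unfolding gg_def I_def by (rule sum.group) (use fin in auto)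
    have "(\<Sum>j\<in>I. y j) = (\<integral>\<^sup>+z. (\<Sum>j\<in>I. (gg j z)\<^sup>2) \<partial>pl)"
      unfolding y_def by (rule nn_integral_sum[symmetric]) measurable
    also have "\<dots> \<le> (\<integral>\<^sup>+z. (\<Sum>j\<in>I. gg j z)\<^sup>2 \<partial>pl)"
      by (intro nn_integral_mono ennreal_sum_of_squares_le finI)
    finally show "(\<Sum>j\<in>I. y j) \<le> (\<integral>\<^sup>+z. (\<Sum>P\<in>Ps. G P z)\<^sup>2 \<partial>pl)" unfolding gs .
    show "(\<Sum>i\<in>I. x i) \<le> (\<integral>\<^sup>+z. (h z)\<^sup>2 \<partial>pl)"
      unfolding x_def I_def by (rule hg_squares)
  qed auto
  finally have main: "(\<integral>\<^sup>+z. (h z)\<^sup>2 \<partial>pl) \<le> 96 * (ennreal (2 * \<Lambda>) * (\<integral>\<^sup>+z. (\<Sum>P\<in>Ps. G P z)\<^sup>2 \<partial>pl)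
      + ennreal (2048 * q / \<Lambda>) * (\<integral>\<^sup>+z. (h z)\<^sup>2 \<partial>pl))"
    by (simp add: mult_left_mono)
  show ?thesis
  proof (cases "(\<integral>\<^sup>+z. (\<Sum>P\<in>Ps. G P z)\<^sup>2 \<partial>pl)")
    case (real s)
    obtain t where t: "0 \<le> t" "(\<integral>\<^sup>+z. (h z)\<^sup>2 \<partial>pl) = ennreal t"
      using h_int2 by (cases "(\<integral>\<^sup>+z. (h z)\<^sup>2 \<partial>pl)") auto
    have "ennreal t \<le> ennreal (96 * (2 * \<Lambda> * s + 2048 * q / \<Lambda> * t))"
    proof -
      have "ennreal (96 * (2 * \<Lambda> * s + 2048 * q / \<Lambda> * t))
        = ennreal 96 * (ennreal (2 * \<Lambda>) * ennreal s + ennreal (2048 * q / \<Lambda>) * ennreal t)"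
      proof -
        have nn: "0 \<le> 2 * \<Lambda>" "0 \<le> 2048 * q / \<Lambda>" "0 \<le> 2 * \<Lambda> * s" "0 \<le> 2048 * q / \<Lambda> * t"
          using q \<Lambda> t(1) real(1) by auto
        show ?thesis
          by (simp only: ennreal_mult'[of 96] ennreal_plus[OF nn(3,4)] ennreal_mult'[OF nn(1)] ennreal_mult'[OF nn(2)])
      qed
      then show ?thesis using main unfolding t(2) real(2) by simp
    qed
    then have "t \<le> 96 * (2 * \<Lambda> * s + 2048 * q / \<Lambda> * t)"
      using real t q \<Lambda> by (subst (asm) ennreal_le_iff) auto
    also have "2048 * q / \<Lambda> = 1 / 192" using q by (simp add: \<Lambda>_def)
    finally have "t \<le> 384 * \<Lambda> * s" by simp
    also have "384 * \<Lambda> = (12288 * (3 + ln D))\<^sup>2" by (simp only: \<Lambda>_def q_def power_mult_distrib) simp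
    finally show ?thesis using t real by (simp add: ennreal_leI flip: ennreal_mult')
  next
    case top
    have "(12288 * (3 + ln (real D)))\<^sup>2 \<noteq> 0" using \<open>0 \<le> ln (real D)\<close> by auto
    then show ?thesis using top by (simp add: ennreal_mult_top)
  qed
qed

end

text \<open>Finitely many tiles and a bounded integrable \<open>f\<close> ensure that the unknown
  integral is finite before half of it is absorbed.\<close>

theorem (in slope_field) tile_maximal_ineq:
  fixes f :: "real \<times> real \<Rightarrow> ennreal"
  assumes \<rho>: "2 * w \<le> \<rho>" and fin: "finite Ps" and live: "\<And>n m j. (n, m, j) \<in> Ps \<Longrightarrow> live n m j"
    and f[measurable]: "f \<in> borel_measurable (borel \<Otimes>\<^sub>M borel)"
    and f_bd: "\<And>z. f z \<le> ennreal K" and f_int: "(\<integral>\<^sup>+z. f z \<partial>pl) < \<infinity>"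
  shows "(\<integral>\<^sup>+z. (SUP P\<in>Ps. B P (vsm \<rho> f) z)\<^sup>2 \<partial>pl)
    \<le> ennreal ((12288 * (3 + ln D))\<^sup>2) * (\<integral>\<^sup>+z. (f z)\<^sup>2 \<partial>pl)"
proof -
  define M where "M = (12288 * (3 + ln (real D)))\<^sup>2"
  have D1: "1 \<le> real D"
  proof -
    have "1 \<le> 256 / \<eta>\<^sup>2" using \<eta> power_le_one[of \<eta> 2] by (simp add: field_simps)
    then show ?thesis using D by linarith
  qed
  then have "0 \<le> ln (real D)" by simp
  then have M: "0 < M" by (auto simp: M_def)
  have \<rho>0: "0 < \<rho>" using \<rho> w by linarith
  define a where "a P = B P (vsm \<rho> f)" for P
  define g where "g z = (SUP P\<in>Ps. a P z)" for z
  have a_meas[measurable]: "a P \<in> borel_measurable (borel \<Otimes>\<^sub>M borel)" for P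
    unfolding a_def by measurable
  have g_meas[measurable]: "g \<in> borel_measurable (borel \<Otimes>\<^sub>M borel)"
    unfolding g_def using fin by measurable
  \<comment> \<open>Among the maximising tiles the one with the smallest code is selected, a
    measurable choice that makes the pieces \<open>G P\<close> disjointly supported.\<close>
  define sel where "sel P z \<longleftrightarrow> P \<in> Ps \<and> a P z = g z \<and> (\<forall>P'\<in>Ps. to_nat P' < to_nat P \<longrightarrow> a P' z \<noteq> g z)" for P z
  define G where "G P z = (if sel P z then g z else 0)" for P z
  have [measurable]: "Measurable.pred (borel \<Otimes>\<^sub>M borel) (sel P)" for P
    unfolding sel_def by measurable
  have G_meas[measurable]: "G P \<in> borel_measurable (borel \<Otimes>\<^sub>M borel)" for P
    unfolding G_def by measurable
  have G_sum: "(\<Sum>P\<in>Ps. G P z) = g z" for z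
  proof (cases "Ps = {}")
    case True
    then show ?thesis by (simp add: g_def bot_ennreal)
  next
    case False
    then have "g z \<in> (\<lambda>P. a P z) ` Ps"
      unfolding g_def using fin Max_in[of "(\<lambda>P. a P z) ` Ps"] by (simp add: cSup_eq_Max)
    then obtain P0 where "P0 \<in> Ps \<and> a P0 z = g z" by auto
    then obtain P where P: "P \<in> Ps" "a P z = g z" and
      least: "\<And>P'. P' \<in> Ps \<Longrightarrow> to_nat P' < to_nat P \<Longrightarrow> a P' z \<noteq> g z"
      using ex_has_least_nat[of "\<lambda>P. P \<in> Ps \<and> a P z = g z" P0 to_nat] by (metis not_le)
    then have "sel P z" by (simp add: sel_def)
    moreover have "P' = P" if "sel P' z" for P'
    proof -
      have "\<not> to_nat P < to_nat P'" using that P unfolding sel_def by blast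
      moreover have "\<not> to_nat P' < to_nat P" using that least[of P'] unfolding sel_def by blast
      ultimately have "to_nat P' = to_nat P" by (simp only: not_less antisym)
      then show "P' = P" by simp
    qed
    ultimately have "sel P' z \<longleftrightarrow> P' = P" for P' by metis
    then have "G P' z = (if P' = P then g z else 0)" for P' by (simp add: G_def)
    then show ?thesis using fin P(1) by simp
  qed
  have a_le: "a P z \<le> ennreal K" for P z
    unfolding a_def B_def by (intro lavg_le vsm_le l \<rho>0 f_bd)
  have a_int: "(\<integral>\<^sup>+z. a P z \<partial>pl) < \<infinity>" for P
  proof -
    have "(\<integral>\<^sup>+z. a P z \<partial>pl) \<le> (\<integral>\<^sup>+z. vsm \<rho> f z \<partial>pl)"
      unfolding a_def B_def by (rule nn_integral_lavg_le[OF l]) measurable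
    also have "\<dots> = (\<integral>\<^sup>+z. f z \<partial>pl)" by (rule nn_integral_vsm[OF \<rho>0 f])
    finally show ?thesis using f_int by (rule le_less_trans)
  qed
  have g_le: "g z \<le> ennreal K" for z
    unfolding g_def by (intro SUP_least a_le)
  have G_a: "G P z \<le> a P z" for P z by (simp add: G_def sel_def)
  have g_int: "(\<integral>\<^sup>+z. g z \<partial>pl) < \<infinity>"
  proof -
    have "(\<integral>\<^sup>+z. g z \<partial>pl) = (\<Sum>P\<in>Ps. \<integral>\<^sup>+z. G P z \<partial>pl)"
      unfolding G_sum[symmetric] by (rule nn_integral_sum) measurable
    also have "\<dots> \<le> (\<Sum>P\<in>Ps. \<integral>\<^sup>+z. a P z \<partial>pl)" by (intro sum_mono nn_integral_mono G_a)
    also have "\<dots> < \<infinity>" using fin a_int by simp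
    finally show ?thesis .
  qed
  interpret tiles l w \<eta> v D \<rho> K Ps G
  proof
    show "G P z \<le> ennreal K" for P z using G_a a_le by (rule order_trans)
    show "(\<integral>\<^sup>+z. G P z \<partial>pl) < \<infinity>" for P
      by (rule le_less_trans[OF nn_integral_mono[OF G_a] a_int])
  qed (use \<rho> fin live in auto)
  define X where "X = (\<integral>\<^sup>+z. (g z)\<^sup>2 \<partial>pl)"
  define Y where "Y = (\<integral>\<^sup>+z. (f z)\<^sup>2 \<partial>pl)"
  have dual: "(\<integral>\<^sup>+z. G P z * a P z \<partial>pl) = (\<integral>\<^sup>+z. f z * \<phi> P z \<partial>pl)" for P
  proof -
    have "(\<integral>\<^sup>+z. G P z * a P z \<partial>pl) = (\<integral>\<^sup>+z. vsm \<rho> f z * B P (G P) z \<partial>pl)"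
      unfolding a_def B_def by (rule lavg_sym) measurable
    also have "\<dots> = (\<integral>\<^sup>+z. B P (G P) z * vsm \<rho> f z \<partial>pl)" by (simp only: mult.commute)
    also have "\<dots> = (\<integral>\<^sup>+z. f z * vsm \<rho> (B P (G P)) z \<partial>pl)"
      by (rule vsm_sym) measurable
    finally show ?thesis by (simp add: \<phi>_def)
  qed
  have "(g z)\<^sup>2 = (\<Sum>P\<in>Ps. G P z * a P z)" for z
  proof -
    have "(\<Sum>P\<in>Ps. G P z * a P z) = (\<Sum>P\<in>Ps. G P z * g z)"
      by (intro sum.cong refl) (simp add: G_def sel_def)
    then show ?thesis by (simp add: G_sum power2_eq_square flip: sum_distrib_right)
  qed
  then have "X = (\<Sum>P\<in>Ps. \<integral>\<^sup>+z. f z * \<phi> P z \<partial>pl)"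
    by (simp add: X_def nn_integral_sum dual)
  also have "\<dots> = (\<integral>\<^sup>+z. f z * h z \<partial>pl)"
    by (simp add: h_def sum_distrib_left nn_integral_sum)
  \<comment> \<open>The weight is dictated by \<open>h_bound\<close>: with \<open>M / 2\<close> the
    second term becomes at most half of \<open>X\<close>.\<close>
  also have "\<dots> \<le> (\<integral>\<^sup>+z. ennreal (M / 2) * (f z)\<^sup>2 + ennreal (1 / (4 * (M / 2))) * (h z)\<^sup>2 \<partial>pl)"
    using M by (intro nn_integral_mono ennreal_amgm) auto
  also have "\<dots> = ennreal (M / 2) * Y + ennreal (1 / (4 * (M / 2))) * (\<integral>\<^sup>+z. (h z)\<^sup>2 \<partial>pl)"
    unfolding Y_def by (subst nn_integral_add) (auto simp: nn_integral_cmult)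
  also have "\<dots> \<le> ennreal (M / 2) * Y + ennreal (1 / (4 * (M / 2))) * (ennreal M * X)"
    using h_bound unfolding G_sum by (intro add_left_mono mult_left_mono) (auto simp: M_def X_def)
  also have "ennreal (1 / (4 * (M / 2))) * (ennreal M * X) = ennreal (1 / (4 * (M / 2)) * M) * X"
    using M by (subst ennreal_mult') (auto simp: mult.assoc)
  also have "1 / (4 * (M / 2)) * M = 1 / 2" using M by simp
  finally have main: "X \<le> ennreal (M / 2) * Y + ennreal (1 / 2) * X" .
  have "X < \<infinity>"
  proof -
    have "X \<le> (\<integral>\<^sup>+z. ennreal K * g z \<partial>pl)"
      unfolding X_def power2_eq_square by (intro nn_integral_mono mult_right_mono g_le) auto
    also have "\<dots> = ennreal K * (\<integral>\<^sup>+z. g z \<partial>pl)" by (rule nn_integral_cmult) measurable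
    also have "\<dots> < \<infinity>" using g_int by (simp add: ennreal_mult_less_top)
    finally show ?thesis .
  qed
  then obtain x where x: "0 \<le> x" "X = ennreal x" by (cases X) auto
  have "X \<le> ennreal M * Y"
  proof (cases Y)
    case (real y)
    have "ennreal x \<le> ennreal (M / 2 * y + 1 / 2 * x)"
    proof -
      have nn: "0 \<le> M / 2" "(0::real) \<le> 1 / 2" "0 \<le> M / 2 * y" "0 \<le> 1 / 2 * x"
        using M real(1) x(1) by auto
      show ?thesis using main unfolding real(2) x(2)
        by (simp only: ennreal_plus[OF nn(3,4)] ennreal_mult'[OF nn(1)] ennreal_mult'[OF nn(2)])
    qed
    then have "x \<le> M / 2 * y + 1 / 2 * x" using M real(1) x(1) by (subst (asm) ennreal_le_iff) auto
    then have "x \<le> M * y" by simp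
    then show ?thesis using M real x by (simp add: ennreal_leI flip: ennreal_mult')
  next
    case top
    then show ?thesis using M by (simp add: ennreal_mult_top)
  qed
  then show ?thesis by (simp add: X_def Y_def M_def g_def a_def)
qed

section \<open>Monotone passage to all live tiles and arbitrary measurable functions\<close>

lemma ennreal_SUP_power2: "(SUP i\<in>I. g i)\<^sup>2 = (SUP i\<in>I. (g i)\<^sup>2)" for g :: "'i \<Rightarrow> ennreal"
proof (rule antisym)
  have "(SUP i\<in>I. g i)\<^sup>2 = (SUP i\<in>I. SUP j\<in>I. g i * g j)"
    by (simp add: power2_eq_square SUP_mult_left_ennreal SUP_mult_right_ennreal mult.commute)
  also have "\<dots> \<le> (SUP i\<in>I. (g i)\<^sup>2)"
  proof (intro SUP_least)
    fix i j assume ij: "i \<in> I" "j \<in> I"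
    define k where "k = (if g i \<le> g j then j else i)"
    have "g i * g j \<le> (g k)\<^sup>2"
      unfolding power2_eq_square k_def by (intro mult_mono) auto
    also have "\<dots> \<le> (SUP i\<in>I. (g i)\<^sup>2)" using ij by (intro SUP_upper) (auto simp: k_def)
    finally show "g i * g j \<le> (SUP i\<in>I. (g i)\<^sup>2)" .
  qed
  finally show "(SUP i\<in>I. g i)\<^sup>2 \<le> (SUP i\<in>I. (g i)\<^sup>2)" .
  show "(SUP i\<in>I. (g i)\<^sup>2) \<le> (SUP i\<in>I. g i)\<^sup>2"
    by (intro SUP_least power_mono SUP_upper) auto
qed

lemma vsm_SUP:
  fixes F :: "nat \<Rightarrow> real \<times> real \<Rightarrow> ennreal"
  assumes inc: "incseq F" and [measurable]: "\<And>k. F k \<in> borel_measurable (borel \<Otimes>\<^sub>M borel)"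
  shows "vsm \<rho> (\<lambda>z. SUP k. F k z) (a, b) = (SUP k. vsm \<rho> (F k) (a, b))"
proof -
  have "(\<integral>\<^sup>+t. (if \<bar>t\<bar> < \<rho> then SUP k. F k (a, b + t) else 0) \<partial>lborel)
    = (\<integral>\<^sup>+t. (SUP k. if \<bar>t\<bar> < \<rho> then F k (a, b + t) else 0) \<partial>lborel)"
    by (intro nn_integral_cong) simp
  also have "\<dots> = (SUP k. \<integral>\<^sup>+t. (if \<bar>t\<bar> < \<rho> then F k (a, b + t) else 0) \<partial>lborel)"
    using inc by (intro nn_integral_monotone_convergence_SUP) (auto simp: incseq_def le_fun_def)
  finally show ?thesis by (simp add: vsm_Pair SUP_mult_left_ennreal)
qed

lemma lavg_SUP:
  fixes F :: "nat \<Rightarrow> real \<times> real \<Rightarrow> ennreal"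
  assumes inc: "incseq F" and [measurable]: "\<And>k. F k \<in> borel_measurable (borel \<Otimes>\<^sub>M borel)"
  shows "lavg l n m s (\<lambda>z. SUP k. F k z) (a, b) = (SUP k. lavg l n m s (F k) (a, b))"
proof -
  have "(\<integral>\<^sup>+a'. (if cell l n a' = m then SUP k. F k (a', b + s * (a' - a)) else 0) \<partial>lborel)
    = (\<integral>\<^sup>+a'. (SUP k. if cell l n a' = m then F k (a', b + s * (a' - a)) else 0) \<partial>lborel)"
    by (intro nn_integral_cong) simp
  also have "\<dots> = (SUP k. \<integral>\<^sup>+a'. (if cell l n a' = m then F k (a', b + s * (a' - a)) else 0) \<partial>lborel)"
    using inc by (intro nn_integral_monotone_convergence_SUP) (auto simp: incseq_def le_fun_def)
  finally show ?thesis by (simp add: lavg_Pair SUP_mult_left_ennreal)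
qed

context slope_field
begin

definition live_tiles :: "(nat \<times> int \<times> int) set" where
  "live_tiles = {(n, m, j). live n m j}"

text \<open>The radius \<open>5 * w\<close> is the one that the comparison of strips with tiles
  requires.\<close>

definition tmax :: "(real \<times> real \<Rightarrow> ennreal) \<Rightarrow> real \<times> real \<Rightarrow> ennreal" where
  "tmax f z = (SUP P\<in>live_tiles. B P (vsm (5 * w) f) z)"

lemma tmax_measurable[measurable]:
  "f \<in> borel_measurable (borel \<Otimes>\<^sub>M borel) \<Longrightarrow> tmax f \<in> borel_measurable (borel \<Otimes>\<^sub>M borel)"
  unfolding tmax_def by measurable

theorem tmax_ineq:
  assumes f[measurable]: "f \<in> borel_measurable (borel \<Otimes>\<^sub>M borel)"
  shows "(\<integral>\<^sup>+z. (tmax f z)\<^sup>2 \<partial>pl)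
    \<le> ennreal ((12288 * (3 + ln D))\<^sup>2) * (\<integral>\<^sup>+z. (f z)\<^sup>2 \<partial>pl)"
proof -
  let ?M = "ennreal ((12288 * (3 + ln D))\<^sup>2)"
  \<comment> \<open>Truncation in size and in support, increasing with \<open>k\<close>. Together
    with the finitely many tiles of code below \<open>k\<close> it meets the hypotheses of
    \<open>tile_maximal_ineq\<close>.\<close>
  define F where "F k z = (if \<bar>fst z\<bar> \<le> real k \<and> \<bar>snd z\<bar> \<le> real k then min (f z) (ennreal (real k)) else 0)"
    for k :: nat and z
  define Q where "Q k = {P \<in> live_tiles. to_nat P < k}" for k
  define g where "g k z = (SUP P\<in>Q k. B P (vsm (5 * w) (F k)) z)" for k z
  have F_meas[measurable]: "F k \<in> borel_measurable (borel \<Otimes>\<^sub>M borel)" for k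
    unfolding F_def by measurable
  have g_meas[measurable]: "g k \<in> borel_measurable (borel \<Otimes>\<^sub>M borel)" for k
    unfolding g_def by measurable
  have F_le: "F k z \<le> f z" for k z by (simp add: F_def)
  have F_inc: "incseq F"
    by (auto simp: incseq_def le_fun_def F_def min.coboundedI2 ennreal_leI intro: min.coboundedI1)
  have F_sup: "(SUP k. F k z) = f z" for z
  proof (rule antisym)
    show "f z \<le> (SUP k. F k z)"
    proof (rule dense_le)
      fix t assume t: "t < f z"
      then have "t < top" using less_le_trans top_greatest by blast
      then obtain r where r: "0 \<le> r" "t = ennreal r" by (cases t) auto
      obtain k :: nat where k: "max r (max \<bar>fst z\<bar> \<bar>snd z\<bar>) \<le> real k" using real_arch_simple by blast
      then have "t \<le> F k z" using t r by (auto simp: F_def ennreal_leI)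
      then show "t \<le> (SUP k. F k z)" by (rule SUP_upper2[OF UNIV_I])
    qed
  qed (intro SUP_least F_le)
  have Q_fin: "finite (Q k)" for k
  proof (rule finite_subset)
    show "Q k \<subseteq> from_nat ` {..<k}"
    proof
      fix P assume "P \<in> Q k"
      then show "P \<in> from_nat ` {..<k}" by (intro image_eqI[of _ _ "to_nat P"]) (auto simp: Q_def)
    qed
  qed auto
  have V_inc: "incseq (\<lambda>k. vsm (5 * w) (F k))"
    using F_inc by (auto simp: incseq_def le_fun_def intro!: vsm_mono)
  have B_sup: "B P (vsm (5 * w) f) z = (SUP k. B P (vsm (5 * w) (F k)) z)" for P z
  proof -
    have "vsm (5 * w) f = (\<lambda>z. SUP k. vsm (5 * w) (F k) z)"
      using vsm_SUP[OF F_inc F_meas] by (auto simp: F_sup)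
    then show ?thesis unfolding B_def using lavg_SUP[OF V_inc] by (cases z) simp
  qed
  have g_inc: "incseq (\<lambda>k z. (g k z)\<^sup>2)"
  proof -
    have "g k z \<le> g k' z" if "k \<le> k'" for k k' z
      unfolding g_def
    proof (rule SUP_mono)
      fix P assume "P \<in> Q k"
      moreover have "B P (vsm (5 * w) (F k)) z \<le> B P (vsm (5 * w) (F k')) z"
        unfolding B_def using V_inc that by (intro lavg_mono) (auto simp: incseq_def le_fun_def)
      ultimately show "\<exists>P'\<in>Q k'. B P (vsm (5 * w) (F k)) z \<le> B P' (vsm (5 * w) (F k')) z"
        using that by (intro bexI[of _ P]) (simp_all add: Q_def)
    qed
    then show ?thesis by (auto simp: incseq_def le_fun_def intro!: power_mono)
  qed
  have tmax_le: "tmax f z \<le> (SUP k. g k z)" for z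
    unfolding tmax_def B_sup
  proof (intro SUP_least)
    fix P k assume P: "P \<in> live_tiles"
    define k' where "k' = max k (Suc (to_nat P))"
    have "B P (vsm (5 * w) (F k)) z \<le> B P (vsm (5 * w) (F k')) z"
      unfolding B_def using V_inc by (intro lavg_mono) (auto simp: incseq_def le_fun_def k'_def)
    also have "\<dots> \<le> g k' z" unfolding g_def using P by (intro SUP_upper) (simp add: Q_def k'_def less_max_iff_disj)
    also have "\<dots> \<le> (SUP k. g k z)" by (rule SUP_upper) simp
    finally show "B P (vsm (5 * w) (F k)) z \<le> (SUP k. g k z)" .
  qed
  have bound: "(\<integral>\<^sup>+z. (g k z)\<^sup>2 \<partial>pl) \<le> ?M * (\<integral>\<^sup>+z. (f z)\<^sup>2 \<partial>pl)" for k
  proof -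
    have "(\<integral>\<^sup>+z. (g k z)\<^sup>2 \<partial>pl) \<le> ?M * (\<integral>\<^sup>+z. (F k z)\<^sup>2 \<partial>pl)"
      unfolding g_def
    proof (rule tile_maximal_ineq)
      show "F k z \<le> ennreal (real k)" for z by (simp add: F_def)
      have "(\<integral>\<^sup>+z. F k z \<partial>pl) \<le> (\<integral>\<^sup>+z. ennreal (real k) * indicator ({-real k..real k} \<times> {-real k..real k}) z \<partial>pl)"
        by (intro nn_integral_mono) (auto simp: F_def indicator_def)
      also have "\<dots> = ennreal (real k) * emeasure pl ({-real k..real k} \<times> {-real k..real k})"
        by (rule nn_integral_cmult_indicator) measurable
      also have "\<dots> = ennreal (real k) * (ennreal (2 * real k) * ennreal (2 * real k))"
        by (subst lborel.emeasure_pair_measure_Times) auto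
      also have "\<dots> < \<infinity>" by (simp add: ennreal_mult_less_top)
      finally show "(\<integral>\<^sup>+z. F k z \<partial>pl) < \<infinity>" .
    qed (use w Q_fin in \<open>auto simp: Q_def live_tiles_def\<close>)
    also have "\<dots> \<le> ?M * (\<integral>\<^sup>+z. (f z)\<^sup>2 \<partial>pl)"
      by (intro mult_left_mono nn_integral_mono power_mono F_le) auto
    finally show ?thesis .
  qed
  have "(\<integral>\<^sup>+z. (tmax f z)\<^sup>2 \<partial>pl) \<le> (\<integral>\<^sup>+z. (SUP k. (g k z)\<^sup>2) \<partial>pl)"
    unfolding ennreal_SUP_power2[symmetric] by (intro nn_integral_mono power_mono tmax_le) auto
  also have "\<dots> = (SUP k. \<integral>\<^sup>+z. (g k z)\<^sup>2 \<partial>pl)"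
    by (rule nn_integral_monotone_convergence_SUP[OF g_inc]) measurable
  also have "\<dots> \<le> ?M * (\<integral>\<^sup>+z. (f z)\<^sup>2 \<partial>pl)" by (intro SUP_least bound)
  finally show ?thesis .
qed

end

section \<open>From rectangles to tiles\<close>

text \<open>A sheared box with half-length \<open>L\<close> and half-height \<open>w\<close>: its
  vertical fibres have constant length, unlike those of a rotated rectangle.\<close>

definition strip :: "real \<Rightarrow> real \<Rightarrow> real \<Rightarrow> real \<Rightarrow> real \<Rightarrow> (real \<times> real) set" where
  "strip c d \<sigma> L w = {(a, b). \<bar>a - c\<bar> < L \<and> \<bar>b - d - \<sigma> * (a - c)\<bar> < w}"

lemma strip_measurable[measurable]: "Measurable.pred (borel \<Otimes>\<^sub>M borel) (\<lambda>z. z \<in> strip c d \<sigma> L w)"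
  unfolding strip_def by measurable

lemma (in slope_field) strip_le_tmax:
  assumes L: "w \<le> L" "6 * L \<le> len n" "len n \<le> 12 * L"
    and inside: "\<And>a. \<bar>a - c\<bar> < L \<Longrightarrow> cell l n a = m"
    and dens: "13 * (\<eta> * len n) \<le> measure lborel {a. \<bar>a - c\<bar> < L \<and> \<bar>v a - \<sigma>\<bar> \<le> w / (2 * L)}"
    and z: "z \<in> strip c d \<sigma> L w"
    and f[measurable]: "f \<in> borel_measurable (borel \<Otimes>\<^sub>M borel)"
  shows "(\<integral>\<^sup>+z'. (if z' \<in> strip c d \<sigma> L w then f z' else 0) \<partial>pl)
    \<le> ennreal (120 * L * w) * tmax f z"
proof -
  define A where "A = {a. \<bar>a - c\<bar> < L \<and> \<bar>v a - \<sigma>\<bar> \<le> w / (2 * L)}"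
  define u where "u = (\<sigma> - w / (2 * L)) * (len n / w)"
  define J where "J = {\<lfloor>u\<rfloor>..\<lfloor>u\<rfloor> + 12}"
  have pos: "0 < len n" "0 < L" using len_pos w L(1) by auto
  have slc: "slc n s = \<lfloor>s * (len n / w)\<rfloor>" for s by (simp add: slc_def len_def field_simps)
  have cover: "slc n (v a) \<in> J" if "a \<in> A" for a
  proof -
    have va: "\<sigma> - w / (2 * L) \<le> v a" "v a \<le> (\<sigma> - w / (2 * L)) + w / L"
      using that by (auto simp: A_def abs_le_iff field_simps)
    have "u \<le> v a * (len n / w)"
      unfolding u_def using pos w va by (intro mult_right_mono) auto
    moreover have "v a * (len n / w) \<le> ((\<sigma> - w / (2 * L)) + w / L) * (len n / w)"
      using pos w va by (intro mult_right_mono) auto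
    moreover have "\<dots> = u + len n / L" unfolding u_def by (subst distrib_right) (use w in simp)
    moreover have "len n / L \<le> 12" using pos L by (simp add: field_simps)
    ultimately have "u \<le> v a * (len n / w)" "v a * (len n / w) \<le> u + 12" by linarith+
    then show ?thesis unfolding J_def slc by (auto intro: floor_mono dest: floor_mono)
  qed
  have A_sub: "A \<subseteq> (\<Union>j\<in>J. {a. cell l n a = m \<and> slc n (v a) = j})"
    using cover inside by (auto simp: A_def)
  have cell_fm: "{a. cell l n a = m \<and> slc n (v a) = j} \<in> fmeasurable lborel" for j
  proof (rule fmeasurableI)
    show "{a. cell l n a = m \<and> slc n (v a) = j} \<in> sets lborel" by measurable
    have "emeasure lborel {a. cell l n a = m \<and> slc n (v a) = j} \<le> emeasure lborel {a. cell l n a = m}"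
      by (intro emeasure_mono) auto
    also have "\<dots> < \<infinity>" using emeasure_cell[OF l] by simp
    finally show "emeasure lborel {a. cell l n a = m \<and> slc n (v a) = j} < \<infinity>" .
  qed
  have "\<exists>j\<in>J. live n m j"
  proof (rule ccontr)
    assume neg: "\<not> (\<exists>j\<in>J. live n m j)"
    have "measure lborel A \<le> measure lborel (\<Union>j\<in>J. {a. cell l n a = m \<and> slc n (v a) = j})"
      by (rule measure_mono_fmeasurable[OF A_sub])
        (unfold A_def, measurable, intro fmeasurable.finite_UN, auto simp: J_def cell_fm)
    also have "\<dots> \<le> (\<Sum>j\<in>J. measure lborel {a. cell l n a = m \<and> slc n (v a) = j})"
      using cell_fm by (intro measure_UNION_le) (auto simp: J_def fmeasurable_def)
    also have "\<dots> < (\<Sum>j\<in>J. \<eta> * len n)"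
      using neg by (intro sum_strict_mono) (auto simp: J_def live_def cmeas_def not_le)
    also have "\<dots> = 13 * (\<eta> * len n)" by (simp add: J_def)
    finally show False using dens by (simp add: A_def)
  qed
  then obtain j where j: "j \<in> J" "live n m j" by blast
  define s where "s = sp n j"
  \<comment> \<open>In units of \<open>w / len n\<close>, \<open>\<sigma>\<close> lies between 3 and
    6 above the lower end \<open>u\<close>, and \<open>j\<close> between \<open>u - 1\<close> and
    \<open>u + 12\<close>; so they differ by at most 9 units.\<close>
  have s_near: "\<bar>\<sigma> - s\<bar> * (2 * L) \<le> 3 * w"
  proof -
    have "\<lfloor>u\<rfloor> \<le> j" "j \<le> \<lfloor>u\<rfloor> + 12" using j by (auto simp: J_def)
    then have ju: "u - 1 \<le> of_int j" "of_int j \<le> u + 12" by linarith+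
    have q: "3 \<le> len n / (2 * L)" "len n / (2 * L) \<le> 6" using pos L by (simp_all add: field_simps)
    have "u = \<sigma> * (len n / w) - len n / (2 * L)" unfolding u_def by (subst left_diff_distrib) (use w in simp)
    then have "\<bar>\<sigma> * (len n / w) - of_int j\<bar> \<le> 9" using ju q by linarith
    moreover have "\<sigma> * (len n / w) - of_int j = (\<sigma> - s) * (len n / w)"
      using pos w by (simp add: s_def sp_def field_simps)
    ultimately have "\<bar>\<sigma> - s\<bar> * (len n / w) \<le> 9" using pos w by (simp add: abs_mult)
    then have le: "\<bar>\<sigma> - s\<bar> * len n \<le> 9 * w" using w by (simp add: field_simps)
    have "\<bar>\<sigma> - s\<bar> * (6 * L) \<le> \<bar>\<sigma> - s\<bar> * len n" using L by (intro mult_left_mono) auto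
    then show ?thesis using le by (simp add: mult_ac)
  qed
  obtain a b where ab: "z = (a, b)" by (cases z)
  then have za: "\<bar>a - c\<bar> < L" "\<bar>b - d - \<sigma> * (a - c)\<bar> < w" using z by (auto simp: strip_def)
  define W where "W a' = (\<integral>\<^sup>+t. (if \<bar>t\<bar> < 5 * w then f (a', b + s * (a' - a) + t) else 0) \<partial>lborel)" for a'
  have W_meas[measurable]: "W \<in> borel_measurable borel" unfolding W_def by measurable
  have inner: "(\<integral>\<^sup>+b'. (if (a', b') \<in> strip c d \<sigma> L w then f (a', b') else 0) \<partial>lborel)
      \<le> (if cell l n a' = m then W a' else 0)" for a'
  proof (cases "\<bar>a' - c\<bar> < L")
    case True
    have "(\<integral>\<^sup>+b'. (if (a', b') \<in> strip c d \<sigma> L w then f (a', b') else 0) \<partial>lborel)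
      \<le> (\<integral>\<^sup>+b'. (if \<bar>b' - (b + s * (a' - a))\<bar> < 5 * w then f (a', b') else 0) \<partial>lborel)"
    proof (intro nn_integral_mono)
      fix b'
      have "\<bar>b' - (b + s * (a' - a))\<bar> < 5 * w" if "(a', b') \<in> strip c d \<sigma> L w"
      proof -
        have b': "\<bar>b' - d - \<sigma> * (a' - c)\<bar> < w" using that by (simp add: strip_def)
        have "\<bar>(\<sigma> - s) * (a' - a)\<bar> \<le> \<bar>\<sigma> - s\<bar> * (2 * L)"
          unfolding abs_mult using True za by (intro mult_left_mono) auto
        then have d: "\<bar>(\<sigma> - s) * (a' - a)\<bar> \<le> 3 * w" using s_near by linarith
        have "b' - (b + s * (a' - a)) = (b' - d - \<sigma> * (a' - c)) - (b - d - \<sigma> * (a - c)) + (\<sigma> - s) * (a' - a)"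
          by (simp add: algebra_simps)
        then show ?thesis using b' za(2) d by linarith
      qed
      then show "(if (a', b') \<in> strip c d \<sigma> L w then f (a', b') else 0)
        \<le> (if \<bar>b' - (b + s * (a' - a))\<bar> < 5 * w then f (a', b') else 0)" by auto
    qed
    also have "\<dots> = W a'"
      unfolding W_def
      using nn_integral_shift[of "\<lambda>b'. if \<bar>b' - (b + s * (a' - a))\<bar> < 5 * w then f (a', b') else 0" "b + s * (a' - a)"]
      by (simp add: add.commute add.left_commute cong: if_cong)
    finally show ?thesis using inside[OF True] by simp
  qed (simp add: strip_def)
  define X where "X = (\<integral>\<^sup>+a'. (if cell l n a' = m then W a' else 0) \<partial>lborel)"
  have "(\<integral>\<^sup>+z'. (if z' \<in> strip c d \<sigma> L w then f z' else 0) \<partial>pl) \<le> X"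
    unfolding X_def by (subst nn_integral_plane) (auto intro!: nn_integral_mono inner)
  also have "X = ennreal (len n * (10 * w)) * B (n, m, j) (vsm (5 * w) f) (a, b)"
  proof -
    have "B (n, m, j) (vsm (5 * w) f) (a, b)
      = ennreal (2 ^ n / l) * (\<integral>\<^sup>+a'. ennreal (1 / (10 * w)) * (if cell l n a' = m then W a' else 0) \<partial>lborel)"
      using inside[OF za(1)]
      by (simp add: B_def lavg_Pair depth_def pos_def slope_def s_def[symmetric] vsm_Pair W_def if_distrib cong: if_cong)
    also have "\<dots> = ennreal (1 / len n) * (ennreal (1 / (10 * w)) * X)"
      unfolding X_def by (subst nn_integral_cmult) (auto simp: len_def)
    also have "\<dots> = ennreal (1 / len n * (1 / (10 * w))) * X"
      using pos by (simp only: ennreal_mult' divide_nonneg_pos zero_le_one mult.assoc)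
    finally have "ennreal (len n * (10 * w)) * B (n, m, j) (vsm (5 * w) f) (a, b)
      = ennreal (len n * (10 * w) * (1 / len n * (1 / (10 * w)))) * X"
      using pos w by (simp only: ennreal_mult' mult_nonneg_nonneg less_imp_le mult.assoc)
    then show ?thesis using pos w by simp
  qed
  also have "\<dots> \<le> ennreal (120 * L * w) * tmax f z"
  proof (rule mult_mono)
    show "B (n, m, j) (vsm (5 * w) f) (a, b) \<le> tmax f z"
      unfolding tmax_def ab using j by (intro SUP_upper) (simp add: live_tiles_def)
    have "len n * (10 * w) \<le> 12 * L * (10 * w)" using L w by (intro mult_right_mono) auto
    then show "ennreal (len n * (10 * w)) \<le> ennreal (120 * L * w)" by (intro ennreal_leI) simp
  qed auto
  finally show ?thesis .
qed

lemma nn_integral_plane_shift: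
  fixes F :: "real \<times> real \<Rightarrow> ennreal"
  assumes [measurable]: "F \<in> borel_measurable (borel \<Otimes>\<^sub>M borel)"
  shows "(\<integral>\<^sup>+z. F (fst z + t, snd z) \<partial>pl) = (\<integral>\<^sup>+z. F z \<partial>pl)"
  by (simp add: nn_integral_plane nn_integral_shift[of "\<lambda>a. \<integral>\<^sup>+b. F (a, b) \<partial>lborel"])

lemma dyadic_between:
  fixes x :: real
  assumes "1 \<le> x"
  obtains n :: nat where "2 ^ n \<le> x" "x < 2 ^ Suc n"
proof -
  obtain N :: nat where "x < 2 ^ N" using real_arch_pow[of 2 x] by auto
  then have ex: "\<exists>N. x < 2 ^ N" by blast
  define N where "N = (LEAST N. x < 2 ^ N)"
  have N: "x < 2 ^ N" unfolding N_def using ex by (rule LeastI_ex)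
  then have "N \<noteq> 0" using assms by (intro notI) simp
  then obtain n where n: "N = Suc n" by (cases N) auto
  have "\<not> x < 2 ^ n" using not_less_Least[of n "\<lambda>N. x < 2 ^ N"] n by (simp add: N_def)
  then show ?thesis using that[of n] N n by simp
qed

text \<open>The translated grid is realised by translating \<open>v\<close> and \<open>f\<close>
  instead, so that the results for the unshifted grid apply as they stand.\<close>

definition shifted_tmax ::
  "real \<Rightarrow> real \<Rightarrow> real \<Rightarrow> (real \<Rightarrow> real) \<Rightarrow> (real \<times> real \<Rightarrow> ennreal) \<Rightarrow> real \<Rightarrow> real \<times> real \<Rightarrow> ennreal" where
  "shifted_tmax l w \<eta> v f s z = slope_field.tmax l w \<eta> (\<lambda>a. v (a - s)) (\<lambda>z. f (fst z - s, snd z)) (fst z + s, snd z)"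

lemma slope_field_shift:
  assumes "slope_field l w \<eta> v D" shows "slope_field l w \<eta> (\<lambda>a. v (a - s)) D"
  using assms by (auto simp: slope_field_def)

lemma shifted_tmax_measurable:
  assumes "slope_field l w \<eta> v D" and [measurable]: "f \<in> borel_measurable (borel \<Otimes>\<^sub>M borel)"
  shows "shifted_tmax l w \<eta> v f s \<in> borel_measurable (borel \<Otimes>\<^sub>M borel)"
proof -
  interpret slope_field l w \<eta> "\<lambda>a. v (a - s)" D by (rule slope_field_shift) fact
  show ?thesis unfolding shifted_tmax_def by measurable
qed

lemma shifted_tmax_ineq:
  assumes "slope_field l w \<eta> v D" and [measurable]: "f \<in> borel_measurable (borel \<Otimes>\<^sub>M borel)"
  shows "(\<integral>\<^sup>+z. (shifted_tmax l w \<eta> v f s z)\<^sup>2 \<partial>pl)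
    \<le> ennreal ((12288 * (3 + ln D))\<^sup>2) * (\<integral>\<^sup>+z. (f z)\<^sup>2 \<partial>pl)"
proof -
  interpret slope_field l w \<eta> "\<lambda>a. v (a - s)" D by (rule slope_field_shift) fact
  let ?g = "\<lambda>z. f (fst z - s, snd z)"
  have "(\<integral>\<^sup>+z. (shifted_tmax l w \<eta> v f s z)\<^sup>2 \<partial>pl)
    = (\<integral>\<^sup>+z. (tmax ?g z)\<^sup>2 \<partial>pl)"
    unfolding shifted_tmax_def using nn_integral_plane_shift[of "\<lambda>z. (tmax ?g z)\<^sup>2" s] by simp
  also have "\<dots> \<le> ennreal ((12288 * (3 + ln D))\<^sup>2) * (\<integral>\<^sup>+z. (?g z)\<^sup>2 \<partial>pl)"
    by (rule tmax_ineq) measurable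
  also have "(\<integral>\<^sup>+z. (?g z)\<^sup>2 \<partial>pl) = (\<integral>\<^sup>+z. (f z)\<^sup>2 \<partial>pl)"
    using nn_integral_plane_shift[of "\<lambda>z. (f z)\<^sup>2" "- s"] by simp
  finally show ?thesis .
qed

text \<open>The one-third trick selects the grid in which the base of the strip fits a single cell.
  That cell is at most \<open>12 * L\<close> long and 13 slope cells compete for the density, whence
  156.\<close>

lemma strip_le_shifted_tmax:
  assumes sf: "slope_field l w \<eta> v D" and L: "w \<le> L" "6 * L \<le> l"
    and dens: "156 * \<eta> * L \<le> measure lborel {a. \<bar>a - c\<bar> < L \<and> \<bar>v a - \<sigma>\<bar> \<le> w / (2 * L)}"
    and z: "z \<in> strip c d \<sigma> L w"
    and f[measurable]: "f \<in> borel_measurable (borel \<Otimes>\<^sub>M borel)"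
  shows "(\<integral>\<^sup>+z'. (if z' \<in> strip c d \<sigma> L w then f z' else 0) \<partial>pl)
    \<le> ennreal (120 * L * w) * (shifted_tmax l w \<eta> v f 0 z + shifted_tmax l w \<eta> v f (l / 3) z)"
proof -
  have l: "0 < l" and w: "0 < w" and \<eta>: "0 < \<eta>" and v[measurable]: "v \<in> borel_measurable borel"
    using sf by (auto simp: slope_field_def)
  have L0: "0 < L" using w L by linarith
  have "1 \<le> l / (6 * L)" using L0 L by simp
  then obtain n :: nat where "2 ^ n \<le> l / (6 * L)" "l / (6 * L) < 2 ^ Suc n" by (rule dyadic_between)
  then have n: "6 * L \<le> l / 2 ^ n" "l / 2 ^ n \<le> 12 * L" using L0 by (simp_all add: field_simps)
  obtain s where s: "s = 0 \<or> s = l / 3"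
    and cells: "\<And>x y. \<bar>x - c\<bar> < L \<Longrightarrow> \<bar>y - c\<bar> < L \<Longrightarrow> cell l n (x + s) = cell l n (y + s)"
    using one_third_trick[OF l less_imp_le[OF L0] n(1), of c] by blast
  interpret slope_field l w \<eta> "\<lambda>a. v (a - s)" D by (rule slope_field_shift[OF sf])
  let ?g = "\<lambda>z. f (fst z - s, snd z)"
  have shift_strip: "(a + s, b) \<in> strip (c + s) d \<sigma> L w \<longleftrightarrow> (a, b) \<in> strip c d \<sigma> L w" for a b
    by (simp add: strip_def)
  have "(\<integral>\<^sup>+z'. (if z' \<in> strip c d \<sigma> L w then f z' else 0) \<partial>pl)
    = (\<integral>\<^sup>+z'. (if z' \<in> strip (c + s) d \<sigma> L w then ?g z' else 0) \<partial>pl)"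
    using nn_integral_plane_shift[of "\<lambda>z'. if z' \<in> strip (c + s) d \<sigma> L w then ?g z' else 0" s]
    by (simp add: shift_strip cong: if_cong)
  also have "\<dots> \<le> ennreal (120 * L * w) * tmax ?g (fst z + s, snd z)"
  proof (rule strip_le_tmax[where n = n and m = "cell l n (c + s)"])
    show "cell l n a = cell l n (c + s)" if "\<bar>a - (c + s)\<bar> < L" for a
      using cells[of "a - s" c] that L0 by (simp add: algebra_simps)
    have "(\<integral>\<^sup>+a. indicator {a. \<bar>a - (c + s)\<bar> < L \<and> \<bar>v (a - s) - \<sigma>\<bar> \<le> w / (2 * L)} (a + s) \<partial>lborel)
      = (\<integral>\<^sup>+a. indicator {a. \<bar>a - (c + s)\<bar> < L \<and> \<bar>v (a - s) - \<sigma>\<bar> \<le> w / (2 * L)} a \<partial>lborel)"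
      by (rule nn_integral_shift) measurable
    moreover have "indicator {a. \<bar>a - (c + s)\<bar> < L \<and> \<bar>v (a - s) - \<sigma>\<bar> \<le> w / (2 * L)} (a + s)
        = (indicator {a. \<bar>a - c\<bar> < L \<and> \<bar>v a - \<sigma>\<bar> \<le> w / (2 * L)} a :: ennreal)" for a
      by (simp add: indicator_def)
    ultimately have "emeasure lborel {a. \<bar>a - c\<bar> < L \<and> \<bar>v a - \<sigma>\<bar> \<le> w / (2 * L)}
      = emeasure lborel {a. \<bar>a - (c + s)\<bar> < L \<and> \<bar>v (a - s) - \<sigma>\<bar> \<le> w / (2 * L)}"
      by simp
    moreover have "\<eta> * len n \<le> \<eta> * (12 * L)"
      using n \<eta> by (intro mult_left_mono) (auto simp: len_def)
    then have "13 * (\<eta> * len n) \<le> 156 * \<eta> * L" by (simp add: mult_ac)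
    ultimately show "13 * (\<eta> * len n)
      \<le> measure lborel {a. \<bar>a - (c + s)\<bar> < L \<and> \<bar>v (a - s) - \<sigma>\<bar> \<le> w / (2 * L)}"
      using dens unfolding measure_def by (simp only:)
    show "(fst z + s, snd z) \<in> strip (c + s) d \<sigma> L w" using z by (simp add: shift_strip)
  qed (use L n in \<open>simp_all add: len_def\<close>)
  also have "tmax ?g (fst z + s, snd z) = shifted_tmax l w \<eta> v f s z" by (simp add: shifted_tmax_def)
  also have "ennreal (120 * L * w) * \<dots> \<le> ennreal (120 * L * w) * (shifted_tmax l w \<eta> v f 0 z + shifted_tmax l w \<eta> v f (l / 3) z)"
    using s by (intro mult_left_mono) (auto intro: add_increasing add_increasing2)
  finally show ?thesis .
qed

section \<open>Rotated rectangles against sheared strips\<close>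

lemma mem_rect_set:
  "p \<in> rect_set (c, \<phi>, L, w) \<longleftrightarrow>
    \<bar>(fst p - fst c) * cos \<phi> + (snd p - snd c) * sin \<phi>\<bar> < L / 2 \<and>
    \<bar>(snd p - snd c) * cos \<phi> - (fst p - fst c) * sin \<phi>\<bar> < w / 2"
  by (cases p; cases c) (simp add: rect_set_def)

lemma rect_set_borel[measurable]: "rect_set R \<in> sets (borel \<Otimes>\<^sub>M borel)"
proof -
  obtain c \<phi> L w where R: "R = (c, \<phi>, L, w)" by (cases R)
  have "{p \<in> space (borel \<Otimes>\<^sub>M borel). p \<in> rect_set R} \<in> sets (borel \<Otimes>\<^sub>M borel)"
    unfolding R mem_rect_set by measurable
  then show ?thesis by (simp add: space_pair_measure)
qed

lemma rect_subset_strip: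
  assumes C: "1 / 2 \<le> \<bar>cos \<phi>\<bar>" and L: "w \<le> L"
  shows "rect_set (c, \<phi>, L, w) \<subseteq> strip (fst c) (snd c) (tan \<phi>) L w"
proof
  fix p assume p: "p \<in> rect_set (c, \<phi>, L, w)"
  define x where "x = fst p - fst c"
  define y where "y = snd p - snd c"
  define s where "s = x * cos \<phi> + y * sin \<phi>"
  define t where "t = y * cos \<phi> - x * sin \<phi>"
  have st: "\<bar>s\<bar> < L / 2" "\<bar>t\<bar> < w / 2"
    using p by (auto simp: mem_rect_set s_def t_def x_def y_def)
  have "s * cos \<phi> - t * sin \<phi> = x * ((cos \<phi>)\<^sup>2 + (sin \<phi>)\<^sup>2)"
    unfolding s_def t_def by algebra
  then have "x = s * cos \<phi> - t * sin \<phi>" by simp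
  moreover have "\<bar>s * cos \<phi>\<bar> \<le> \<bar>s\<bar>" "\<bar>t * sin \<phi>\<bar> \<le> \<bar>t\<bar>"
    by (simp_all add: abs_mult mult_left_le)
  ultimately have x: "\<bar>x\<bar> < L" using st L by linarith
  have c0: "cos \<phi> \<noteq> 0" using C by auto
  then have "(y - tan \<phi> * x) * cos \<phi> = t" by (simp add: t_def tan_def field_simps)
  then have "\<bar>y - tan \<phi> * x\<bar> * \<bar>cos \<phi>\<bar> = \<bar>t\<bar>" by (metis abs_mult)
  moreover have "\<bar>y - tan \<phi> * x\<bar> * (1 / 2) \<le> \<bar>y - tan \<phi> * x\<bar> * \<bar>cos \<phi>\<bar>"
    using C by (intro mult_left_mono) auto
  ultimately have "\<bar>y - tan \<phi> * x\<bar> * (1 / 2) < w / 2" using st by (metis le_less_trans)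
  then have "\<bar>y - tan \<phi> * x\<bar> < w" by simp
  then show "p \<in> strip (fst c) (snd c) (tan \<phi>) L w"
    using x by (cases p) (simp add: strip_def x_def y_def)
qed

text \<open>The inner strip has area \<open>L * w / 8\<close>, a lower bound for the area of the
  rectangle that avoids computing it.\<close>

lemma strip_subset_rect:
  assumes C: "1 / 2 \<le> \<bar>cos \<phi>\<bar>" and L: "0 < w" "w \<le> L"
  shows "strip (fst c) (snd c) (tan \<phi>) (L / 8) (w / 4) \<subseteq> rect_set (c, \<phi>, L, w)"
proof
  fix p assume p: "p \<in> strip (fst c) (snd c) (tan \<phi>) (L / 8) (w / 4)"
  define x where "x = fst p - fst c"
  define y where "y = snd p - snd c"
  define e where "e = y - tan \<phi> * x"
  have xe: "\<bar>x\<bar> < L / 8" "\<bar>e\<bar> < w / 4"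
    using p by (cases p; auto simp: strip_def x_def y_def e_def)+
  have c0: "cos \<phi> \<noteq> 0" using C by auto
  have y: "y = x * sin \<phi> / cos \<phi> + e" by (simp add: e_def tan_def)
  have "x * (cos \<phi> * cos \<phi>) + x * (sin \<phi> * sin \<phi>) = x * ((cos \<phi>)\<^sup>2 + (sin \<phi>)\<^sup>2)"
    by algebra
  then have "x * (cos \<phi> * cos \<phi>) + x * (sin \<phi> * sin \<phi>) = x" by simp
  then have s: "x * cos \<phi> + y * sin \<phi> = x / cos \<phi> + e * sin \<phi>"
    unfolding y using c0 by (simp add: field_simps)
  have t: "y * cos \<phi> - x * sin \<phi> = e * cos \<phi>" unfolding y using c0 by (simp add: field_simps)
  have "\<bar>x\<bar> * 1 \<le> \<bar>x\<bar> * (2 * \<bar>cos \<phi>\<bar>)" using C by (intro mult_left_mono) auto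
  then have "\<bar>x / cos \<phi>\<bar> \<le> 2 * \<bar>x\<bar>" using c0 by (simp add: abs_divide field_simps)
  moreover have "\<bar>e * sin \<phi>\<bar> \<le> \<bar>e\<bar>" "\<bar>e * cos \<phi>\<bar> \<le> \<bar>e\<bar>"
    by (simp_all add: abs_mult mult_left_le)
  ultimately have "\<bar>x / cos \<phi> + e * sin \<phi>\<bar> < L / 2" "\<bar>e * cos \<phi>\<bar> < w / 2"
    using xe L by linarith+
  then show "p \<in> rect_set (c, \<phi>, L, w)"
    unfolding mem_rect_set x_def[symmetric] y_def[symmetric] s t by simp
qed

lemma emeasure_graph_band:
  fixes Q :: "real \<Rightarrow> bool" and g :: "real \<Rightarrow> real"
  assumes [measurable]: "Measurable.pred borel Q" "g \<in> borel_measurable borel" and q: "0 < q"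
  shows "emeasure pl {z. Q (fst z) \<and> \<bar>snd z - g (fst z)\<bar> < q}
    = emeasure lborel {a. Q a} * ennreal (2 * q)"
proof -
  let ?S = "{z. Q (fst z) \<and> \<bar>snd z - g (fst z)\<bar> < q}"
  have [measurable]: "?S \<in> sets (borel \<Otimes>\<^sub>M borel)"
  proof -
    have "{z \<in> space (borel \<Otimes>\<^sub>M borel). Q (fst z) \<and> \<bar>snd z - g (fst z)\<bar> < q} \<in> sets (borel \<Otimes>\<^sub>M borel)"
      by measurable
    then show ?thesis by (simp add: space_pair_measure)
  qed
  have "emeasure pl ?S = (\<integral>\<^sup>+z. indicator ?S z \<partial>pl)"
    by (intro nn_integral_indicator[symmetric]) (simp cong: sets_pair_measure_cong)
  also have "\<dots> = (\<integral>\<^sup>+a. \<integral>\<^sup>+b. indicator ?S (a, b) \<partial>lborel \<partial>lborel)"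
    by (rule nn_integral_plane) measurable
  also have "\<dots> = (\<integral>\<^sup>+a. indicator {a. Q a} a * ennreal (2 * q) \<partial>lborel)"
  proof (rule nn_integral_cong)
    fix a
    have "(\<integral>\<^sup>+b. indicator ?S (a, b) \<partial>lborel)
      = (\<integral>\<^sup>+b. indicator {a. Q a} a * indicator {g a - q<..<g a + q} b \<partial>lborel)"
      by (intro nn_integral_cong) (auto simp: indicator_def)
    also have "\<dots> = indicator {a. Q a} a * ennreal (2 * q)"
      using q by (subst nn_integral_cmult_indicator) auto
    finally show "(\<integral>\<^sup>+b. indicator ?S (a, b) \<partial>lborel) = indicator {a. Q a} a * ennreal (2 * q)" .
  qed
  also have "\<dots> = emeasure lborel {a. Q a} * ennreal (2 * q)"
    by (subst nn_integral_multc) auto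
  finally show ?thesis .
qed

lemma emeasure_strip:
  assumes "0 < L" "0 < w"
  shows "emeasure pl (strip c d \<sigma> L w) = ennreal (4 * L * w)"
proof -
  have "{a. \<bar>a - c\<bar> < L} = {c - L<..<c + L}" by auto
  then have "emeasure lborel {a. \<bar>a - c\<bar> < L} = ennreal (2 * L)" using assms by simp
  moreover have "strip c d \<sigma> L w = {z. \<bar>fst z - c\<bar> < L \<and> \<bar>snd z - (d + \<sigma> * (fst z - c))\<bar> < w}"
    by (auto simp: strip_def algebra_simps)
  ultimately show ?thesis
    using emeasure_graph_band[of "\<lambda>a. \<bar>a - c\<bar> < L" "\<lambda>a. d + \<sigma> * (a - c)" w] assms
    by (simp add: ennreal_mult''[symmetric] mult_ac)
qed

lemma strip_sets[measurable]: "strip c d \<sigma> L w \<in> sets (borel \<Otimes>\<^sub>M borel)"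
  using strip_measurable[of c d \<sigma> L w] by (simp add: pred_def space_pair_measure)

lemma
  fixes S :: "(real \<times> real) set"
  assumes "S \<in> sets (borel \<Otimes>\<^sub>M borel)"
  shows plane_set_lebesgue: "S \<in> sets lebesgue"
    and emeasure_lebesgue_plane: "emeasure lebesgue S = emeasure pl S"
proof -
  have "S \<in> sets borel" using assms by (simp only: borel_prod)
  then show "S \<in> sets lebesgue" "emeasure lebesgue S = emeasure pl S"
    by (simp_all add: lborel_prod)
qed

text \<open>A nonempty \<open>V_set\<close> forces the slope to be at most 3/2 in modulus, since
  \<open>v\<close> takes values in [0,1] and \<open>theta\<close> has half-width at most 1/2; hence
  the cosine is at least 1/2 in modulus. The columns carrying \<open>V_set\<close> have fibres of
  length at most \<open>2 * w\<close>, so their measure is at least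
  \<open>\<delta> * (L * w / 8) / (2 * w)\<close>.\<close>

lemma R_delta_strip:
  assumes R: "R \<in> R_delta v w \<delta>" and w: "0 < w" and \<delta>: "0 < \<delta>" and v: "\<And>a. 0 \<le> v a \<and> v a \<le> 1"
    and v0[measurable]: "v0 \<in> borel_measurable borel" and ae: "AE a in lborel. v a = v0 a"
    and nz: "measure lebesgue (rect_set R) \<noteq> 0"
  obtains c d \<sigma> L where "w \<le> L" "rect_set R \<subseteq> strip c d \<sigma> L w"
    "L * w / 8 \<le> measure lebesgue (rect_set R)"
    "\<delta> * L / 16 \<le> measure lborel {a. \<bar>a - c\<bar> < L \<and> \<bar>v0 a - \<sigma>\<bar> \<le> w / (2 * L)}"
proof -
  obtain c \<phi> L where Req: "R = (c, \<phi>, L, w)" and L: "w \<le> L"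
    and dens: "\<delta> * measure lebesgue (rect_set R) \<le> measure lebesgue (V_set v R)"
    using R by (cases R) (auto simp: R_delta_def rect_width_def rect_length_def)
  let ?\<mu> = "measure lebesgue (rect_set R)"
  have L0: "0 < L" using w L by linarith
  have "0 < \<delta> * ?\<mu>" using nz \<delta> by (simp add: zero_less_measure_iff)
  then have "V_set v R \<noteq> {}" using dens by auto
  then obtain p where "v (fst p) \<in> theta R" by (auto simp: V_set_def)
  then have th: "\<bar>v (fst p) - tan \<phi>\<bar> \<le> w / (2 * L)" and c0: "cos \<phi> \<noteq> 0"
    by (auto simp: theta_def Req split: if_splits)
  have "w / (2 * L) \<le> 1 / 2" using L L0 by simp
  then have "\<bar>tan \<phi>\<bar> \<le> 3 / 2" using th v[of "fst p"] by linarith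
  then have "(tan \<phi>)\<^sup>2 \<le> (3 / 2)\<^sup>2" by (simp add: abs_le_square_iff[symmetric])
  moreover have "(cos \<phi>)\<^sup>2 * (1 + (tan \<phi>)\<^sup>2) = 1"
    using c0 sin_cos_squared_add2[of \<phi>] by (simp add: tan_def field_simps)
  ultimately have "1 \<le> (cos \<phi>)\<^sup>2 * (1 + (3 / 2)\<^sup>2)"
    by (smt (verit) mult_left_mono zero_le_power2)
  then have "(1 / 2)\<^sup>2 \<le> (cos \<phi>)\<^sup>2" by (simp add: power2_eq_square)
  then have C: "1 / 2 \<le> \<bar>cos \<phi>\<bar>" using abs_le_square_iff[of "1 / 2" "cos \<phi>"] by simp
  note sub = rect_subset_strip[OF C L, of c]
  have fin: "emeasure lebesgue (rect_set R) < \<infinity>"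
  proof -
    have "emeasure lebesgue (rect_set R) \<le> emeasure lebesgue (strip (fst c) (snd c) (tan \<phi>) L w)"
      using sub by (intro emeasure_mono plane_set_lebesgue strip_sets) (simp add: Req)
    also have "\<dots> < \<infinity>" using L0 w by (simp add: emeasure_lebesgue_plane emeasure_strip)
    finally show ?thesis .
  qed
  then have \<mu>: "emeasure lebesgue (rect_set R) = ennreal ?\<mu>" by (intro emeasure_eq_ennreal_measure) simp
  have area: "L * w / 8 \<le> ?\<mu>"
  proof -
    have "ennreal (4 * (L / 8) * (w / 4)) = emeasure lebesgue (strip (fst c) (snd c) (tan \<phi>) (L / 8) (w / 4))"
      using L0 w by (simp add: emeasure_lebesgue_plane emeasure_strip)
    also have "\<dots> \<le> ennreal ?\<mu>"
      unfolding \<mu>[symmetric] using strip_subset_rect[OF C w L, of c]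
      by (intro emeasure_mono plane_set_lebesgue rect_set_borel) (simp add: Req)
    finally show ?thesis by (simp add: ennreal_le_iff)
  qed
  define A where "A = {a. \<bar>a - fst c\<bar> < L \<and> \<bar>v0 a - tan \<phi>\<bar> \<le> w / (2 * L)}"
  define V where "V = {z. (\<bar>fst z - fst c\<bar> < L \<and> \<bar>v0 (fst z) - tan \<phi>\<bar> \<le> w / (2 * L)) \<and>
    \<bar>snd z - (snd c + tan \<phi> * (fst z - fst c))\<bar> < w}"
  have V_sets: "V \<in> sets (borel \<Otimes>\<^sub>M borel)"
  proof -
    have "{z \<in> space (borel \<Otimes>\<^sub>M borel). z \<in> V} \<in> sets (borel \<Otimes>\<^sub>M borel)"
      unfolding V_def mem_Collect_eq by measurable
    then show ?thesis by (simp add: space_pair_measure)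
  qed
  obtain N where N: "{a. v a \<noteq> v0 a} \<subseteq> N" "emeasure lborel N = 0" "N \<in> sets borel"
    using AE_E[OF ae] by auto
  \<comment> \<open>\<open>v\<close> agrees with its Borel version \<open>v0\<close> off a null set
    of columns, and the product of that set with a line is null in the plane.\<close>
  have "emeasure lebesgue (V_set v R) \<le> emeasure lebesgue V"
  proof (rule emeasure_mono_AE)
    have "emeasure pl (N \<times> (UNIV :: real set)) = 0"
      using N by (subst lborel.emeasure_pair_measure_Times) auto
    then have "N \<times> (UNIV :: real set) \<in> null_sets lborel"
      unfolding lborel_prod null_sets_def using pair_measureI[OF N(3), of UNIV borel] by (simp add: borel_prod[symmetric])
    then have "AE z in lborel. z \<notin> N \<times> (UNIV :: real set)" by (rule AE_not_in)
    then have "AE z in lebesgue. z \<notin> N \<times> (UNIV :: real set)" by (rule AE_completion)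
    then show "AE z in lebesgue. z \<in> V_set v R \<longrightarrow> z \<in> V"
    proof (rule AE_mp, intro AE_I2 impI)
      fix z :: "real \<times> real" assume "z \<notin> N \<times> UNIV" and z: "z \<in> V_set v R"
      then have "v (fst z) = v0 (fst z)" using N(1) by (cases z) auto
      moreover have "z \<in> strip (fst c) (snd c) (tan \<phi>) L w" "v (fst z) \<in> theta R"
        using z sub by (auto simp: V_set_def Req)
      ultimately show "z \<in> V"
        using c0 by (cases z) (auto simp: V_def strip_def theta_def Req algebra_simps)
    qed
    show "V \<in> sets lebesgue" by (rule plane_set_lebesgue[OF V_sets])
  qed
  also have "\<dots> = emeasure lborel A * ennreal (2 * w)"
    unfolding V_def A_def using w V_sets[unfolded V_def]
    by (subst emeasure_lebesgue_plane, simp, subst emeasure_graph_band) auto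
  finally have le: "emeasure lebesgue (V_set v R) \<le> emeasure lborel A * ennreal (2 * w)" .
  have "emeasure lborel A \<le> emeasure lborel {fst c - L<..<fst c + L}"
    by (intro emeasure_mono) (auto simp: A_def)
  then have A: "emeasure lborel A = ennreal (measure lborel A)"
    using L0 by (intro emeasure_eq_ennreal_measure) (auto simp: top_unique)
  have "ennreal (\<delta> * ?\<mu>) \<le> ennreal (measure lebesgue (V_set v R))" by (rule ennreal_leI[OF dens])
  also have "\<dots> \<le> emeasure lebesgue (V_set v R)" by (simp add: measure_def ennreal_enn2real_if)
  also have "\<dots> \<le> ennreal (measure lborel A * (2 * w))"
    using le w unfolding A by (subst ennreal_mult'') simp_all
  finally have "\<delta> * ?\<mu> \<le> measure lborel A * (2 * w)"
    using w by (subst (asm) ennreal_le_iff) auto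
  moreover have "\<delta> * (L * w / 8) \<le> \<delta> * ?\<mu>" using area \<delta> by (intro mult_left_mono) auto
  ultimately have "\<delta> * (L * w / 8) \<le> measure lborel A * (2 * w)" by (rule order_trans[rotated])
  then have "\<delta> * L / 16 * (2 * w) \<le> measure lborel A * (2 * w)" by (simp add: mult_ac)
  then have "\<delta> * L / 16 \<le> measure lborel A" using w by (simp only: mult_le_cancel_right)
  then show ?thesis using that[of L "fst c" "snd c" "tan \<phi>"] L sub area by (simp add: A_def Req)
qed

lemma rect_average_le:
  fixes f :: "real \<times> real \<Rightarrow> real" and F :: "real \<times> real \<Rightarrow> ennreal"
  assumes ae: "AE z in lborel. ennreal \<bar>f z\<bar> = F z" and sub: "S \<subseteq> T"
    and k: "0 < k" "k \<le> measure lebesgue S"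
  shows "ennreal \<bar>(1 / measure lebesgue S) * (\<integral>p\<in>S. f p \<partial>lebesgue)\<bar>
    \<le> ennreal (1 / k) * (\<integral>\<^sup>+z. (if z \<in> T then F z else 0) \<partial>lborel)"
proof -
  have "ennreal \<bar>\<integral>p\<in>S. f p \<partial>lebesgue\<bar> \<le> (\<integral>\<^sup>+p. ennreal (norm (indicator S p *\<^sub>R f p)) \<partial>lebesgue)"
  proof (cases "integrable lebesgue (\<lambda>p. indicator S p *\<^sub>R f p)")
    case True
    from integral_norm_bound_ennreal[OF this] show ?thesis by (simp add: set_lebesgue_integral_def)
  next
    \<comment> \<open>If \<open>f\<close> is not integrable over \<open>S\<close>, its integral is 0
      by convention.\<close>
    case False
    then show ?thesis by (simp add: set_lebesgue_integral_def not_integrable_integral_eq)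
  qed
  also have "\<dots> = (\<integral>\<^sup>+p. ennreal (norm (indicator S p *\<^sub>R f p)) \<partial>lborel)"
    by (rule nn_integral_completion)
  also have "\<dots> \<le> (\<integral>\<^sup>+z. (if z \<in> T then F z else 0) \<partial>lborel)"
    using ae by (intro nn_integral_mono_AE, elim AE_mp, intro AE_I2 impI) (use sub in \<open>auto simp: indicator_def\<close>)
  finally have le: "ennreal \<bar>\<integral>p\<in>S. f p \<partial>lebesgue\<bar> \<le> (\<integral>\<^sup>+z. (if z \<in> T then F z else 0) \<partial>lborel)" .
  have "ennreal \<bar>(1 / measure lebesgue S) * (\<integral>p\<in>S. f p \<partial>lebesgue)\<bar>
    = ennreal (1 / measure lebesgue S) * ennreal \<bar>\<integral>p\<in>S. f p \<partial>lebesgue\<bar>"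
    unfolding abs_mult by (subst ennreal_mult') auto
  also have "\<dots> \<le> ennreal (1 / k) * (\<integral>\<^sup>+z. (if z \<in> T then F z else 0) \<partial>lborel)"
    using k by (intro mult_mono le ennreal_leI divide_left_mono) auto
  finally show ?thesis .
qed

text \<open>The averages carry signs, so their supremum may be negative; its modulus is then at most
  that of any single average.\<close>

lemma maxop_le_SUP:
  "e2ennreal \<bar>maxop \<R> f x\<bar> \<le> (SUP R\<in>{R \<in> \<R>. x \<in> rect_set R}.
    ennreal \<bar>(1 / measure lebesgue (rect_set R)) * (\<integral>p\<in>rect_set R. f p \<partial>lebesgue)\<bar>)"
proof (cases "\<exists>R\<in>\<R>. x \<in> rect_set R")
  case False
  then have "maxop \<R> f x = 0" by (simp add: maxop_def)
  then show ?thesis by (simp add: e2ennreal_neg)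
next
  case True
  define X where "X = {R \<in> \<R>. x \<in> rect_set R}"
  define q where "q R = (1 / measure lebesgue (rect_set R)) * (\<integral>p\<in>rect_set R. f p \<partial>lebesgue)" for R
  define S where "S = (SUP R\<in>X. ennreal \<bar>q R\<bar>)"
  obtain R0 where R0: "R0 \<in> X" using True by (auto simp: X_def)
  have m: "maxop \<R> f x = (SUP R\<in>X. ereal (q R))" using True by (simp add: maxop_def X_def q_def)
  have q_le: "ereal \<bar>q R\<bar> \<le> enn2ereal S" if "R \<in> X" for R
  proof -
    have "enn2ereal (ennreal \<bar>q R\<bar>) \<le> enn2ereal S"
      unfolding S_def less_eq_ennreal.rep_eq[symmetric] by (rule SUP_upper[OF that])
    then show ?thesis by simp
  qed
  have "(SUP R\<in>X. ereal (q R)) \<le> enn2ereal S"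
    by (intro SUP_least order_trans[OF _ q_le]) auto
  moreover have "- (SUP R\<in>X. ereal (q R)) \<le> enn2ereal S"
  proof -
    have "ereal (q R0) \<le> (SUP R\<in>X. ereal (q R))" by (rule SUP_upper[OF R0])
    then have "- (SUP R\<in>X. ereal (q R)) \<le> - ereal (q R0)" by (simp only: ereal_minus_le_minus)
    also have "\<dots> \<le> ereal \<bar>q R0\<bar>" by simp
    also have "\<dots> \<le> enn2ereal S" by (rule q_le[OF R0])
    finally show ?thesis .
  qed
  ultimately have "\<bar>maxop \<R> f x\<bar> \<le> enn2ereal S" unfolding m by (rule ereal_abs_leI)
  then have "e2ennreal \<bar>maxop \<R> f x\<bar> \<le> e2ennreal (enn2ereal S)" by (rule e2ennreal_mono)
  then show ?thesis by (simp add: S_def X_def q_def)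
qed

text \<open>The quantity rounded up is \<open>2 ^ 32 / \<delta>\<^sup>2\<close>; rounding costs at
  most a factor 2, and \<open>ln 2 < 1\<close> gives the constant 3 + 33 = 36.\<close>

lemma grid_constant_le:
  fixes \<delta> :: real
  assumes "0 < \<delta>" "\<delta> \<le> 1"
  shows "3 + ln (real (nat \<lceil>256 / (\<delta> / 4096)\<^sup>2\<rceil>)) \<le> 36 * (1 + ln (1 / \<delta>))"
proof -
  let ?t = "256 / (\<delta> / 4096)\<^sup>2"
  have d2: "\<delta>\<^sup>2 \<le> 1" using assms by (simp add: power_le_one)
  have t: "?t = 2 ^ 32 / \<delta>\<^sup>2" by (simp add: power_divide)
  have "1 \<le> 2 ^ 32 / \<delta>\<^sup>2" using assms d2 by (simp add: field_simps)
  then have t1: "1 \<le> ?t" unfolding t .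
  then have "real (nat \<lceil>?t\<rceil>) \<le> 2 * ?t" using ceiling_correct[of ?t] by linarith
  moreover have D1: "1 \<le> real (nat \<lceil>?t\<rceil>)" using t1 ceiling_correct[of ?t] by linarith
  ultimately have "ln (real (nat \<lceil>?t\<rceil>)) \<le> ln (2 * ?t)" by simp
  also have "\<dots> = ln (2 ^ 33 * (1 / \<delta>)\<^sup>2)" unfolding t by (simp add: power_divide)
  also have "\<dots> = 33 * ln 2 + 2 * ln (1 / \<delta>)"
    using assms ln_realpow[of "2::real" 33] ln_realpow[of "1 / \<delta>" 2] by (subst ln_mult) simp_all
  also have "\<dots> \<le> 33 + 2 * ln (1 / \<delta>)" using ln_2_less_1 by simp
  finally have "ln (real (nat \<lceil>?t\<rceil>)) \<le> 33 + 2 * ln (1 / \<delta>)" .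
  moreover have "0 \<le> ln (1 / \<delta>)" using assms by simp
  ultimately show ?thesis by simp
qed

text \<open>No coarsest scale suits all rectangles, so \<open>l = 2 ^ K * w\<close> is sent to
  infinity. Each rectangle fits from some \<open>K\<close> on; as the third-shift changes with
  \<open>K\<close>, Fatou's lemma takes the place of monotone convergence.\<close>

theorem maxop_bound:
  fixes w \<delta> :: real and v :: "real \<Rightarrow> real" and f :: "real \<times> real \<Rightarrow> real"
  assumes w: "0 < w" and \<delta>: "0 < \<delta>" "\<delta> \<le> 1"
    and v: "v \<in> borel_measurable lebesgue" "\<And>a. 0 \<le> v a \<and> v a \<le> 1"
    and f: "f \<in> borel_measurable lebesgue"
  shows "(\<integral>\<^sup>+x. (e2ennreal \<bar>maxop (R_delta v w \<delta>) f x\<bar>)\<^sup>2 \<partial>lebesgue)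
    \<le> ennreal ((849346560 * (1 + ln (1 / \<delta>)))\<^sup>2) * (\<integral>\<^sup>+x. ennreal ((f x)\<^sup>2) \<partial>lebesgue)"
proof -
  obtain v0 where v0[measurable]: "v0 \<in> borel_measurable borel" and v_ae: "AE a in lborel. v a = v0 a"
    using completion_ex_borel_measurable_real[OF v(1)] by auto
  obtain f0 where f0: "f0 \<in> borel_measurable borel" and f_ae: "AE z in lborel. f z = f0 z"
    using completion_ex_borel_measurable_real[OF f] by auto
  define F where "F z = ennreal \<bar>f0 z\<bar>" for z
  have "f0 \<in> borel_measurable (borel \<Otimes>\<^sub>M borel)" using f0 by (simp only: borel_prod)
  then have F[measurable]: "F \<in> borel_measurable (borel \<Otimes>\<^sub>M borel)" unfolding F_def by measurable
  have F_ae: "AE z in lborel. ennreal \<bar>f z\<bar> = F z" using f_ae by (auto simp: F_def)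
  \<comment> \<open>The strips need \<open>156 * \<eta> \<le> \<delta> / 16\<close>, that is
    \<open>\<eta> \<le> \<delta> / 2496\<close>; 4096 is the next power of two.\<close>
  define \<eta> where "\<eta> = \<delta> / 4096"
  define D where "D = nat \<lceil>256 / \<eta>\<^sup>2\<rceil>"
  define M where "M = (12288 * (3 + ln (real D)))\<^sup>2"
  have sf: "slope_field (2 ^ K * w) w \<eta> v0 D" for K :: nat
    using w \<delta> v0 by (auto simp: slope_field_def \<eta>_def D_def)
  define T where "T K z = shifted_tmax (2 ^ K * w) w \<eta> v0 F 0 z + shifted_tmax (2 ^ K * w) w \<eta> v0 F (2 ^ K * w / 3) z"
    for K :: nat and z
  have S_meas[measurable]: "shifted_tmax (2 ^ K * w) w \<eta> v0 F s \<in> borel_measurable (borel \<Otimes>\<^sub>M borel)" for K s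
    by (rule shifted_tmax_measurable[OF sf F])
  have T_meas[measurable]: "T K \<in> borel_measurable (borel \<Otimes>\<^sub>M borel)" for K
    unfolding T_def by measurable
  define q where "q R = ennreal \<bar>(1 / measure lebesgue (rect_set R)) * (\<integral>p\<in>rect_set R. f p \<partial>lebesgue)\<bar>" for R
  have q_le: "\<forall>\<^sub>F K in sequentially. q R \<le> 960 * T K x" if R: "R \<in> R_delta v w \<delta>" "x \<in> rect_set R" for R x
  proof (cases "measure lebesgue (rect_set R) = 0")
    \<comment> \<open>With area 0 the average is 0, because \<open>1 / 0 = 0\<close>.\<close>
    case True
    then show ?thesis by (simp add: q_def)
  next
    case False
    obtain c d \<sigma> L where L: "w \<le> L" and sub: "rect_set R \<subseteq> strip c d \<sigma> L w"
      and area: "L * w / 8 \<le> measure lebesgue (rect_set R)"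
      and dens: "\<delta> * L / 16 \<le> measure lborel {a. \<bar>a - c\<bar> < L \<and> \<bar>v0 a - \<sigma>\<bar> \<le> w / (2 * L)}"
      by (rule R_delta_strip[OF R(1) w \<delta>(1) v(2) v0 v_ae False])
    have L0: "0 < L" using w L by linarith
    obtain K0 :: nat where K0: "6 * L / w < 2 ^ K0" using real_arch_pow[of 2 "6 * L / w"] by auto
    have "q R \<le> 960 * T K x" if K: "K0 \<le> K" for K
    proof -
      have "(2::real) ^ K0 \<le> 2 ^ K" using K by (intro power_increasing) auto
      then have "6 * L / w \<le> 2 ^ K" using K0 by linarith
      then have l: "6 * L \<le> 2 ^ K * w" using w by (simp add: field_simps)
      have "156 * \<eta> * L \<le> \<delta> * L / 16" using \<delta> L0 by (simp add: \<eta>_def)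
      then have dens': "156 * \<eta> * L \<le> measure lborel {a. \<bar>a - c\<bar> < L \<and> \<bar>v0 a - \<sigma>\<bar> \<le> w / (2 * L)}"
        using dens by (rule order_trans)
      have "q R \<le> ennreal (1 / (L * w / 8)) * (\<integral>\<^sup>+z. (if z \<in> strip c d \<sigma> L w then F z else 0) \<partial>lborel)"
        unfolding q_def using L0 w by (intro rect_average_le F_ae sub area) auto
      also have "\<dots> \<le> ennreal (1 / (L * w / 8)) * (ennreal (120 * L * w) * T K x)"
        unfolding T_def lborel_prod[symmetric] using R(2) sub
        by (intro mult_left_mono strip_le_shifted_tmax[OF sf L l dens' _ F]) auto
      also have "\<dots> = ennreal (1 / (L * w / 8) * (120 * L * w)) * T K x"
        using L0 w by (subst ennreal_mult') (auto simp: mult.assoc)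
      also have "1 / (L * w / 8) * (120 * L * w) = 960" using L0 w by (simp add: field_simps)
      finally show ?thesis by simp
    qed
    then show ?thesis unfolding eventually_sequentially by blast
  qed
  have point: "(e2ennreal \<bar>maxop (R_delta v w \<delta>) f x\<bar>)\<^sup>2 \<le> liminf (\<lambda>K. (960 * T K x)\<^sup>2)" for x
  proof -
    have "(e2ennreal \<bar>maxop (R_delta v w \<delta>) f x\<bar>)\<^sup>2 \<le> (SUP R\<in>{R \<in> R_delta v w \<delta>. x \<in> rect_set R}. q R)\<^sup>2"
      unfolding q_def by (intro power_mono maxop_le_SUP) auto
    also have "\<dots> \<le> liminf (\<lambda>K. (960 * T K x)\<^sup>2)"
      unfolding ennreal_SUP_power2
    proof (intro SUP_least Liminf_bounded)
      fix R assume "R \<in> {R \<in> R_delta v w \<delta>. x \<in> rect_set R}"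
      then have "\<forall>\<^sub>F K in sequentially. q R \<le> 960 * T K x" by (intro q_le) auto
      then show "\<forall>\<^sub>F K in sequentially. (q R)\<^sup>2 \<le> (960 * T K x)\<^sup>2"
        by (rule eventually_mono) (rule power_mono, simp_all)
    qed
    finally show ?thesis .
  qed
  have T_int: "(\<integral>\<^sup>+z. (960 * T K z)\<^sup>2 \<partial>pl)
      \<le> ennreal (1920\<^sup>2 * M) * (\<integral>\<^sup>+z. (F z)\<^sup>2 \<partial>pl)" for K
  proof -
    let ?A = "shifted_tmax (2 ^ K * w) w \<eta> v0 F 0" and ?B = "shifted_tmax (2 ^ K * w) w \<eta> v0 F (2 ^ K * w / 3)"
    let ?X = "\<integral>\<^sup>+z. (F z)\<^sup>2 \<partial>pl"
    have "(\<integral>\<^sup>+z. (960 * T K z)\<^sup>2 \<partial>pl)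
      \<le> (\<integral>\<^sup>+z. 960\<^sup>2 * (2 * (?A z)\<^sup>2 + 2 * (?B z)\<^sup>2) \<partial>pl)"
      unfolding power_mult_distrib T_def by (intro nn_integral_mono mult_left_mono ennreal_power2_add_le) auto
    also have "\<dots> = 960\<^sup>2 * (2 * (\<integral>\<^sup>+z. (?A z)\<^sup>2 \<partial>pl) + 2 * (\<integral>\<^sup>+z. (?B z)\<^sup>2 \<partial>pl))"
      by (simp add: nn_integral_cmult nn_integral_add)
    also have "\<dots> \<le> 960\<^sup>2 * (2 * (ennreal M * ?X) + 2 * (ennreal M * ?X))"
      using shifted_tmax_ineq[OF sf F, of K] unfolding M_def by (intro mult_left_mono add_mono) auto
    also have "\<dots> = ennreal (1920\<^sup>2) * (ennreal M * ?X)"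
    proof -
      have "960\<^sup>2 * (2 * x + 2 * x) = (960\<^sup>2 * (2 + 2)) * x" for x :: ennreal
        by (simp only: distrib_right mult.assoc)
      then show ?thesis by simp
    qed
    also have "\<dots> = ennreal (1920\<^sup>2 * M) * ?X"
      by (subst ennreal_mult') (auto simp: mult.assoc M_def)
    finally show ?thesis .
  qed
  have "(\<integral>\<^sup>+x. (e2ennreal \<bar>maxop (R_delta v w \<delta>) f x\<bar>)\<^sup>2 \<partial>lebesgue)
    = (\<integral>\<^sup>+x. (e2ennreal \<bar>maxop (R_delta v w \<delta>) f x\<bar>)\<^sup>2 \<partial>pl)"
    by (simp only: nn_integral_completion lborel_prod)
  also have "\<dots> \<le> (\<integral>\<^sup>+x. liminf (\<lambda>K. (960 * T K x)\<^sup>2) \<partial>pl)"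
    by (intro nn_integral_mono point)
  also have "\<dots> \<le> liminf (\<lambda>K. \<integral>\<^sup>+x. (960 * T K x)\<^sup>2 \<partial>pl)"
    by (intro nn_integral_liminf) measurable
  also have "\<dots> \<le> limsup (\<lambda>K. \<integral>\<^sup>+x. (960 * T K x)\<^sup>2 \<partial>pl)"
    by (intro Liminf_le_Limsup) simp
  also have "\<dots> \<le> ennreal (1920\<^sup>2 * M) * (\<integral>\<^sup>+z. (F z)\<^sup>2 \<partial>pl)"
    by (intro Limsup_bounded always_eventually allI T_int)
  also have "\<dots> \<le> ennreal ((849346560 * (1 + ln (1 / \<delta>)))\<^sup>2) * (\<integral>\<^sup>+z. (F z)\<^sup>2 \<partial>pl)"
  proof (intro mult_right_mono ennreal_leI)
    have D1: "1 \<le> real D"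
    proof -
      have "1 \<le> 256 / \<eta>\<^sup>2" using \<delta> power_le_one[of \<eta> 2] by (simp add: \<eta>_def field_simps)
      then show ?thesis unfolding D_def by linarith
    qed
    have "1920\<^sup>2 * M = (23592960 * (3 + ln (real D)))\<^sup>2" unfolding M_def power_mult_distrib by simp
    also have "\<dots> \<le> (23592960 * (36 * (1 + ln (1 / \<delta>))))\<^sup>2"
      using grid_constant_le[OF \<delta>] D1 by (intro power_mono mult_left_mono) (auto simp: D_def \<eta>_def)
    finally show "1920\<^sup>2 * M \<le> (849346560 * (1 + ln (1 / \<delta>)))\<^sup>2" by simp
  qed simp
  also have "(\<integral>\<^sup>+z. (F z)\<^sup>2 \<partial>pl) = (\<integral>\<^sup>+x. ennreal ((f x)\<^sup>2) \<partial>lebesgue)"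
    unfolding nn_integral_completion lborel_prod
    using f_ae by (intro nn_integral_cong_AE) (auto simp: F_def ennreal_power)
  finally show ?thesis .
qed

text \<open>The bound proved has power 1 of the logarithm; as \<open>1 + ln (1 / \<delta>)\<close>
  is at least 1, it is below its power 3/2. The summand 1 keeps the right side from vanishing at
  \<open>\<delta> = 1\<close>.\<close>

theorem theorem1p1:
  shows "\<exists>C>0. \<forall>(w::real) (\<delta>::real) (v::real \<Rightarrow> real) (f::real \<times> real \<Rightarrow> real).
     0 < w \<and> w \<le> 1 \<and> 0 < \<delta> \<and> \<delta> \<le> 1 \<and>
     v \<in> borel_measurable lebesgue \<and> (\<forall>a. 0 \<le> v a \<and> v a \<le> 1) \<and>
     f \<in> borel_measurable lebesgue \<and> integrable lebesgue (\<lambda>x. (f x)^2)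
     \<longrightarrow> (\<integral>\<^sup>+ x. (e2ennreal \<bar>maxop (R_delta v w \<delta>) f x\<bar>)^2 \<partial>lebesgue)
         \<le> ennreal ((C * (1 + ln (1 / \<delta>)) powr (3/2))^2 * (\<integral>x. (f x)^2 \<partial>lebesgue))"
proof (intro exI[of _ "849346560 :: real"] conjI allI impI)
  fix w \<delta> :: real and v :: "real \<Rightarrow> real" and f :: "real \<times> real \<Rightarrow> real"
  assume "0 < w \<and> w \<le> 1 \<and> 0 < \<delta> \<and> \<delta> \<le> 1 \<and>
     v \<in> borel_measurable lebesgue \<and> (\<forall>a. 0 \<le> v a \<and> v a \<le> 1) \<and>
     f \<in> borel_measurable lebesgue \<and> integrable lebesgue (\<lambda>x. (f x)^2)"
  then have h: "0 < w" "0 < \<delta>" "\<delta> \<le> 1" "v \<in> borel_measurable lebesgue" "\<And>a. 0 \<le> v a \<and> v a \<le> 1"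
    "f \<in> borel_measurable lebesgue" and int: "integrable lebesgue (\<lambda>x. (f x)\<^sup>2)" by auto
  let ?C = "849346560 :: real"
  have ln: "1 \<le> 1 + ln (1 / \<delta>)" using h by simp
  then have "1 + ln (1 / \<delta>) \<le> (1 + ln (1 / \<delta>)) powr (3/2)"
    using powr_mono[of 1 "3/2" "1 + ln (1 / \<delta>)"] by simp
  then have c: "(?C * (1 + ln (1 / \<delta>)))\<^sup>2 \<le> (?C * (1 + ln (1 / \<delta>)) powr (3/2))\<^sup>2"
    using ln by (intro power_mono mult_left_mono) auto
  have "(\<integral>\<^sup>+x. (e2ennreal \<bar>maxop (R_delta v w \<delta>) f x\<bar>)\<^sup>2 \<partial>lebesgue)
    \<le> ennreal ((?C * (1 + ln (1 / \<delta>)))\<^sup>2) * (\<integral>\<^sup>+x. ennreal ((f x)\<^sup>2) \<partial>lebesgue)"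
    by (rule maxop_bound) (use h in auto)
  also have "\<dots> \<le> ennreal ((?C * (1 + ln (1 / \<delta>)) powr (3/2))\<^sup>2) * (\<integral>\<^sup>+x. ennreal ((f x)\<^sup>2) \<partial>lebesgue)"
    by (intro mult_right_mono ennreal_leI c) simp
  also have "(\<integral>\<^sup>+x. ennreal ((f x)\<^sup>2) \<partial>lebesgue) = ennreal (\<integral>x. (f x)\<^sup>2 \<partial>lebesgue)"
    by (rule nn_integral_eq_integral[OF int]) simp
  also have "ennreal ((?C * (1 + ln (1 / \<delta>)) powr (3/2))\<^sup>2) * ennreal (\<integral>x. (f x)\<^sup>2 \<partial>lebesgue)
    = ennreal ((?C * (1 + ln (1 / \<delta>)) powr (3/2))\<^sup>2 * (\<integral>x. (f x)\<^sup>2 \<partial>lebesgue))"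
    by (rule ennreal_mult'[symmetric]) simp
  finally show "(\<integral>\<^sup>+x. (e2ennreal \<bar>maxop (R_delta v w \<delta>) f x\<bar>)\<^sup>2 \<partial>lebesgue)
    \<le> ennreal ((?C * (1 + ln (1 / \<delta>)) powr (3/2))\<^sup>2 * (\<integral>x. (f x)\<^sup>2 \<partial>lebesgue))" .
qed simp

end
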